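(* Let $c,\omega,\delta\in\mathbb R$, $\gamma\in\left(\frac12,1\right]$, $\omega\notin\pi\mathbb Z$, let $\{q_n\}_{n=1}^\infty\in l^1$ be a real sequence, and let $$b_n=\frac{c\sin(2\omega n+\delta)}{n^\gamma}+q_n,\qquad n\ge1.$$ Then for every $z\in\mathbb T\setminus\{1,-1,e^{\pm i\omega},-e^{\pm i\omega}\}$ there exists $F(z)\in\mathbb C$ such that the orthonormal polynomials $P_n$ associated to $\{b_n\}_{n=1}^\infty$ have the following asymptotics: $$P_n\left(z+\frac1z\right)=\frac{zF(z)}{1-z^2}\cdot\frac1{z^n}+\frac{z\overline{F(z)}}{z^2-1}\cdot z^n+o(1)\quad\text{as }n\to\infty.$$ The function $F$ is continuous in $\mathbb T\setminus\{1,-1,e^{\pm i\omega},-e^{\pm i\omega}\}$ and does not have zeros there. The spectrum of the Jacobi operator $\mathcal J=\mathcal J(1,b_n)$ is purely absolutely continuous on $(-2,2)\setminus\{\pm2\cos\omega\}$, and for almost all $\lambda\in(-2,2)$ the spectral density of $\mathcal J$ equals $$\rho'(\lambda)=\frac{\sqrt{4-\lambda^2}}{2\pi\left|F\left(\frac\lambda2-i\frac{\sqrt{4-\lambda^2}}2\right)\right|^2}.$$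
   Context: $\mathbb T$ is the unit circle in $\mathbb C$. The square root $\sqrt{4-\lambda^2}$ is positive for $\lambda\in(-2,2)$. $\mathcal J=\mathcal J(1,b_n)$ is the (bounded self-adjoint) operator in $l^2=l^2(\mathbb N)$ given by $(\mathcal Ju)_1=b_1u_1+u_2$ and $(\mathcal Ju)_n=u_{n-1}+b_nu_n+u_{n+1}$ for $n\ge2$. The polynomials (of the first kind) associated to $\{b_n\}$ are $P_1(\lambda)=1$, $P_2(\lambda)=\lambda-b_1$, $P_{n+1}(\lambda)=(\lambda-b_n)P_n(\lambda)-P_{n-1}(\lambda)$ for $n\ge2$. The polynomials of the second kind $Q_n$ satisfy the same recurrence for $n\ge2$ with $Q_1(\lambda)=0$, $Q_2(\lambda)=1$. Spectral density: for $\lambda\in\mathbb C\setminus\mathbb R$ the Weyl function $m(\lambda)$ is the unique number such that $\{Q_n(\lambda)+m(\lambda)P_n(\lambda)\}_{n\ge1}\in l^2$. The spectral measure $d\rho$ of $\mathcal J$ (the spectral measure of the first basis vector $e_1$) satisfies $m(\lambda)=\int_{\mathbb R}\frac{d\rho(x)}{x-\lambda}$ for $\lambda\in\mathbb C\setminus\mathbb R$. The spectral density is $\rho'(\lambda)=\frac1\pi\mathrm{Im}\,m(\lambda+i0)$ for a.a. $\lambda\in\mathbb R$. *)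

theory Defs
  imports "HOL-Probability.Probability"
begin

text \<open>Sequences indexed by \<open>n \<ge> 1\<close> are functions on \<^typ>\<open>nat\<close>; the entry at \<open>0\<close> is a dummy.
  It is required to vanish in \<open>l2\<close>, so that equality of functions is equality of sequences.\<close>

definition l2 :: "(nat \<Rightarrow> complex) set" where
  "l2 = {u. u 0 = 0 \<and> summable (\<lambda>n. (cmod (u n))\<^sup>2)}"

definition l2_inner :: "(nat \<Rightarrow> complex) \<Rightarrow> (nat \<Rightarrow> complex) \<Rightarrow> complex" where
  "l2_inner u v = (\<Sum>n. u n * cnj (v n))"

definition jacobi_op :: "(nat \<Rightarrow> real) \<Rightarrow> (nat \<Rightarrow> complex) \<Rightarrow> (nat \<Rightarrow> complex)" where
  "jacobi_op b u n =
     (if n = 0 then 0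
      else if n = 1 then of_real (b 1) * u 1 + u 2
      else u (n - 1) + of_real (b n) * u n + u (n + 1))"

fun first_kind :: "(nat \<Rightarrow> real) \<Rightarrow> nat \<Rightarrow> complex \<Rightarrow> complex" where
  "first_kind b 0 lam = 0"
| "first_kind b (Suc 0) lam = 1"
| "first_kind b (Suc (Suc 0)) lam = lam - of_real (b 1)"
| "first_kind b (Suc (Suc (Suc n))) lam =
     (lam - of_real (b (Suc (Suc n)))) * first_kind b (Suc (Suc n)) lam - first_kind b (Suc n) lam"

fun second_kind :: "(nat \<Rightarrow> real) \<Rightarrow> nat \<Rightarrow> complex \<Rightarrow> complex" where
  "second_kind b 0 lam = 0"
| "second_kind b (Suc 0) lam = 0"
| "second_kind b (Suc (Suc 0)) lam = 1"
| "second_kind b (Suc (Suc (Suc n))) lam =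
     (lam - of_real (b (Suc (Suc n)))) * second_kind b (Suc (Suc n)) lam - second_kind b (Suc n) lam"

definition weyl_m :: "(nat \<Rightarrow> real) \<Rightarrow> complex \<Rightarrow> complex" where
  "weyl_m b lam = (THE m. (\<lambda>n. second_kind b n lam + m * first_kind b n lam) \<in> l2)"

definition resolvent ::
  "((nat \<Rightarrow> complex) \<Rightarrow> (nat \<Rightarrow> complex)) \<Rightarrow> complex \<Rightarrow> (nat \<Rightarrow> complex) \<Rightarrow> (nat \<Rightarrow> complex)" where
  "resolvent A lam f = (THE u. u \<in> l2 \<and> (\<forall>n. A u n - lam * u n = f n))"

text \<open>The spectral measure of the vector \<open>f\<close> with respect to the self-adjoint operator \<open>A\<close> is the
  finite Borel measure whose Borel transform is \<open>\<langle>(A - \<lambda>)\<^sup>-\<^sup>1 f, f\<rangle>\<close>. For the Jacobi operator and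
  the first basis vector this function is \<open>weyl_m\<close>, because
  \<open>u n = second_kind b n \<lambda> + weyl_m b \<lambda> * first_kind b n \<lambda>\<close>
  solves \<open>(J - \<lambda>) u = e\<^sub>1\<close> and \<open>u 1 = weyl_m b \<lambda>\<close>.\<close>

definition spectral_measure ::
  "((nat \<Rightarrow> complex) \<Rightarrow> (nat \<Rightarrow> complex)) \<Rightarrow> (nat \<Rightarrow> complex) \<Rightarrow> real measure" where
  "spectral_measure A f =
     (THE \<mu>. finite_measure \<mu> \<and> sets \<mu> = sets borel \<and>
        (\<forall>lam. Im lam \<noteq> 0 \<longrightarrow>
           l2_inner (resolvent A lam f) f = (LINT x|\<mu>. 1 / (of_real x - lam))))"

definition purely_ac_on ::
  "((nat \<Rightarrow> complex) \<Rightarrow> (nat \<Rightarrow> complex)) \<Rightarrow> real set \<Rightarrow> bool" where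
  "purely_ac_on A S \<longleftrightarrow>
     (\<forall>f\<in>l2. absolutely_continuous (restrict_space lborel S)
                (restrict_space (spectral_measure A f) S))"

text \<open>\<open>has_spectral_density b x d\<close> says that the boundary value
  \<open>Im m(x + i0) / \<pi>\<close> exists and equals \<open>d\<close>.\<close>

definition has_spectral_density :: "(nat \<Rightarrow> real) \<Rightarrow> real \<Rightarrow> real \<Rightarrow> bool" where
  "has_spectral_density b x d \<longleftrightarrow>
     ((\<lambda>\<epsilon>. Im (weyl_m b (Complex x \<epsilon>)) / pi) \<longlongrightarrow> d) (at_right 0)"

definition punctured_circle :: "real \<Rightarrow> complex set" where
  "punctured_circle \<omega> =
     sphere 0 1 - {1, -1, cis \<omega>, cis (-\<omega>), - cis \<omega>, - cis (-\<omega>)}"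

end

theory Submission
  imports Defs "HOL-Computational_Algebra.Fundamental_Theorem_Algebra"
begin

text \<open>For \<open>\<bar>z\<bar> = 1\<close> the quantity \<open>G\<^sub>n = z\<^sup>n (P\<^sub>n\<^sub>+\<^sub>1 - z P\<^sub>n)\<close> satisfies
  \<open>G\<^sub>n = G\<^sub>n\<^sub>-\<^sub>1 + a\<^sub>n (G\<^sub>n\<^sub>-\<^sub>1 - z\<^sup>2\<^sup>n cnj G\<^sub>n\<^sub>-\<^sub>1)\<close> with \<open>a\<^sub>n = b\<^sub>n z / (z\<^sup>2 - 1)\<close>, and \<open>P\<^sub>n\<close> is recovered
  from it, so the asymptotics amount to convergence of \<open>G\<^sub>n\<close>; its limit is \<open>F\<close>. Off the resonances
  \<open>a\<^sub>n\<close> and \<open>a\<^sub>n z\<^sup>2\<^sup>n\<close> are conditionally summable with tails \<open>O(n\<^sup>-\<^sup>\<gamma>)\<close>, and a Harris-Lutz change of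
  variable by these tails leaves a perturbation of size \<open>n\<^sup>-\<^sup>2\<^sup>\<gamma>\<close>, which is summable locally
  uniformly in \<open>z\<close>. The Wronskian of \<open>P\<close> and \<open>Q\<close> keeps \<open>G\<^sub>n\<close> away from zero.

  If \<open>b\<close> is cut off after \<open>n\<close>, the Weyl function is explicit and its boundary values show that the
  spectral measure has the density \<open>sqrt (4 - x\<^sup>2) / (2 \<pi> \<bar>G\<^sub>n\<bar>\<^sup>2)\<close> on \<open>(-2, 2)\<close>. These measures
  converge weakly to one that orthonormalizes the polynomials of \<open>b\<close>, and their densities converge
  locally uniformly off the resonances. An orthonormalizing measure carries the spectral theory of
  the operator: by Bessel's inequality the Fourier coefficients of \<open>g / (x - \<lambda>)\<close> are in
  \<open>l\<^sup>2\<close> and give the resolvent, so its Borel transform is the Weyl function, and every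
  spectral measure is \<open>\<bar>g\<bar>\<^sup>2 \<mu>\<close> for some \<open>g\<close>.\<close>

section \<open>Orthogonal polynomials and Gauss quadrature\<close>

text \<open>The asymptotics are established only on the unit circle, so boundary values of the Weyl
  function of \<open>b\<close> cannot be reached by letting a decaying solution approach the circle
  from inside the disc. Cutting \<open>b\<close> off separates the two limits: for fixed
  \<open>n\<close> everything is built from polynomials and one square root and is continuous up to
  the real axis, and the limit in \<open>n\<close> then involves |z| = 1 alone. Weak convergence
  sees the masses of intervals only at continuity points, so atoms have to be excluded by bounds on
  the densities; this is why |G_n| must be bounded below uniformly in \<open>n\<close> and locally
  uniformly in \<open>z\<close>, and not merely in the limit.

  The operations \<open>weyl_m\<close>, \<open>resolvent\<close> and \<open>spectral_measure\<close>
  are definite descriptions, so each use needs existence and uniqueness. Uniqueness rests on the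
  absence of nonreal eigenvalues and on Stieltjes inversion. Existence is traced back to Gauss
  quadrature at the zeros of the polynomials, followed by a weak limit.\<close>

lemma first_kind_rec:
  assumes "n \<ge> 1"
  shows "first_kind b (Suc n) lam = (lam - of_real (b n)) * first_kind b n lam - first_kind b (n - 1) lam"
proof (cases "n = 1")
  case True
  then show ?thesis by (simp add: numeral_2_eq_2)
next
  case False
  then obtain k where "n = Suc (Suc k)"
    using assms by (metis One_nat_def Suc_diff_1 less_one not_less order_less_le zero_less_diff diff_Suc_1 less_eq_Suc_le gr0_conv_Suc)
  then show ?thesis by simp
qed

text \<open>At \<open>n = 1\<close> the right-hand side vanishes although
  \<open>second_kind b 2 lam = 1\<close>, so this recurrence starts one index later than that of
  \<open>first_kind\<close>, whose dummy entry 0 fits.\<close>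

lemma second_kind_rec:
  assumes "n \<ge> 2"
  shows "second_kind b (Suc n) lam = (lam - of_real (b n)) * second_kind b n lam - second_kind b (n - 1) lam"
proof -
  obtain k where "n = Suc (Suc k)"
    using assms by (metis add_2_eq_Suc le_iff_add)
  then show ?thesis by simp
qed

lemma cnj_first_kind: "cnj (first_kind b n lam) = first_kind b n (cnj lam)"
  by (induction b n lam rule: first_kind.induct) simp_all

lemma cnj_second_kind: "cnj (second_kind b n lam) = second_kind b n (cnj lam)"
  by (induction b n lam rule: second_kind.induct) simp_all

lemma first_kind_cong:
  assumes "\<And>k. 1 \<le> k \<Longrightarrow> k < n \<Longrightarrow> b k = b' k"
  shows "first_kind b n lam = first_kind b' n lam"
  using assms by (induction b n lam rule: first_kind.induct) auto

lemma second_kind_cong: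
  assumes "\<And>k. 1 \<le> k \<Longrightarrow> k < n \<Longrightarrow> b k = b' k"
  shows "second_kind b n lam = second_kind b' n lam"
  using assms by (induction b n lam rule: second_kind.induct) auto

lemma continuous_first_kind [continuous_intros]:
  "continuous_on A f \<Longrightarrow> continuous_on A (\<lambda>x. first_kind b n (f x))"
  by (induction b n "0 :: complex" rule: first_kind.induct) (auto intro!: continuous_intros)

lemma continuous_second_kind [continuous_intros]:
  "continuous_on A f \<Longrightarrow> continuous_on A (\<lambda>x. second_kind b n (f x))"
  by (induction b n "0 :: complex" rule: second_kind.induct) (auto intro!: continuous_intros)

text \<open>Used at \<open>mu = cnj lam\<close>, where the sum becomes a sum of squared moduli, and
  at two roots of \<open>first_kind b (Suc n)\<close>, where the right-hand side vanishes.\<close>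

lemma christoffel_darboux:
  "(lam - mu) * (\<Sum>k=1..n. first_kind b k lam * first_kind b k mu) =
     first_kind b (Suc n) lam * first_kind b n mu - first_kind b n lam * first_kind b (Suc n) mu"
proof (induction n)
  case (Suc n)
  have "(lam - mu) * (\<Sum>k=1..Suc n. first_kind b k lam * first_kind b k mu)
      = (lam - mu) * (\<Sum>k=1..n. first_kind b k lam * first_kind b k mu)
        + (lam - mu) * (first_kind b (Suc n) lam * first_kind b (Suc n) mu)"
    by (simp add: distrib_left)
  then show ?case
    unfolding Suc.IH by (simp add: first_kind_rec algebra_simps)
qed simp

text \<open>Both sequences solve the same recurrence, in which \<open>b\<close> drops out of the
  determinant. The value 1 forbids simultaneous smallness of consecutive terms and is the source of
  every nonvanishing statement on the circle.\<close>

lemma wronskian: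
  assumes "n \<ge> 1"
  shows "first_kind b n lam * second_kind b (Suc n) lam
    - second_kind b n lam * first_kind b (Suc n) lam = 1"
  using assms
proof (induction n rule: dec_induct)
  case base
  then show ?case by simp
next
  case (step m)
  have "first_kind b (Suc m) lam * second_kind b (Suc (Suc m)) lam
      - second_kind b (Suc m) lam * first_kind b (Suc (Suc m)) lam
    = first_kind b m lam * second_kind b (Suc m) lam - second_kind b m lam * first_kind b (Suc m) lam"
    using step.hyps by (simp add: first_kind_rec second_kind_rec algebra_simps)
  then show ?case using step by simp
qed

lemma sum_first_kind_cnj:
  "(\<Sum>k=1..n. first_kind b k lam * first_kind b k (cnj lam))
    = of_real (\<Sum>k=1..n. (cmod (first_kind b k lam))\<^sup>2)"
  by (simp add: cnj_first_kind[symmetric] complex_norm_square flip: of_real_power)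

lemma sum_norm_first_kind_ge_1:
  assumes "n \<ge> 1"
  shows "(\<Sum>k=1..n. (cmod (first_kind b k lam))\<^sup>2) \<ge> 1"
proof -
  have "(\<Sum>k=1..n. (cmod (first_kind b k lam))\<^sup>2) \<ge> (cmod (first_kind b 1 lam))\<^sup>2"
    using assms by (intro member_le_sum) auto
  then show ?thesis by simp
qed

lemma summable_square_tendsto_zero:
  fixes u :: "nat \<Rightarrow> complex"
  assumes "summable (\<lambda>n. (cmod (u n))\<^sup>2)"
  shows "u \<longlonglongrightarrow> 0"
proof -
  have "(\<lambda>n. sqrt ((cmod (u n))\<^sup>2)) \<longlonglongrightarrow> sqrt 0"
    by (intro tendsto_real_sqrt summable_LIMSEQ_zero assms)
  then show ?thesis by (simp add: tendsto_norm_zero_iff)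
qed

text \<open>If \<open>first_kind b\<close> were square summable, the right-hand side of the Christoffel-Darboux
  formula at \<open>lam\<close> and \<open>cnj lam\<close> would tend to zero.\<close>

lemma first_kind_not_in_l2:
  assumes "Im lam \<noteq> 0"
  shows "(\<lambda>n. first_kind b n lam) \<notin> l2"
proof
  assume "(\<lambda>n. first_kind b n lam) \<in> l2"
  then have u: "(\<lambda>n. first_kind b n lam) \<longlonglongrightarrow> 0"
    by (auto simp: l2_def intro: summable_square_tendsto_zero)
  have v: "(\<lambda>n. first_kind b n (cnj lam)) \<longlonglongrightarrow> 0"
    using tendsto_cnj[OF u] by (simp add: cnj_first_kind)
  have "(\<lambda>n. first_kind b (Suc n) lam * first_kind b n (cnj lam)
      - first_kind b n lam * first_kind b (Suc n) (cnj lam)) \<longlonglongrightarrow> 0 * 0 - 0 * 0"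
    by (intro tendsto_intros u v LIMSEQ_Suc)
  then have "(\<lambda>n. norm ((lam - cnj lam) * of_real (\<Sum>k=1..n. (cmod (first_kind b k lam))\<^sup>2))) \<longlonglongrightarrow> 0"
    unfolding christoffel_darboux[symmetric] sum_first_kind_cnj by (intro tendsto_norm_zero) simp
  moreover have "norm ((lam - cnj lam) * of_real (\<Sum>k=1..n. (cmod (first_kind b k lam))\<^sup>2)) \<ge> 2 * \<bar>Im lam\<bar>"
    if "n \<ge> 1" for n
  proof -
    have "norm (lam - cnj lam) = 2 * \<bar>Im lam\<bar>" by (simp add: complex_diff_cnj norm_mult)
    then show ?thesis
      using sum_norm_first_kind_ge_1[OF that, of b lam]
      by (simp add: norm_mult mult_le_cancel_left1 del: of_real_sum)
  qed
  ultimately have "2 * \<bar>Im lam\<bar> \<le> 0"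
    by (intro tendsto_lowerbound[of _ 0 sequentially]) (auto intro: eventually_sequentiallyI[of 1])
  then show False using assms by simp
qed

lemma jacobi_solution:
  assumes "u 0 = 0" and "\<And>n. n \<ge> 1 \<Longrightarrow> jacobi_op b u n = lam * u n"
  shows "u n = u 1 * first_kind b n lam"
proof (induction n rule: less_induct)
  case (less n)
  consider "n = 0" | "n = 1" | "n = 2" | "n \<ge> 3" by linarith
  then show ?case
  proof cases
    case 3
    then show ?thesis using assms(2)[of 1] by (simp add: jacobi_op_def numeral_2_eq_2 algebra_simps)
  next
    case 4
    then obtain m where m: "n = Suc m" "m \<ge> 2" by (cases n) auto
    have "u (Suc m) = (lam - of_real (b m)) * u m - u (m - 1)"
      using assms(2)[of m] m(2) by (simp add: jacobi_op_def algebra_simps)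
    moreover have "u m = u 1 * first_kind b m lam" "u (m - 1) = u 1 * first_kind b (m - 1) lam"
      using m less[of m] less[of "m - 1"] by auto
    ultimately show ?thesis
      using m by (simp add: first_kind_rec algebra_simps)
  qed (use assms in auto)
qed

lemma scaled_in_l2_iff:
  assumes "c \<noteq> 0"
  shows "(\<lambda>n. c * u n) \<in> l2 \<longleftrightarrow> u \<in> l2"
  using assms by (auto simp: l2_def norm_mult power_mult_distrib)

lemma norm_square_add_le:
  "(cmod (z + w))\<^sup>2 \<le> 2 * (cmod z)\<^sup>2 + 2 * (cmod w)\<^sup>2"
proof -
  have "(cmod (z + w))\<^sup>2 \<le> (cmod z + cmod w)\<^sup>2"
    by (intro power_mono norm_triangle_ineq) auto
  also have "\<dots> \<le> 2 * (cmod z)\<^sup>2 + 2 * (cmod w)\<^sup>2"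
    using sum_squares_bound[of "cmod z" "cmod w"] by (simp add: power2_sum)
  finally show ?thesis .
qed

lemma norm_mult_le_squares: "cmod (z * w) \<le> (cmod z)\<^sup>2 + (cmod w)\<^sup>2"
proof -
  have "0 \<le> cmod z * cmod w" by simp
  then show ?thesis
    using sum_squares_bound[of "cmod z" "cmod w"] unfolding norm_mult by linarith
qed

lemma l2_diff:
  assumes "u \<in> l2" "v \<in> l2"
  shows "(\<lambda>n. u n - v n) \<in> l2"
proof -
  have "norm ((cmod (u n - v n))\<^sup>2) \<le> 2 * (cmod (u n))\<^sup>2 + 2 * (cmod (v n))\<^sup>2" for n
    using norm_square_add_le[of "u n" "- v n"] by simp
  moreover have "summable (\<lambda>n. 2 * (cmod (u n))\<^sup>2 + 2 * (cmod (v n))\<^sup>2)"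
    using assms by (intro summable_add summable_mult) (auto simp: l2_def)
  ultimately have "summable (\<lambda>n. (cmod (u n - v n))\<^sup>2)"
    by (rule summable_comparison_test'[where N = 0, rotated])
  then show ?thesis using assms by (auto simp: l2_def)
qed

text \<open>A difference of two solutions is a square summable multiple of
  \<open>first_kind b\<close>, hence zero. This makes the definite description in
  \<open>resolvent\<close> meaningful.\<close>

lemma jacobi_l2_solution_unique:
  assumes "Im lam \<noteq> 0" and "u \<in> l2" "v \<in> l2"
    and "\<And>n. jacobi_op b u n - lam * u n = f n" "\<And>n. jacobi_op b v n - lam * v n = f n"
  shows "u = v"
proof -
  define w where "w = (\<lambda>n. u n - v n)"
  have "w \<in> l2" unfolding w_def by (rule l2_diff) fact+
  have w0: "w 0 = 0" using assms by (auto simp: w_def l2_def)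
  have eq: "jacobi_op b u n - lam * u n = jacobi_op b v n - lam * v n" for n
    using assms by simp
  have "jacobi_op b w n = lam * w n" for n
    using eq[of n] w0 by (cases "n = 0"; cases "n = 1") (simp_all add: jacobi_op_def w_def algebra_simps)
  then have sol: "w n = w 1 * first_kind b n lam" for n
    by (intro jacobi_solution w0)
  then have "w = (\<lambda>n. w 1 * first_kind b n lam)" by blast
  with \<open>w \<in> l2\<close> have "(\<lambda>n. w 1 * first_kind b n lam) \<in> l2" by simp
  then have "w 1 = 0"
    using first_kind_not_in_l2[OF assms(1), of b] scaled_in_l2_iff[of "w 1" "\<lambda>n. first_kind b n lam"]
    by blast
  then have "u n - v n = 0" for n using sol[of n] by (simp add: w_def)
  then show ?thesis by (intro ext) simp
qed

text \<open>Two candidates differ by a square summable multiple of \<open>first_kind b\<close>, so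
  exhibiting one candidate determines the description.\<close>

lemma weyl_m_eqI:
  assumes "Im lam \<noteq> 0" and "(\<lambda>n. second_kind b n lam + m * first_kind b n lam) \<in> l2"
  shows "weyl_m b lam = m"
  unfolding weyl_m_def
proof (rule the_equality)
  fix m' assume "(\<lambda>n. second_kind b n lam + m' * first_kind b n lam) \<in> l2"
  from l2_diff[OF this assms(2)] have "(\<lambda>n. (m' - m) * first_kind b n lam) \<in> l2"
    by (simp add: algebra_simps)
  then show "m' = m"
    using first_kind_not_in_l2[OF assms(1), of b] scaled_in_l2_iff[of "m' - m" "\<lambda>n. first_kind b n lam"]
    by auto
qed fact

text \<open>Here |lam - b_n| >= 2, so the recurrence gives |P_(n+1)| - |P_n| >= |P_n| - |P_(n-1)|,
  and the increments of the moduli start nonnegative. Hence no roots lie outside the disc of radius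
  \<open>B + 2\<close>, which later bounds all supports.\<close>

lemma norm_first_kind_mono:
  assumes "\<forall>k\<ge>1. \<bar>b k\<bar> \<le> B" and "cmod lam \<ge> B + 2"
  shows "cmod (first_kind b n lam) \<le> cmod (first_kind b (Suc n) lam)"
proof (induction n)
  case (Suc n)
  let ?P = "first_kind b"
  have "2 * cmod (?P (Suc n) lam) - cmod (?P n lam)
      \<le> cmod (lam - of_real (b (Suc n))) * cmod (?P (Suc n) lam) - cmod (?P n lam)"
    using norm_triangle_ineq2[of lam "of_real (b (Suc n))"] assms(1)[rule_format, of "Suc n"] assms(2)
    by (intro diff_right_mono mult_right_mono) auto
  also have "\<dots> \<le> cmod (?P (Suc (Suc n)) lam)"
  proof -
    have "?P (Suc (Suc n)) lam = (lam - of_real (b (Suc n))) * ?P (Suc n) lam - ?P n lam"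
      using first_kind_rec[of "Suc n" b lam] by simp
    then show ?thesis
      using norm_triangle_ineq2[of "(lam - of_real (b (Suc n))) * ?P (Suc n) lam" "?P n lam"]
      by (simp only: norm_mult)
  qed
  finally show ?case using Suc by linarith
qed simp

lemma first_kind_root_bound:
  assumes "\<forall>k\<ge>1. \<bar>b k\<bar> \<le> B" and "first_kind b (Suc n) lam = 0"
  shows "cmod lam < B + 2"
proof (rule ccontr)
  assume "\<not> ?thesis"
  then have "cmod (first_kind b n lam) \<le> cmod (first_kind b (Suc n) lam)" for n
    by (intro norm_first_kind_mono[OF assms(1)]) auto
  then have "cmod (first_kind b (Suc 0) lam) \<le> cmod (first_kind b (Suc n) lam)"
    by (rule lift_Suc_mono_le) simp
  then show False using assms(2) by simp
qed

text \<open>The same polynomials as elements of the polynomial ring, where degree, derivative and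
  factorization into linear factors are available.\<close>

fun first_kind_poly :: "(nat \<Rightarrow> real) \<Rightarrow> nat \<Rightarrow> complex poly" where
  "first_kind_poly b 0 = 0"
| "first_kind_poly b (Suc 0) = 1"
| "first_kind_poly b (Suc (Suc n)) =
     [:- of_real (b (Suc n)), 1:] * first_kind_poly b (Suc n) - first_kind_poly b n"

lemma poly_first_kind_poly: "poly (first_kind_poly b n) lam = first_kind b n lam"
  by (induction b n rule: first_kind_poly.induct) (simp_all add: first_kind_rec algebra_simps)

text \<open>The last conjunct carries the induction, since the recurrence reaches two indices
  back.\<close>

lemma degree_first_kind_poly:
  "first_kind_poly b (Suc n) \<noteq> 0 \<and> degree (first_kind_poly b (Suc n)) = n
    \<and> (n \<ge> 1 \<longrightarrow> degree (first_kind_poly b n) = n - 1)"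
proof (induction n)
  case (Suc n)
  let ?p = "first_kind_poly b (Suc n)" and ?q = "first_kind_poly b n"
  have deg: "degree ([:- of_real (b (Suc n)), 1:] * ?p) = Suc n"
    using Suc by (subst degree_mult_eq) auto
  have "degree ?q < Suc n"
    using Suc by (cases n) auto
  then have "degree (first_kind_poly b (Suc (Suc n))) = Suc n"
    using deg degree_add_eq_left[of "- ?q" "[:- of_real (b (Suc n)), 1:] * ?p"]
    by (simp del: mult_pCons_left)
  then show ?case using Suc by auto
qed simp

text \<open>The confluent case \<open>mu = lam\<close> of the Christoffel-Darboux formula. At a real
  point the right-hand side is a sum of squares, so roots there are simple.\<close>

lemma pderiv_first_kind_poly:
  "poly (pderiv (first_kind_poly b (Suc n))) lam * first_kind b n lam
     - poly (pderiv (first_kind_poly b n)) lam * first_kind b (Suc n) lam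
   = (\<Sum>k=1..n. (first_kind b k lam)\<^sup>2)"
proof (induction n)
  case (Suc n)
  have d: "poly (pderiv (first_kind_poly b (Suc (Suc n)))) lam =
      first_kind b (Suc n) lam + (lam - of_real (b (Suc n))) * poly (pderiv (first_kind_poly b (Suc n))) lam
      - poly (pderiv (first_kind_poly b n)) lam"
    by (simp add: pderiv_diff pderiv_mult pderiv_pCons poly_first_kind_poly del: mult_pCons_left)
  have e: "first_kind b (Suc (Suc n)) lam
      = (lam - of_real (b (Suc n))) * first_kind b (Suc n) lam - first_kind b n lam"
    using first_kind_rec[of "Suc n" b lam] by simp
  show ?case
    unfolding d e
    using Suc.IH by (simp add: algebra_simps power2_eq_square del: first_kind_poly.simps)
qed simp

text \<open>The conjugate of a root is a root, so the right-hand side of the Christoffel-Darboux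
  formula at \<open>lam\<close> and \<open>cnj lam\<close> vanishes, while the sum on the left is at
  least 1.\<close>

lemma first_kind_root_real:
  assumes "first_kind b (Suc n) lam = 0" and "n \<ge> 1"
  shows "Im lam = 0"
proof -
  have "first_kind b (Suc n) (cnj lam) = 0"
    using assms(1) by (metis cnj_first_kind complex_cnj_zero)
  then have "(lam - cnj lam) * (\<Sum>k=1..n. first_kind b k lam * first_kind b k (cnj lam)) = 0"
    using assms by (simp only: christoffel_darboux) simp
  moreover have "(\<Sum>k=1..n. (cmod (first_kind b k lam))\<^sup>2) \<noteq> 0"
    using sum_norm_first_kind_ge_1[OF assms(2), of b lam] by auto
  ultimately have "lam - cnj lam = 0"
    by (simp only: sum_first_kind_cnj mult_eq_0_iff of_real_eq_0_iff) blast
  then show ?thesis by (simp add: complex_eq_iff)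
qed

definition first_kind_real :: "(nat \<Rightarrow> real) \<Rightarrow> nat \<Rightarrow> real \<Rightarrow> real" where
  "first_kind_real b n x = Re (first_kind b n (of_real x))"

lemma first_kind_of_real: "first_kind b n (of_real x) = of_real (first_kind_real b n x)"
proof -
  have "cnj (first_kind b n (of_real x)) = first_kind b n (of_real x)"
    by (simp add: cnj_first_kind)
  then show ?thesis by (simp add: first_kind_real_def complex_eq_iff)
qed

lemma first_kind_real_1 [simp]: "first_kind_real b (Suc 0) x = 1" "first_kind_real b 0 x = 0"
  by (simp_all add: first_kind_real_def)

lemma sum_first_kind_real_ge_1:
  assumes "n \<ge> 1"
  shows "(\<Sum>k=1..n. (first_kind_real b k x)\<^sup>2) \<ge> 1"
  using sum_norm_first_kind_ge_1[OF assms, of b "of_real x"] by (simp add: first_kind_of_real)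

lemma continuous_first_kind_real [continuous_intros]:
  "continuous_on A (first_kind_real b n)"
  unfolding first_kind_real_def by (intro continuous_intros)

lemma first_kind_roots:
  assumes "n \<ge> 1" and "\<forall>k\<ge>1. \<bar>b k\<bar> \<le> B"
  shows "\<exists>X. finite X \<and> card X = n \<and> (\<forall>x\<in>X. \<bar>x\<bar> \<le> B + 2 \<and> first_kind_real b (Suc n) x = 0)"
proof -
  define p where "p = first_kind_poly b (Suc n)"
  define Z where "Z = {z. poly p z = 0}"
  have p: "p \<noteq> 0" "degree p = n" using degree_first_kind_poly[of b n] by (auto simp: p_def)
  have Z: "first_kind b (Suc n) z = 0 \<and> z = of_real (Re z) \<and> cmod z \<le> B + 2" if "z \<in> Z" for z
  proof -
    have *: "first_kind b (Suc n) z = 0"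
      using that by (simp add: Z_def p_def poly_first_kind_poly)
    have "Im z = 0" using first_kind_root_real[OF * assms(1)] .
    then show ?thesis using * first_kind_root_bound[OF assms(2) *] by (simp add: complex_eq_iff)
  qed
  \<comment> \<open>At a double root the confluent Christoffel-Darboux sum would vanish, but its
    squares are nonnegative and the first one is 1. Without double roots the number of roots equals
    the degree \<open>n\<close>.\<close>
  have "rsquarefree p"
    unfolding rsquarefree_roots
  proof (intro allI notI)
    fix z assume z: "poly p z = 0 \<and> poly (pderiv p) z = 0"
    then have "z \<in> Z" by (simp add: Z_def)
    with Z obtain x where zx: "z = of_real x" and root: "first_kind b (Suc n) z = 0" by metis
    have "(\<Sum>k=1..n. (first_kind b k z)\<^sup>2) = 0"
      using pderiv_first_kind_poly[of b n z] z root by (simp add: p_def)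
    then have "(\<Sum>k=1..n. (first_kind_real b k x)\<^sup>2) = 0"
      by (simp add: zx first_kind_of_real flip: of_real_power of_real_sum)
    then show False using sum_first_kind_real_ge_1[OF assms(1), of b x] by simp
  qed
  then have "smult (lead_coeff p) (\<Prod>z|poly p z = 0. [:-z, 1:]) = p"
    by (rule complex_poly_decompose_rsquarefree)
  moreover have "degree (smult (lead_coeff p) (\<Prod>z|poly p z = 0. [:-z, 1:])) = card Z"
    using p(1) by (simp add: degree_prod_eq_sum_degree Z_def)
  ultimately have card: "card Z = n" using p by simp
  have fin: "finite Z" unfolding Z_def by (rule poly_roots_finite) fact
  have inj: "inj_on Re Z" by (rule inj_onI) (metis Z)
  show ?thesis
  proof (intro exI[of _ "Re ` Z"] conjI ballI)
    show "finite (Re ` Z)" "card (Re ` Z) = n" using fin card inj by (auto simp: card_image)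
    fix x assume "x \<in> Re ` Z"
    then obtain z where z: "z \<in> Z" "x = Re z" by auto
    show "\<bar>x\<bar> \<le> B + 2" using Z[OF z(1)] abs_Re_le_cmod[of z] z by linarith
    show "first_kind_real b (Suc n) x = 0"
      using Z[OF z(1)] z first_kind_of_real[of b "Suc n" x] by simp
  qed
qed

text \<open>Summing Bessel's inequality for the standard basis vectors over the whole basis gives an
  equality, so each of the inequalities is one.\<close>

lemma orthonormal_rows_imp_columns:
  fixes v :: "'i \<Rightarrow> 'j \<Rightarrow> real"
  assumes "finite X" "finite J" "card X = card J"
    and orth: "\<And>x y. x \<in> X \<Longrightarrow> y \<in> X \<Longrightarrow> (\<Sum>j\<in>J. v x j * v y j) = of_bool (x = y)"
    and "j \<in> J" "k \<in> J"
  shows "(\<Sum>x\<in>X. v x j * v x k) = of_bool (j = k)"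
proof -
  \<comment> \<open>\<open>r j\<close> is the component of the \<open>j\<close>-th standard basis
    vector orthogonal to the rows \<open>v x\<close>.\<close>
  define r where "r = (\<lambda>j k. of_bool (k = j) - (\<Sum>x\<in>X. v x j * v x k))"
  have r: "(\<Sum>k\<in>J. (r j k)\<^sup>2) = 1 - (\<Sum>x\<in>X. (v x j)\<^sup>2)" if "j \<in> J" for j
  proof -
    have "(\<Sum>k\<in>J. (r j k)\<^sup>2) = (\<Sum>k\<in>J. of_bool (k = j) - 2 * of_bool (k = j) * (\<Sum>x\<in>X. v x j * v x k)
        + (\<Sum>x\<in>X. v x j * v x k)\<^sup>2)"
      by (intro sum.cong) (auto simp: r_def power2_eq_square algebra_simps)
    also have "\<dots> = (\<Sum>k\<in>J. of_bool (k = j)) - 2 * (\<Sum>k\<in>J. of_bool (k = j) * (\<Sum>x\<in>X. v x j * v x k))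
        + (\<Sum>k\<in>J. (\<Sum>x\<in>X. v x j * v x k)\<^sup>2)"
      by (simp add: sum.distrib sum_subtractf sum_distrib_left mult.assoc)
    also have "(\<Sum>k\<in>J. (\<Sum>x\<in>X. v x j * v x k)\<^sup>2) =
        (\<Sum>k\<in>J. \<Sum>x\<in>X. \<Sum>y\<in>X. v x j * v y j * (v x k * v y k))"
      by (simp add: power2_eq_square sum_product algebra_simps)
    also have "\<dots> = (\<Sum>x\<in>X. \<Sum>y\<in>X. v x j * v y j * (\<Sum>k\<in>J. v x k * v y k))"
      by (subst sum.swap, rule sum.cong[OF refl], subst sum.swap) (simp add: sum_distrib_left)
    also have "\<dots> = (\<Sum>x\<in>X. \<Sum>y\<in>X. v x j * v y j * of_bool (x = y))"
      by (intro sum.cong refl) (simp add: orth)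
    also have "\<dots> = (\<Sum>x\<in>X. (v x j)\<^sup>2)"
      using assms(1) by (simp add: of_bool_def if_distrib power2_eq_square cong: if_cong)
    also have "(\<Sum>k\<in>J. of_bool (k = j) * (\<Sum>x\<in>X. v x j * v x k)) = (\<Sum>x\<in>X. (v x j)\<^sup>2)"
      using that assms(2) by (simp add: of_bool_def if_distrib[of "\<lambda>t. t * _"] power2_eq_square cong: if_cong)
    also have "(\<Sum>k\<in>J. of_bool (k = j)) = (1 :: real)"
      using that assms(2) by (simp add: of_bool_def)
    finally show ?thesis by simp
  qed
  have "(\<Sum>j\<in>J. \<Sum>k\<in>J. (r j k)\<^sup>2) = real (card J) - (\<Sum>j\<in>J. \<Sum>x\<in>X. (v x j)\<^sup>2)"
    by (simp add: r sum_subtractf)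
  also have "(\<Sum>j\<in>J. \<Sum>x\<in>X. (v x j)\<^sup>2) = (\<Sum>x\<in>X. \<Sum>j\<in>J. v x j * v x j)"
    by (subst sum.swap) (simp add: power2_eq_square)
  also have "\<dots> = (\<Sum>x\<in>X. 1)" by (intro sum.cong refl) (simp add: orth)
  also have "\<dots> = real (card J)" by (simp add: assms(3))
  finally have zero: "(\<Sum>j\<in>J. \<Sum>k\<in>J. (r j k)\<^sup>2) = 0" by simp
  have "\<forall>j\<in>J. (\<Sum>k\<in>J. (r j k)\<^sup>2) = 0"
    by (rule sum_nonneg_eq_0_iff[THEN iffD1, OF assms(2) _ zero]) (simp add: sum_nonneg)
  then have "(\<Sum>k\<in>J. (r j k)\<^sup>2) = 0" using assms(5) by blast
  then have "\<forall>k\<in>J. (r j k)\<^sup>2 = 0"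
    by (rule sum_nonneg_eq_0_iff[THEN iffD1, OF assms(2), rotated]) simp
  then have "r j k = 0" using assms(6) by simp
  then show ?thesis by (simp add: r_def eq_commute[of k j])
qed

text \<open>The nodes are the \<open>n\<close> roots of \<open>first_kind b (Suc n)\<close> and the
  weights are the Christoffel numbers \<open>1 / K x\<close>. By Christoffel-Darboux the square
  matrix with entries \<open>first_kind_real b k x / sqrt (K x)\<close> has orthonormal rows;
  orthonormality of its columns is the claim.\<close>

lemma gauss_quadrature:
  assumes "n \<ge> 1" and "\<forall>k\<ge>1. \<bar>b k\<bar> \<le> B"
  shows "\<exists>X w. finite X \<and> (\<forall>x\<in>X. \<bar>x\<bar> \<le> B + 2 \<and> w x \<ge> 0) \<and>
    (\<forall>j\<in>{1..n}. \<forall>k\<in>{1..n}.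
       (\<Sum>x\<in>X. w x * (first_kind_real b j x * first_kind_real b k x)) = of_bool (j = k))"
proof -
  let ?p = "first_kind_real b"
  obtain X where X: "finite X" "card X = n" "\<forall>x\<in>X. \<bar>x\<bar> \<le> B + 2 \<and> ?p (Suc n) x = 0"
    using first_kind_roots[OF assms] by auto
  define K where "K = (\<lambda>x. \<Sum>k=1..n. (?p k x)\<^sup>2)"
  have K: "K x \<ge> 1" for x
    unfolding K_def by (rule sum_first_kind_real_ge_1) fact
  have off: "(\<Sum>k=1..n. ?p k x * ?p k y) = 0" if "x \<in> X" "y \<in> X" "x \<noteq> y" for x y
  proof -
    have "(x - y) * (\<Sum>k=1..n. ?p k x * ?p k y) = 0"
      using christoffel_darboux[where lam = "of_real x" and mu = "of_real y" and n = n and b = b] X(3) that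
      by (simp add: first_kind_of_real flip: of_real_mult of_real_sum of_real_diff)
    with that show ?thesis by simp
  qed
  have orth: "(\<Sum>k=1..n. (?p k x / sqrt (K x)) * (?p k y / sqrt (K y))) = of_bool (x = y)"
    if "x \<in> X" "y \<in> X" for x y
  proof -
    have "(\<Sum>k=1..n. (?p k x / sqrt (K x)) * (?p k y / sqrt (K y)))
        = (\<Sum>k=1..n. ?p k x * ?p k y) / (sqrt (K x) * sqrt (K y))"
      by (simp add: sum_divide_distrib)
    also have "\<dots> = of_bool (x = y)"
    proof (cases "x = y")
      case True
      have "(\<Sum>k=1..n. ?p k x * ?p k x) = K x" by (simp add: K_def power2_eq_square)
      then show ?thesis using True K[of x] by auto
    qed (use off[OF that] in simp)
    finally show ?thesis .
  qed
  show ?thesis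
  proof (intro exI[of _ X] exI[of _ "\<lambda>x. 1 / K x"] conjI ballI)
    fix j k assume jk: "j \<in> {1..n}" "k \<in> {1..n}"
    have "(\<Sum>x\<in>X. (?p j x / sqrt (K x)) * (?p k x / sqrt (K x))) = of_bool (j = k)"
      by (rule orthonormal_rows_imp_columns[where J = "{1..n}"]) (use X orth jk in auto)
    moreover have "(?p j x / sqrt (K x)) * (?p k x / sqrt (K x)) = 1 / K x * (?p j x * ?p k x)" for x
    proof -
      have "sqrt (K x) * sqrt (K x) = K x" using K[of x] by simp
      then show ?thesis by (simp add: field_simps)
    qed
    ultimately show "(\<Sum>x\<in>X. 1 / K x * (?p j x * ?p k x)) = of_bool (j = k)"
      by (simp only:)
  qed (use X K in \<open>auto intro: order_trans[OF zero_le_one]\<close>)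
qed

section \<open>Orthonormalizing measures\<close>

lemma compact_continuous_bounded:
  assumes "compact A" "continuous_on A f"
  shows "\<exists>C. \<forall>x\<in>A. norm (f x) \<le> C"
  using compact_imp_bounded[OF compact_continuous_image[OF assms(2,1)]]
  unfolding bounded_iff by blast

definition gram :: "real measure \<Rightarrow> (nat \<Rightarrow> real) \<Rightarrow> nat \<Rightarrow> nat \<Rightarrow> real" where
  "gram \<mu> b j k = (LINT x|\<mu>. first_kind_real b j x * first_kind_real b k x)"

text \<open>A candidate for the spectral measure of the first basis vector, described without
  reference to the operator. The support bound \<open>R\<close> keeps polynomials integrable and
  survives weak limits.\<close>

definition orthonormalizing :: "(nat \<Rightarrow> real) \<Rightarrow> real \<Rightarrow> real measure \<Rightarrow> bool" where
  "orthonormalizing b R \<mu> \<longleftrightarrow> real_distribution \<mu> \<and> (AE x in \<mu>. \<bar>x\<bar> \<le> R) \<and>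
     (\<forall>j\<ge>1. \<forall>k\<ge>1. gram \<mu> b j k = of_bool (j = k))"

text \<open>Weak convergence tests bounded continuous functions, and polynomials are unbounded.
  Clamping the argument to \<open>{-R..R}\<close> makes \<open>f\<close> bounded and changes it only
  outside the supports.\<close>

lemma weak_conv_integral_compact_support:
  fixes f :: "real \<Rightarrow> real"
  assumes "\<And>n. real_distribution (M n)" "real_distribution N" "weak_conv_m M N" "0 \<le> R"
    and "\<And>n. AE x in M n. \<bar>x\<bar> \<le> R" "AE x in N. \<bar>x\<bar> \<le> R"
    and f: "continuous_on UNIV f"
  shows "(\<lambda>n. LINT x|M n. f x) \<longlonglongrightarrow> (LINT x|N. f x)"
proof -
  interpret M: real_distribution "M n" for n by fact
  interpret N: real_distribution N by fact
  let ?c = "\<lambda>x. max (- R) (min R x)"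
  let ?g = "\<lambda>x. f (?c x)"
  have id: "?c x = x" if "\<bar>x\<bar> \<le> R" for x
    using that by linarith
  have "continuous_on UNIV ?g"
    by (rule continuous_on_compose2[OF f]) (intro continuous_intros, simp)
  then have cont: "isCont ?g x" for x by (simp add: continuous_on_eq_continuous_at)
  then have meas: "?g \<in> borel_measurable borel" "f \<in> borel_measurable borel"
    using f by (auto intro!: borel_measurable_continuous_onI continuous_at_imp_continuous_on)
  obtain C where C: "\<forall>y\<in>{-R..R}. norm (f y) \<le> C"
    using compact_continuous_bounded[OF compact_Icc continuous_on_subset[OF f]] by blast
  have "norm (?g x) \<le> C" for x
    using assms(4) by (intro C[rule_format]) auto
  then have "(\<lambda>n. integral\<^sup>L (M n) ?g) \<longlonglongrightarrow> integral\<^sup>L N ?g"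
    by (intro weak_conv_imp_integral_bdd_continuous_conv assms(1-3) cont)
  moreover have "integral\<^sup>L (M n) ?g = integral\<^sup>L (M n) f" for n
    using assms(5)[of n] meas by (intro integral_cong_AE) (auto simp: id elim!: eventually_mono)
  moreover have "integral\<^sup>L N ?g = integral\<^sup>L N f"
    using assms(6) meas by (intro integral_cong_AE) (auto simp: id elim!: eventually_mono)
  ultimately show ?thesis by simp
qed

text \<open>The test function is bounded, continuous, nonnegative and vanishes exactly on
  \<open>{-R..R}\<close>, so its integral detects mass outside.\<close>

lemma weak_conv_bounded_support:
  assumes "\<And>n. real_distribution (M n)" "real_distribution N" "weak_conv_m M N"
    and "\<And>n. AE x in M n. \<bar>x\<bar> \<le> R"
  shows "AE x in N. \<bar>x\<bar> \<le> R"
proof -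
  interpret M: real_distribution "M n" for n by fact
  interpret N: real_distribution N by fact
  let ?g = "\<lambda>x::real. min 1 (max 0 (\<bar>x\<bar> - R))"
  have cont: "continuous_on UNIV ?g" by (intro continuous_intros)
  then have meas: "?g \<in> borel_measurable borel"
    by (intro borel_measurable_continuous_onI)
  have "(\<lambda>n. integral\<^sup>L (M n) ?g) \<longlonglongrightarrow> integral\<^sup>L N ?g"
    using cont by (intro weak_conv_imp_integral_bdd_continuous_conv[where B = 1] assms(1-3))
      (auto simp: continuous_on_eq_continuous_at)
  moreover have "integral\<^sup>L (M n) ?g = 0" for n
    using assms(4)[of n] by (intro integral_eq_zero_AE) (auto elim!: eventually_mono)
  ultimately have "integral\<^sup>L N ?g = 0"
    by (simp add: LIMSEQ_const_iff)
  moreover have "integrable N ?g"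
    using meas by (intro N.integrable_const_bound[where B = 1]) auto
  ultimately have "AE x in N. ?g x = 0"
    by (subst (asm) integral_nonneg_eq_0_iff_AE) auto
  then show ?thesis
    by (rule eventually_mono) (auto simp: min_def max_def split: if_splits)
qed

lemma tight_bounded_support:
  assumes "\<And>n. real_distribution (M n)" "\<And>n. AE x in M n. \<bar>x\<bar> \<le> R"
  shows "tight M"
  unfolding tight_def
proof (intro conjI allI impI)
  fix e :: real assume "e > 0"
  \<comment> \<open>The left end is moved out by 1 because the interval is open there and has to be
    nonempty even for \<open>R = 0\<close>.\<close>
  have "measure (M n) {-\<bar>R\<bar> - 1<..\<bar>R\<bar>} > 1 - e" for n
  proof -
    interpret real_distribution "M n" by fact
    have "measure (M n) {-\<bar>R\<bar> - 1<..\<bar>R\<bar>} = 1"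
      using assms(2)[of n] by (subst prob_eq_1) (auto elim!: eventually_mono)
    then show ?thesis using \<open>e > 0\<close> by simp
  qed
  then show "\<exists>a b. a < b \<and> (\<forall>n. 1 - e < measure (M n) {a<..b})"
    by (intro exI[of _ "-\<bar>R\<bar> - 1"] exI[of _ "\<bar>R\<bar>"]) auto
qed fact

text \<open>The orthogonality relations are required only eventually, which fits both uses:
  quadrature measures satisfy finitely many of them each, and a truncated sequence has the
  polynomials of \<open>b\<close> only up to some index.\<close>

lemma orthonormalizing_weak_limit:
  assumes "\<And>n. real_distribution (M n)" "\<And>n. AE x in M n. \<bar>x\<bar> \<le> R" "0 \<le> R"
    and "\<And>j k. j \<ge> 1 \<Longrightarrow> k \<ge> 1 \<Longrightarrow> \<forall>\<^sub>F n in sequentially.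
      gram (M n) b j k = of_bool (j = k)"
  shows "\<exists>r \<mu>. strict_mono (r :: nat \<Rightarrow> nat) \<and> weak_conv_m (M \<circ> r) \<mu> \<and> orthonormalizing b R \<mu>"
proof -
  have "tight M" by (rule tight_bounded_support) fact+
  from tight_imp_convergent_subsubsequence[OF this strict_mono_id]
  obtain r \<mu> where r: "strict_mono r" "real_distribution \<mu>" "weak_conv_m (M \<circ> r) \<mu>"
    by (auto simp: o_def)
  have M: "real_distribution ((M \<circ> r) n)" "AE x in (M \<circ> r) n. \<bar>x\<bar> \<le> R" for n
    unfolding o_def by (rule assms(1), rule assms(2))
  have supp: "AE x in \<mu>. \<bar>x\<bar> \<le> R"
    by (rule weak_conv_bounded_support[OF M(1) r(2,3) M(2)])
  have "gram \<mu> b j k = of_bool (j = k)"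
    if jk: "j \<ge> 1" "k \<ge> 1" for j k
  proof (rule LIMSEQ_unique)
    show "(\<lambda>n. gram ((M \<circ> r) n) b j k) \<longlonglongrightarrow> gram \<mu> b j k"
      unfolding gram_def
      by (rule weak_conv_integral_compact_support[OF M(1) r(2,3) assms(3) M(2) supp])
        (intro continuous_intros)
    have "\<forall>\<^sub>F n in sequentially. gram (M (r n)) b j k = of_bool (j = k)"
      using assms(4)[OF jk] filterlim_subseq[OF r(1)] by (rule eventually_compose_filterlim)
    then show "(\<lambda>n. gram ((M \<circ> r) n) b j k) \<longlonglongrightarrow> of_bool (j = k)"
      by (intro tendsto_eventually) simp
  qed
  then have "orthonormalizing b R \<mu>" using r(2) supp by (auto simp: orthonormalizing_def)
  then show ?thesis using r by blast
qed

lemma orthonormalizing_exists_finite: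
  assumes "n \<ge> 1" and "\<forall>k\<ge>1. \<bar>b k\<bar> \<le> B"
  shows "\<exists>M. real_distribution M \<and> (AE x in M. \<bar>x\<bar> \<le> B + 2) \<and> (\<forall>j\<in>{1..n}. \<forall>k\<in>{1..n}.
      gram M b j k = of_bool (j = k))"
proof -
  from gauss_quadrature[OF assms]
  obtain X w where Xw: "finite X" "\<forall>x\<in>X. \<bar>x\<bar> \<le> B + 2 \<and> w x \<ge> 0" "\<forall>j\<in>{1..n}. \<forall>k\<in>{1..n}.
       (\<Sum>x\<in>X. w x * (first_kind_real b j x * first_kind_real b k x)) = of_bool (j = k)"
    by (elim exE conjE)
  then have X: "finite X" "\<And>x. x \<in> X \<Longrightarrow> \<bar>x\<bar> \<le> B + 2" "\<And>x. x \<in> X \<Longrightarrow> w x \<ge> 0"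
    "\<And>j k. j \<in> {1..n} \<Longrightarrow> k \<in> {1..n} \<Longrightarrow>
       (\<Sum>x\<in>X. w x * (first_kind_real b j x * first_kind_real b k x)) = of_bool (j = k)"
    by blast+
  define P where "P = point_measure X (\<lambda>x. ennreal (w x))"
  \<comment> \<open>The point measure has all subsets of \<open>X\<close> as measurable sets; its
    image under the identity is a Borel measure on the line.\<close>
  define M where "M = distr P borel (\<lambda>x. x)"
  have [measurable]: "(\<lambda>x. x) \<in> P \<rightarrow>\<^sub>M borel"
    by (simp add: P_def)
  have "(\<Sum>x\<in>X. w x) = 1" using X(4)[of 1 1] assms(1) by simp
  then have "emeasure P (space P) = 1"
    using X(1,3) by (simp add: P_def space_point_measure emeasure_point_measure_finite sum_ennreal)
  then have "prob_space P" by (rule prob_spaceI)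
  then have "prob_space M" unfolding M_def by (rule prob_space.prob_space_distr) measurable
  then have "real_distribution M"
    by (auto simp: real_distribution_def real_distribution_axioms_def M_def)
  moreover have "AE x in M. \<bar>x\<bar> \<le> B + 2"
    unfolding M_def using X(2)
    by (subst AE_distr_iff) (auto simp: P_def space_point_measure intro!: AE_I2)
  moreover have "gram M b j k = of_bool (j = k)"
    if "j \<in> {1..n}" "k \<in> {1..n}" for j k
  proof -
    have "gram M b j k = (LINT x|P. first_kind_real b j x * first_kind_real b k x)"
      unfolding M_def gram_def
      by (intro integral_distr borel_measurable_continuous_onI continuous_intros) measurable
    also have "\<dots> = (\<Sum>x\<in>X. w x * (first_kind_real b j x * first_kind_real b k x))"
      unfolding P_def using X(1,3) by (subst lebesgue_integral_point_measure_finite) auto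
    finally show ?thesis using X(4) that by simp
  qed
  ultimately show ?thesis by blast
qed

text \<open>Favard's theorem for bounded coefficients, as a weak limit of Gauss quadratures.\<close>

lemma orthonormalizing_exists:
  assumes "\<forall>k\<ge>1. \<bar>b k\<bar> \<le> B"
  shows "\<exists>\<mu>. orthonormalizing b (B + 2) \<mu>"
proof -
  have "\<forall>n. \<exists>M. real_distribution M \<and> (AE x in M. \<bar>x\<bar> \<le> B + 2) \<and> (\<forall>j\<in>{1..Suc n}. \<forall>k\<in>{1..Suc n}.
      gram M b j k = of_bool (j = k))"
    using orthonormalizing_exists_finite[OF _ assms] by simp
  then obtain M where M: "\<And>n. real_distribution (M n)" "\<And>n. AE x in M n. \<bar>x\<bar> \<le> B + 2"
    "\<And>n j k. j \<in> {1..Suc n} \<Longrightarrow> k \<in> {1..Suc n} \<Longrightarrow>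
      gram (M n) b j k = of_bool (j = k)"
    by metis
  have ev: "\<forall>\<^sub>F n in sequentially. gram (M n) b j k = of_bool (j = k)"
    if "j \<ge> 1" "k \<ge> 1" for j k
    using that by (intro eventually_sequentiallyI[of "max j k"] M(3)) auto
  have nonneg: "0 \<le> B + 2" using assms[rule_format, of 1] by simp
  from orthonormalizing_weak_limit[of M "B + 2" b, OF M(1,2) nonneg ev] show ?thesis
    by blast
qed

section \<open>Stieltjes inversion\<close>

definition borel_transform :: "real measure \<Rightarrow> complex \<Rightarrow> complex" where
  "borel_transform \<mu> lam = (LINT x|\<mu>. 1 / (of_real x - lam))"

lemma norm_cauchy_kernel_le:
  assumes "Im lam \<noteq> 0"
  shows "cmod (1 / (of_real x - lam)) \<le> 1 / \<bar>Im lam\<bar>"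
proof -
  have "\<bar>Im lam\<bar> \<le> cmod (of_real x - lam)"
    using abs_Im_le_cmod[of "of_real x - lam"] by simp
  then show ?thesis using assms by (simp add: norm_divide frac_le)
qed

lemma Im_cauchy_kernel: "Im (1 / (of_real t - Complex x e)) = e / ((t - x)\<^sup>2 + e\<^sup>2)"
  by (simp add: Im_divide)

lemma integrable_cauchy_kernel:
  assumes "finite_borel_measure \<mu>" "Im lam \<noteq> 0"
  shows "integrable \<mu> (\<lambda>x. 1 / (of_real x - lam))"
proof -
  interpret finite_borel_measure \<mu> by fact
  have [measurable_cong]: "sets \<mu> = sets borel" by (rule M_is_borel)
  show ?thesis
    using norm_cauchy_kernel_le[OF assms(2)]
    by (intro integrable_const_bound[where B = "1 / \<bar>Im lam\<bar>"]) auto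
qed

lemma Im_borel_transform:
  assumes "finite_borel_measure \<mu>" "e > 0"
  shows "Im (borel_transform \<mu> (Complex x e)) = (LINT t|\<mu>. e / ((t - x)\<^sup>2 + e\<^sup>2))"
proof -
  have "Im (borel_transform \<mu> (Complex x e)) = (LINT t|\<mu>. Im (1 / (of_real t - Complex x e)))"
    unfolding borel_transform_def
    by (intro integral_Im[symmetric] integrable_cauchy_kernel assms) (use assms in auto)
  then show ?thesis by (simp only: Im_cauchy_kernel)
qed

lemma poisson_kernel_le:
  assumes "(e::real) > 0"
  shows "norm (e / ((t - x)\<^sup>2 + e\<^sup>2)) \<le> 1 / e"
proof -
  have "e / ((t - x)\<^sup>2 + e\<^sup>2) \<le> e / e\<^sup>2"
    using assms by (intro divide_left_mono) (auto intro!: mult_pos_pos add_nonneg_pos)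
  also have "\<dots> = 1 / e" using assms by (simp add: power2_eq_square)
  finally show ?thesis using assms by simp
qed

lemma integral_poisson_kernel:
  assumes "(e::real) > 0" "a \<le> b"
  shows "(LINT x|lborel. indicator {a..b} x *\<^sub>R (e / ((t - x)\<^sup>2 + e\<^sup>2)))
    = arctan ((b - t) / e) - arctan ((a - t) / e)"
proof (rule integral_FTC_atLeastAtMost[OF assms(2)])
  fix x
  have pos: "(t - x)\<^sup>2 + e\<^sup>2 > 0" using assms(1) by (intro add_nonneg_pos) auto
  have "((\<lambda>x. arctan ((x - t) / e)) has_real_derivative
      inverse (1 + ((x - t) / e)\<^sup>2) * (1 / e)) (at x within {a..b})"
    using assms(1) by (auto intro!: derivative_eq_intros)
  also have "inverse (1 + ((x - t) / e)\<^sup>2) * (1 / e) = e / ((t - x)\<^sup>2 + e\<^sup>2)"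
    using assms(1) pos by (simp add: field_simps power2_eq_square)
  finally show "((\<lambda>x. arctan ((x - t) / e)) has_vector_derivative e / ((t - x)\<^sup>2 + e\<^sup>2)) (at x within {a..b})"
    by (simp add: has_real_derivative_iff_has_vector_derivative)
next
  have "(t - x)\<^sup>2 + e\<^sup>2 \<noteq> 0" for x
    using assms(1) by (metis add_nonneg_pos less_irrefl zero_le_power2 zero_less_power)
  then show "continuous_on {a..b} (\<lambda>x. e / ((t - x)\<^sup>2 + e\<^sup>2))"
    by (intro continuous_intros) auto
qed

lemma integral_Im_borel_transform:
  assumes "finite_borel_measure \<mu>" "e > 0" "a \<le> b"
  shows "(LINT x|lborel. indicator {a..b} x *\<^sub>R Im (borel_transform \<mu> (Complex x e)))
    = (LINT t|\<mu>. arctan ((b - t) / e) - arctan ((a - t) / e))"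
proof -
  interpret finite_borel_measure \<mu> by fact
  have [measurable_cong]: "sets \<mu> = sets borel" by (rule M_is_borel)
  \<comment> \<open>Lebesgue measure is cut down to \<open>{a..b}\<close> so that the product with
    \<open>\<mu>\<close> is finite and the bounded kernel is integrable, as Fubini's theorem
    asks.\<close>
  define N where "N = restrict_space lborel {a..b}"
  interpret N: finite_measure N
    by (rule finite_measureI) (simp add: N_def emeasure_restrict_space emeasure_lborel_Icc[OF assms(3)])
  have id_N: "(\<lambda>x. x) \<in> N \<rightarrow>\<^sub>M borel"
    unfolding N_def by (rule measurable_restrict_space1) simp
  interpret pair_sigma_finite N \<mu> ..
  interpret P: finite_measure "N \<Otimes>\<^sub>M \<mu>"
    by (rule finite_measure_pair_measure) unfold_locales
  let ?f = "\<lambda>x t. e / ((t - x)\<^sup>2 + e\<^sup>2)"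
  have meas: "(\<lambda>(x, t). ?f x t) \<in> borel_measurable (N \<Otimes>\<^sub>M \<mu>)"
  proof -
    have [measurable]: "fst \<in> N \<Otimes>\<^sub>M \<mu> \<rightarrow>\<^sub>M borel"
      using measurable_compose[OF measurable_fst[of N \<mu>] id_N] by simp
    have [measurable]: "snd \<in> N \<Otimes>\<^sub>M \<mu> \<rightarrow>\<^sub>M borel"
      by measurable
    have "(\<lambda>p. e / ((snd p - fst p)\<^sup>2 + e\<^sup>2)) \<in> borel_measurable (N \<Otimes>\<^sub>M \<mu>)"
      by measurable
    then show ?thesis by (simp add: case_prod_beta')
  qed
  have "integrable (N \<Otimes>\<^sub>M \<mu>) (\<lambda>(x, t). ?f x t)"
    using poisson_kernel_le[OF assms(2)] meas
    by (intro P.integrable_const_bound[where B = "1 / e"]) auto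
  then have "(LINT t|\<mu>. LINT x|N. ?f x t) = (LINT x|N. LINT t|\<mu>. ?f x t)"
    by (rule Fubini_integral)
  moreover have "(LINT x|N. ?f x t) = arctan ((b - t) / e) - arctan ((a - t) / e)" for t
    unfolding N_def by (subst integral_restrict_space) (auto simp: integral_poisson_kernel[OF assms(2,3), simplified])
  moreover have "(LINT x|N. LINT t|\<mu>. ?f x t)
      = (LINT x|lborel. indicator {a..b} x *\<^sub>R Im (borel_transform \<mu> (Complex x e)))"
    unfolding N_def Im_borel_transform[OF assms(1,2)] by (subst integral_restrict_space) auto
  ultimately show ?thesis by simp
qed

text \<open>The case \<open>c = 0\<close>, with limit 0, occurs at the end points of an interval and
  is what gives their atoms half weight.\<close>

lemma arctan_scaled_limit:
  fixes e :: "nat \<Rightarrow> real"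
  assumes "\<And>n. e n > 0" "e \<longlonglongrightarrow> 0"
  shows "(\<lambda>n. arctan (c / e n)) \<longlonglongrightarrow> sgn c * (pi / 2)"
proof -
  have inf: "filterlim (\<lambda>n. inverse (e n)) at_top sequentially"
    using assms by (intro filterlim_inverse_at_top) auto
  consider "c > 0" | "c = 0" | "c < 0" by linarith
  then show ?thesis
  proof cases
    case 1
    have "filterlim (\<lambda>n. c / e n) at_top sequentially"
      unfolding divide_inverse by (rule filterlim_tendsto_pos_mult_at_top[OF tendsto_const 1 inf])
    from filterlim_compose[OF tendsto_arctan_at_top this] 1 show ?thesis
      by simp
  next
    case 3
    have "filterlim (\<lambda>n. c / e n) at_bot sequentially"
      unfolding divide_inverse by (rule filterlim_tendsto_neg_mult_at_bot[OF tendsto_const 3 inf])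
    from filterlim_compose[OF tendsto_arctan_at_bot this] 3 show ?thesis
      by simp
  qed simp
qed

text \<open>The integrated Poisson kernels tend to pi inside the interval, to pi/2 at its end points
  and to 0 outside, bounded by pi throughout; the average of the open and the closed interval
  expresses this weight.\<close>

lemma stieltjes_inversion:
  assumes "finite_borel_measure \<mu>" "\<And>n. e n > 0" "e \<longlonglongrightarrow> 0" "a < b"
  shows "(\<lambda>n. LINT x|lborel. indicator {a..b} x *\<^sub>R Im (borel_transform \<mu> (Complex x (e n))))
    \<longlonglongrightarrow> pi * ((measure \<mu> {a<..<b} + measure \<mu> {a..b}) / 2)"
proof -
  interpret finite_borel_measure \<mu> by fact
  have [measurable_cong]: "sets \<mu> = sets borel" by (rule M_is_borel)
  have "(\<lambda>n. LINT t|\<mu>. arctan ((b - t) / e n) - arctan ((a - t) / e n))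
    \<longlonglongrightarrow> (LINT t|\<mu>. sgn (b - t) * (pi / 2) - sgn (a - t) * (pi / 2))"
  proof (rule integral_dominated_convergence[where w = "\<lambda>_. pi"])
    show "AE t in \<mu>. norm (arctan ((b - t) / e n) - arctan ((a - t) / e n)) \<le> pi" for n
    proof (rule AE_I2)
      fix t
      show "norm (arctan ((b - t) / e n) - arctan ((a - t) / e n)) \<le> pi"
        using arctan_bounded[of "(b - t) / e n"] arctan_bounded[of "(a - t) / e n"] by auto
    qed
    show "AE t in \<mu>. (\<lambda>n. arctan ((b - t) / e n) - arctan ((a - t) / e n))
        \<longlonglongrightarrow> sgn (b - t) * (pi / 2) - sgn (a - t) * (pi / 2)"
      by (intro AE_I2 tendsto_diff arctan_scaled_limit assms(2,3))
  qed auto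
  also have "(\<lambda>t. sgn (b - t) * (pi / 2) - sgn (a - t) * (pi / 2))
      = (\<lambda>t. pi / 2 * (indicator {a<..<b} t + indicator {a..b} t))"
    using assms(4) by (auto simp: fun_eq_iff sgn_if indicator_def)
  also have "(LINT t|\<mu>. pi / 2 * (indicator {a<..<b} t + indicator {a..b} t))
      = pi * ((measure \<mu> {a<..<b} + measure \<mu> {a..b}) / 2)"
    by (subst integral_mult_right_zero, subst Bochner_Integration.integral_add)
      (auto simp: borel_UNIV less_top[symmetric])
  finally have "(\<lambda>n. LINT t|\<mu>. arctan ((b - t) / e n) - arctan ((a - t) / e n))
    \<longlonglongrightarrow> pi * ((measure \<mu> {a<..<b} + measure \<mu> {a..b}) / 2)" .
  then show ?thesis
    by (subst integral_Im_borel_transform[OF assms(1,2)]) (use assms(4) in auto)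
qed

text \<open>The Stieltjes inversion formula determines \<open>\<mu> {a<..<b} + \<mu> {a..b}\<close>; both terms tend to
  \<open>\<mu> {x<..}\<close> for \<open>a \<down> x\<close> and \<open>b \<rightarrow> \<infinity>\<close>.\<close>

lemma borel_transform_inj:
  assumes "finite_borel_measure \<mu>" "finite_borel_measure \<nu>"
    and "\<And>lam. Im lam > 0 \<Longrightarrow> borel_transform \<mu> lam = borel_transform \<nu> lam"
  shows "\<mu> = \<nu>"
proof -
  interpret \<mu>: finite_borel_measure \<mu> by fact
  interpret \<nu>: finite_borel_measure \<nu> by fact
  define e :: "nat \<Rightarrow> real" where "e = (\<lambda>n. 1 / real (Suc n))"
  have e: "e n > 0" "e \<longlonglongrightarrow> 0" for n
    unfolding e_def using LIMSEQ_Suc[OF lim_1_over_n] by simp_all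
  have half: "measure \<mu> {a<..<b} + measure \<mu> {a..b} = measure \<nu> {a<..<b} + measure \<nu> {a..b}"
    if "a < b" for a b
  proof -
    have "(\<lambda>n. LINT x|lborel. indicator {a..b} x *\<^sub>R Im (borel_transform \<mu> (Complex x (e n))))
      \<longlonglongrightarrow> pi * ((measure \<nu> {a<..<b} + measure \<nu> {a..b}) / 2)"
      using stieltjes_inversion[OF assms(2) e that] assms(3) e(1) by simp
    from LIMSEQ_unique[OF this stieltjes_inversion[OF assms(1) e that]] show ?thesis
      by simp
  qed
  \<comment> \<open>The summand 2 keeps the intervals nondegenerate from \<open>n = 0\<close> on,
    since \<open>e n\<close> is at most 1.\<close>
  let ?I = "\<lambda>x n. {x + e n<..<x + real n + 2}" and ?C = "\<lambda>x n. {x + e n..x + real n + 2}"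
  have lim: "(\<lambda>n. measure M (?I x n) + measure M (?C x n))
      \<longlonglongrightarrow> measure M {x<..} + measure M {x<..}" if "finite_borel_measure M" for M x
  proof -
    interpret M: finite_borel_measure M by fact
    have mono: "e n \<le> e m" if "m \<le> n" for m n
      using that by (simp add: e_def frac_le)
    have U: "(\<Union>n. ?I x n) = {x<..}"
      "(\<Union>n. ?C x n) = {x<..}"
    proof -
      have "\<exists>n. y \<in> ?I x n" if "y > x" for y
      proof -
        have "\<forall>\<^sub>F n in sequentially. e n < y - x"
          using e(2) that by (intro order_tendstoD(2)) auto
        moreover have "\<forall>\<^sub>F n in sequentially. y - x < real n"
          using filterlim_real_sequentially unfolding filterlim_at_top_dense by blast
        ultimately have "\<forall>\<^sub>F n in sequentially. y \<in> ?I x n"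
          by eventually_elim auto
        then show ?thesis unfolding eventually_sequentially by blast
      qed
      then have sub: "{x<..} \<subseteq> (\<Union>n. ?I x n)"
        by blast
      have sub': "?I x n \<subseteq> ?C x n"
        "?C x n \<subseteq> {x<..}" for n
        using e(1)[of n] by auto
      then have "(\<Union>n. ?I x n) \<subseteq> (\<Union>n. ?C x n)"
        "(\<Union>n. ?C x n) \<subseteq> {x<..}"
        by (intro UN_mono order_refl UN_least sub')+
      with sub show "(\<Union>n. ?I x n) = {x<..}"
        "(\<Union>n. ?C x n) = {x<..}"
        by (simp_all only: order.eq_iff) (meson order_trans)+
    qed
    have "(\<lambda>n. measure M (?I x n)) \<longlonglongrightarrow> measure M (\<Union>n. ?I x n)"
    proof (rule M.finite_Lim_measure_incseq)
      show "incseq (\<lambda>n. ?I x n)"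
      proof (rule incseq_SucI)
        show "?I x n \<subseteq> {x + e (Suc n)<..<x + real (Suc n) + 2}" for n
          using mono[of n "Suc n"] by auto
      qed
    qed auto
    moreover have "(\<lambda>n. measure M (?C x n)) \<longlonglongrightarrow> measure M (\<Union>n. ?C x n)"
    proof (rule M.finite_Lim_measure_incseq)
      show "incseq (\<lambda>n. ?C x n)"
      proof (rule incseq_SucI)
        show "?C x n \<subseteq> {x + e (Suc n)..x + real (Suc n) + 2}" for n
          using mono[of n "Suc n"] by auto
      qed
    qed auto
    ultimately show ?thesis unfolding U by (rule tendsto_add)
  qed
  have "measure \<mu> {x<..} = measure \<nu> {x<..}" for x
  proof -
    have "x + e n < x + real n + 2" for n
    proof -
      have "e n \<le> 1" by (simp add: e_def)
      then show ?thesis by linarith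
    qed
    then have "(\<lambda>n. measure \<mu> (?I x n) + measure \<mu> (?C x n))
        \<longlonglongrightarrow> measure \<nu> {x<..} + measure \<nu> {x<..}"
      using lim[OF assms(2), of x] by (simp add: half)
    from LIMSEQ_unique[OF this lim[OF assms(1), of x]] show ?thesis by simp
  qed
  then show ?thesis
    by (intro measure_eqI_lessThan)
      (auto simp: \<mu>.M_is_borel \<nu>.M_is_borel \<mu>.emeasure_eq_measure \<nu>.emeasure_eq_measure)
qed

section \<open>Spectral measures\<close>

definition square_integrable :: "real measure \<Rightarrow> (real \<Rightarrow> complex) \<Rightarrow> bool" where
  "square_integrable \<mu> g \<longleftrightarrow> g \<in> borel_measurable borel \<and> integrable \<mu> (\<lambda>x. (cmod (g x))\<^sup>2)"

lemma norm_square_diff_complex: "(cmod (z - s))\<^sup>2 = (cmod z)\<^sup>2 - 2 * Re (z * cnj s) + (cmod s)\<^sup>2"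
  unfolding cmod_power2 by (simp add: power2_eq_square algebra_simps)

locale jacobi_measure = real_distribution \<mu> for \<mu> :: "real measure" +
  fixes b :: "nat \<Rightarrow> real" and R :: real
  assumes orthonormalizing: "orthonormalizing b R \<mu>"
begin

declare M_is_borel [measurable_cong]

definition p :: "nat \<Rightarrow> real \<Rightarrow> complex" where
  "p n x = first_kind b n (of_real x)"

lemma p_of_real: "p n x = of_real (first_kind_real b n x)"
  by (simp add: p_def first_kind_of_real)

lemma p_0 [simp]: "p 0 x = 0" and p_1 [simp]: "p (Suc 0) x = 1"
  by (simp_all add: p_def)

lemma cnj_p [simp]: "cnj (p n x) = p n x"
  by (simp add: p_of_real)

lemma continuous_p: "continuous_on A (p n)"
  unfolding p_def by (intro continuous_intros)

lemma measurable_p [measurable]: "p n \<in> borel_measurable borel"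
  by (intro borel_measurable_continuous_onI continuous_p)

text \<open>Bounded support enters here: multiplication by \<open>p n\<close> preserves
  integrability.\<close>

lemma p_bounded: "\<exists>C. AE x in \<mu>. cmod (p n x) \<le> C"
proof -
  obtain C where C: "\<forall>x\<in>{-R..R}. cmod (p n x) \<le> C"
    using compact_continuous_bounded[OF compact_Icc continuous_p] by blast
  have "AE x in \<mu>. \<bar>x\<bar> \<le> R"
    using orthonormalizing by (simp add: orthonormalizing_def)
  then have "AE x in \<mu>. cmod (p n x) \<le> C"
    by (rule eventually_mono) (use C in \<open>auto simp: abs_le_iff minus_le_iff\<close>)
  then show ?thesis ..
qed

lemma integrable_p_mult:
  assumes "integrable \<mu> g"
  shows "integrable \<mu> (\<lambda>x. p n x * g x)"
proof -
  obtain C where C: "AE x in \<mu>. cmod (p n x) \<le> C" using p_bounded by blast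
  have [measurable]: "g \<in> borel_measurable \<mu>" using assms by simp
  show ?thesis
  proof (rule Bochner_Integration.integrable_bound[where f = "\<lambda>x. of_real C * g x"])
    show "AE x in \<mu>. norm (p n x * g x) \<le> norm (of_real C * g x)"
      using C by eventually_elim (auto simp: norm_mult intro!: mult_right_mono order_trans[OF _ abs_ge_self])
  qed (use assms in auto)
qed

lemma integrable_p_p: "integrable \<mu> (\<lambda>x. p j x * p k x)"
  using integrable_p_mult[OF integrable_p_mult[of "\<lambda>_. 1" k], of j] by simp

lemma p_orthonormal:
  assumes "j \<ge> 1" "k \<ge> 1"
  shows "(LINT x|\<mu>. p j x * p k x) = of_bool (j = k)"
proof -
  have "(LINT x|\<mu>. p j x * p k x) = of_real (LINT x|\<mu>. first_kind_real b j x * first_kind_real b k x)"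
    unfolding p_of_real by (simp flip: of_real_mult)
  then show ?thesis using assms orthonormalizing by (simp add: orthonormalizing_def gram_def)
qed

lemma square_integrable_measurable: "square_integrable \<mu> g \<Longrightarrow> g \<in> borel_measurable borel"
  by (simp add: square_integrable_def)

lemma integrable_square_integrable_mult:
  assumes "square_integrable \<mu> g" "square_integrable \<mu> h"
  shows "integrable \<mu> (\<lambda>x. g x * h x)"
proof (rule Bochner_Integration.integrable_bound[where f = "\<lambda>x. (cmod (g x))\<^sup>2 + (cmod (h x))\<^sup>2"])
  note [measurable] = assms[THEN square_integrable_measurable]
  show "(\<lambda>x. g x * h x) \<in> borel_measurable \<mu>" by measurable
  show "AE x in \<mu>. norm (g x * h x) \<le> norm ((cmod (g x))\<^sup>2 + (cmod (h x))\<^sup>2)"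
    using norm_mult_le_squares by (intro AE_I2) (auto intro: order_trans)
qed (use assms in \<open>auto simp: square_integrable_def\<close>)

lemma square_integrable_add:
  assumes "square_integrable \<mu> g" "square_integrable \<mu> h"
  shows "square_integrable \<mu> (\<lambda>x. g x + h x)"
proof -
  note [measurable] = assms[THEN square_integrable_measurable]
  have "integrable \<mu> (\<lambda>x. (cmod (g x + h x))\<^sup>2)"
  proof (rule Bochner_Integration.integrable_bound[where f = "\<lambda>x. 2 * (cmod (g x))\<^sup>2 + 2 * (cmod (h x))\<^sup>2"])
    show "AE x in \<mu>. norm ((cmod (g x + h x))\<^sup>2) \<le> norm (2 * (cmod (g x))\<^sup>2 + 2 * (cmod (h x))\<^sup>2)"
      using norm_square_add_le by (intro AE_I2) auto
  qed (use assms in \<open>auto simp: square_integrable_def\<close>)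
  then show ?thesis by (simp add: square_integrable_def)
qed

lemma square_integrable_mult:
  assumes "square_integrable \<mu> g" and [measurable]: "k \<in> borel_measurable borel" and "\<And>x. cmod (k x) \<le> C"
  shows "square_integrable \<mu> (\<lambda>x. k x * g x)"
proof -
  note [measurable] = assms(1)[THEN square_integrable_measurable]
  have "integrable \<mu> (\<lambda>x. (cmod (k x * g x))\<^sup>2)"
  proof (rule Bochner_Integration.integrable_bound[where f = "\<lambda>x. C\<^sup>2 * (cmod (g x))\<^sup>2"])
    show "AE x in \<mu>. norm ((cmod (k x * g x))\<^sup>2) \<le> norm (C\<^sup>2 * (cmod (g x))\<^sup>2)"
      using assms(3) by (intro AE_I2) (auto simp: norm_mult power_mult_distrib intro!: mult_right_mono power_mono)
  qed (use assms in \<open>auto simp: square_integrable_def\<close>)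
  then show ?thesis by (simp add: square_integrable_def)
qed

lemma square_integrable_minus:
  assumes "square_integrable \<mu> g" "square_integrable \<mu> h"
  shows "square_integrable \<mu> (\<lambda>x. g x - h x)"
  using square_integrable_add[OF assms(1) square_integrable_mult[OF assms(2), of "\<lambda>_. -1" 1]] by simp

lemma square_integrable_cnj: "square_integrable \<mu> g \<Longrightarrow> square_integrable \<mu> (\<lambda>x. cnj (g x))"
proof -
  have "cnj \<in> borel_measurable borel"
    by (intro borel_measurable_continuous_onI continuous_on_cnj continuous_on_id)
  then have "(\<lambda>x. cnj (g x)) \<in> borel_measurable borel" if "g \<in> borel_measurable borel"
    by (rule measurable_compose[OF that])
  then show "square_integrable \<mu> g \<Longrightarrow> square_integrable \<mu> (\<lambda>x. cnj (g x))"
    by (simp add: square_integrable_def)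
qed

lemma square_integrable_const: "square_integrable \<mu> (\<lambda>_. c)"
  by (simp add: square_integrable_def)

lemma square_integrable_p: "square_integrable \<mu> (p n)"
proof -
  have "integrable \<mu> (\<lambda>x. complex_of_real ((cmod (p n x))\<^sup>2))"
    using integrable_p_p[of n n] by (simp add: p_of_real power2_eq_square)
  then have "integrable \<mu> (\<lambda>x. Re (complex_of_real ((cmod (p n x))\<^sup>2)))"
    by (rule integrable_Re)
  then show ?thesis by (simp add: square_integrable_def)
qed

lemma integrable_square_integrable: "square_integrable \<mu> g \<Longrightarrow> integrable \<mu> g"
  using integrable_square_integrable_mult[OF _ square_integrable_const[of 1]] by simp

lemma cauchy_schwarz:
  assumes "square_integrable \<mu> g" "square_integrable \<mu> h"
  shows "(LINT x|\<mu>. cmod (g x) * cmod (h x))\<^sup>2 \<le> (LINT x|\<mu>. (cmod (g x))\<^sup>2) * (LINT x|\<mu>. (cmod (h x))\<^sup>2)"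
proof -
  note [measurable] = assms[THEN square_integrable_measurable]
  have "integrable \<mu> (\<lambda>x. cmod (g x) * cmod (h x))"
    using integrable_norm[OF integrable_square_integrable_mult[OF assms]] by (simp add: norm_mult)
  then have 1: "(\<integral>\<^sup>+x. ennreal (cmod (g x)) * ennreal (cmod (h x)) \<partial>\<mu>) = ennreal (LINT x|\<mu>. cmod (g x) * cmod (h x))"
    by (subst nn_integral_eq_integral[symmetric]) (auto simp: ennreal_mult)
  have 2: "(\<integral>\<^sup>+x. (ennreal (cmod (f x)))\<^sup>2 \<partial>\<mu>) = ennreal (LINT x|\<mu>. (cmod (f x))\<^sup>2)" if "square_integrable \<mu> f" for f
    using that by (subst nn_integral_eq_integral[symmetric]) (auto simp: ennreal_power square_integrable_def)
  have "ennreal ((LINT x|\<mu>. cmod (g x) * cmod (h x))\<^sup>2) \<le> ennreal ((LINT x|\<mu>. (cmod (g x))\<^sup>2) * (LINT x|\<mu>. (cmod (h x))\<^sup>2))"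
    using Cauchy_Schwarz_nn_integral[of "\<lambda>x. ennreal (cmod (g x))" \<mu> "\<lambda>x. ennreal (cmod (h x))"]
    unfolding 1 2[OF assms(1)] 2[OF assms(2)] by (simp add: ennreal_power ennreal_mult)
  then show ?thesis by simp
qed

lemma tendsto_integral_mult:
  assumes "\<And>k. square_integrable \<mu> (s k)" "square_integrable \<mu> g" "square_integrable \<mu> h"
    and "(\<lambda>k. LINT x|\<mu>. (cmod (g x - s k x))\<^sup>2) \<longlonglongrightarrow> 0"
  shows "(\<lambda>k. LINT x|\<mu>. h x * s k x) \<longlonglongrightarrow> (LINT x|\<mu>. h x * g x)"
proof (rule Lim_transform2[OF tendsto_const])
  have "(\<lambda>k. LINT x|\<mu>. h x * (g x - s k x)) \<longlonglongrightarrow> 0"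
  proof (rule Lim_null_comparison)
    let ?a = "\<lambda>k. (LINT x|\<mu>. (cmod (h x))\<^sup>2) * (LINT x|\<mu>. (cmod (g x - s k x))\<^sup>2)"
    have "norm (LINT x|\<mu>. h x * (g x - s k x)) \<le> sqrt (?a k)" for k
    proof -
      have "norm (LINT x|\<mu>. h x * (g x - s k x)) \<le> (LINT x|\<mu>. norm (h x * (g x - s k x)))"
        by (rule integral_norm_bound)
      then have "norm (LINT x|\<mu>. h x * (g x - s k x)) \<le> (LINT x|\<mu>. cmod (h x) * cmod (g x - s k x))"
        by (simp add: norm_mult)
      also have "\<dots> \<le> sqrt (?a k)"
        by (intro real_le_rsqrt cauchy_schwarz assms square_integrable_minus)
      finally show ?thesis .
    qed
    then show "\<forall>\<^sub>F k in sequentially. norm (LINT x|\<mu>. h x * (g x - s k x)) \<le> sqrt (?a k)" by simp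
    have "(\<lambda>k. sqrt (?a k)) \<longlonglongrightarrow> sqrt ((LINT x|\<mu>. (cmod (h x))\<^sup>2) * 0)"
      by (intro tendsto_real_sqrt tendsto_mult tendsto_const assms)
    then show "(\<lambda>k. sqrt (?a k)) \<longlonglongrightarrow> 0" by simp
  qed
  then show "(\<lambda>k. (LINT x|\<mu>. h x * g x) - (LINT x|\<mu>. h x * s k x)) \<longlonglongrightarrow> 0"
    by (simp add: right_diff_distrib Bochner_Integration.integral_diff integrable_square_integrable_mult assms)
qed

lemma integral_norm_square_sum:
  assumes "finite A" "A \<subseteq> {1..}"
  shows "(LINT x|\<mu>. (cmod (\<Sum>n\<in>A. c n * p n x))\<^sup>2) = (\<Sum>n\<in>A. (cmod (c n))\<^sup>2)"
proof -
  have "complex_of_real (LINT x|\<mu>. (cmod (\<Sum>n\<in>A. c n * p n x))\<^sup>2)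
      = (LINT x|\<mu>. complex_of_real ((cmod (\<Sum>n\<in>A. c n * p n x))\<^sup>2))"
    by (rule integral_complex_of_real[symmetric])
  also have "\<dots> = (LINT x|\<mu>. (\<Sum>n\<in>A. \<Sum>m\<in>A. c n * cnj (c m) * (p n x * p m x)))"
  proof (intro Bochner_Integration.integral_cong refl)
    fix x
    show "complex_of_real ((cmod (\<Sum>n\<in>A. c n * p n x))\<^sup>2) = (\<Sum>n\<in>A. \<Sum>m\<in>A. c n * cnj (c m) * (p n x * p m x))"
      by (subst complex_norm_square) (simp add: sum_product algebra_simps)
  qed
  also have "\<dots> = (\<Sum>n\<in>A. \<Sum>m\<in>A. c n * cnj (c m) * (LINT x|\<mu>. p n x * p m x))"
    by (simp add: Bochner_Integration.integral_sum integrable_p_p)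
  also have "\<dots> = (\<Sum>n\<in>A. \<Sum>m\<in>A. if m = n then c n * cnj (c n) else 0)"
    using assms by (intro sum.cong refl) (auto simp: p_orthonormal subset_iff)
  also have "\<dots> = (\<Sum>n\<in>A. c n * cnj (c n))"
    using assms(1) by simp
  also have "\<dots> = complex_of_real (\<Sum>n\<in>A. (cmod (c n))\<^sup>2)"
    by (simp add: complex_norm_square del: of_real_power)
  finally show ?thesis by (simp only: of_real_eq_iff)
qed

lemma square_integrable_sum: "square_integrable \<mu> (\<lambda>x. \<Sum>n\<in>A. c n * p n x)"
proof (induction A rule: infinite_finite_induct)
  case (insert a A)
  then show ?case
    using square_integrable_add[OF square_integrable_mult[OF square_integrable_p[of a], of "\<lambda>_. c a" "cmod (c a)"]]
    by simp
qed (simp_all add: square_integrable_const)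

lemma bessel:
  assumes g: "square_integrable \<mu> g" and A: "finite A" "A \<subseteq> {1..}"
  shows "(\<Sum>n\<in>A. (cmod (LINT x|\<mu>. p n x * g x))\<^sup>2) \<le> (LINT x|\<mu>. (cmod (g x))\<^sup>2)"
proof -
  define c where "c = (\<lambda>n. LINT x|\<mu>. p n x * g x)"
  define s where "s = (\<lambda>x. \<Sum>n\<in>A. c n * p n x)"
  have int: "integrable \<mu> (\<lambda>x. (cmod (g x))\<^sup>2)" "integrable \<mu> (\<lambda>x. (cmod (s x))\<^sup>2)"
    using g square_integrable_sum[of c A] by (auto simp: square_integrable_def s_def)
  have int2: "integrable \<mu> (\<lambda>x. g x * cnj (s x))"
    unfolding s_def by (intro integrable_square_integrable_mult g square_integrable_cnj square_integrable_sum)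
  have "(LINT x|\<mu>. g x * cnj (s x)) = (LINT x|\<mu>. (\<Sum>n\<in>A. cnj (c n) * (p n x * g x)))"
    by (simp add: s_def sum_distrib_left algebra_simps)
  also have "\<dots> = (\<Sum>n\<in>A. cnj (c n) * c n)"
    using integrable_p_mult[OF integrable_square_integrable[OF g]]
    by (simp add: Bochner_Integration.integral_sum c_def)
  also have "\<dots> = complex_of_real (\<Sum>n\<in>A. (cmod (c n))\<^sup>2)"
    by (simp add: complex_norm_square mult.commute del: of_real_power)
  finally have cross: "(LINT x|\<mu>. Re (g x * cnj (s x))) = (\<Sum>n\<in>A. (cmod (c n))\<^sup>2)"
    using integral_Re[OF int2] by simp
  have "0 \<le> (LINT x|\<mu>. (cmod (g x - s x))\<^sup>2)" by simp
  also have "\<dots> = (LINT x|\<mu>. (cmod (g x))\<^sup>2 - 2 * Re (g x * cnj (s x)) + (cmod (s x))\<^sup>2)"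
    by (intro Bochner_Integration.integral_cong refl norm_square_diff_complex)
  also have "\<dots> = (LINT x|\<mu>. (cmod (g x))\<^sup>2) - 2 * (LINT x|\<mu>. Re (g x * cnj (s x))) + (LINT x|\<mu>. (cmod (s x))\<^sup>2)"
    using int integrable_Re[OF int2] by (simp del: times_complex.sel)
  also have "\<dots> = (LINT x|\<mu>. (cmod (g x))\<^sup>2) - (\<Sum>n\<in>A. (cmod (c n))\<^sup>2)"
    unfolding cross unfolding s_def integral_norm_square_sum[OF A] by simp
  finally show ?thesis by (simp add: c_def)
qed

lemma coefficients_in_l2:
  assumes "square_integrable \<mu> g"
  shows "(\<lambda>n. LINT x|\<mu>. p n x * g x) \<in> l2"
proof -
  have "(\<Sum>n<N. (cmod (LINT x|\<mu>. p n x * g x))\<^sup>2) \<le> (LINT x|\<mu>. (cmod (g x))\<^sup>2)" for N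
  proof -
    \<comment> \<open>The dummy index contributes nothing because \<open>p 0\<close> vanishes;
      Bessel's inequality concerns indices from 1 on.\<close>
    have "(\<Sum>n<N. (cmod (LINT x|\<mu>. p n x * g x))\<^sup>2) = (\<Sum>n\<in>{..<N} - {0}. (cmod (LINT x|\<mu>. p n x * g x))\<^sup>2)"
      by (rule sum.mono_neutral_right) auto
    also have "\<dots> \<le> (LINT x|\<mu>. (cmod (g x))\<^sup>2)"
      by (intro bessel assms) auto
    finally show ?thesis .
  qed
  then have "summable (\<lambda>n. (cmod (LINT x|\<mu>. p n x * g x))\<^sup>2)"
    by (intro summableI_nonneg_bounded) auto
  then show ?thesis by (simp add: l2_def)
qed

text \<open>Integrating the three-term recurrence against a function shows that
  \<open>jacobi_op b\<close> acts on coefficients as multiplication by the variable. The row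
  \<open>n = 1\<close> is included because \<open>p 0\<close> is zero.\<close>

lemma resolvent_coefficients:
  assumes g: "square_integrable \<mu> g" and "Im lam \<noteq> 0"
  defines "u \<equiv> \<lambda>n. LINT x|\<mu>. p n x * (1 / (of_real x - lam) * g x)"
  shows "u \<in> l2" and "jacobi_op b u n - lam * u n = (LINT x|\<mu>. p n x * g x)"
proof -
  define h where "h = (\<lambda>x. 1 / (of_real x - lam) * g x)"
  have h: "square_integrable \<mu> h"
    unfolding h_def using norm_cauchy_kernel_le[OF assms(2)] by (intro square_integrable_mult g) measurable
  have u_eq: "u = (\<lambda>n. LINT x|\<mu>. p n x * h x)" by (simp only: u_def h_def)
  show "u \<in> l2" unfolding u_eq by (rule coefficients_in_l2[OF h])
  have int: "integrable \<mu> (\<lambda>x. p n x * h x)" for n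
    by (intro integrable_p_mult integrable_square_integrable h)
  show "jacobi_op b u n - lam * u n = (LINT x|\<mu>. p n x * g x)"
  proof (cases "n = 0")
    case True
    then show ?thesis by (simp add: jacobi_op_def u_eq)
  next
    case False
    have "jacobi_op b u n - lam * u n = u (n - 1) + of_real (b n) * u n + u (Suc n) - lam * u n"
      using False by (auto simp: jacobi_op_def u_eq numeral_2_eq_2)
    also have "\<dots> = (LINT x|\<mu>. p (n - 1) x * h x + of_real (b n) * (p n x * h x) + p (Suc n) x * h x
        - lam * (p n x * h x))"
      unfolding u_eq using int by simp
    also have "\<dots> = (LINT x|\<mu>. p n x * g x)"
    proof (intro Bochner_Integration.integral_cong refl)
      fix x
      have "p (Suc n) x = (of_real x - of_real (b n)) * p n x - p (n - 1) x"
        unfolding p_def using False by (intro first_kind_rec) auto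
      then have "p (n - 1) x * h x + of_real (b n) * (p n x * h x) + p (Suc n) x * h x
          - lam * (p n x * h x) = p n x * ((of_real x - lam) * h x)"
        by (simp only:) (simp add: algebra_simps)
      moreover have "of_real x - lam \<noteq> 0" using assms(2) by (auto simp: complex_eq_iff)
      then have "(of_real x - lam) * h x = g x" by (simp add: h_def)
      ultimately show "p (n - 1) x * h x + of_real (b n) * (p n x * h x) + p (Suc n) x * h x
          - lam * (p n x * h x) = p n x * g x" by simp
    qed
    finally show ?thesis .
  qed
qed

text \<open>For the constant function 1 the coefficients form the first basis vector. The resulting
  resolvent vector \<open>u\<close> therefore solves the homogeneous recurrence from the second row
  on, the first row supplies the inhomogeneity carried by \<open>second_kind\<close>, and
  \<open>u 1\<close> is the Borel transform since \<open>p 1\<close> is 1.\<close>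

lemma weyl_m_eq_borel_transform:
  assumes "Im lam \<noteq> 0"
  shows "weyl_m b lam = borel_transform \<mu> lam"
proof (rule weyl_m_eqI[OF assms])
  define u where "u = (\<lambda>n. LINT x|\<mu>. p n x * (1 / (of_real x - lam) * 1))"
  have u: "u \<in> l2" "jacobi_op b u n - lam * u n = (LINT x|\<mu>. p n x * 1)" for n
    unfolding u_def by (intro resolvent_coefficients square_integrable_const assms)+
  have e1: "(LINT x|\<mu>. p n x * 1) = of_bool (n = 1)" if "n \<ge> 1" for n
    using p_orthonormal[OF that, of 1] by simp
  have u1: "u 1 = borel_transform \<mu> lam" by (simp add: u_def borel_transform_def)
  have u0: "u 0 = 0" by (simp add: u_def)
  have sol: "u n = second_kind b n lam + u 1 * first_kind b n lam" for n
  proof (induction n rule: less_induct)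
    case (less n)
    consider "n = 0" | "n = 1" | "n = 2" | "n \<ge> 3" by linarith
    then show ?case
    proof cases
      case 3
      then show ?thesis
        using u(2)[of 1] e1[of 1] by (simp add: jacobi_op_def numeral_2_eq_2 algebra_simps)
    next
      case 4
      then obtain m where 4: "n = Suc m" "m \<ge> 2" by (cases n) auto
      have "u (m - 1) + of_real (b m) * u m + u (Suc m) - lam * u m = 0"
        using u(2)[of m] e1[of m] 4 by (simp add: jacobi_op_def)
      then have "u (Suc m) = (lam - of_real (b m)) * u m - u (m - 1)"
        by algebra
      moreover have "u m = second_kind b m lam + u 1 * first_kind b m lam"
        "u (m - 1) = second_kind b (m - 1) lam + u 1 * first_kind b (m - 1) lam"
        using 4 less[of m] less[of "m - 1"] by auto
      ultimately show ?thesis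
        using 4 by (simp add: first_kind_rec second_kind_rec algebra_simps)
    qed (use u0 in auto)
  qed
  have "u n = second_kind b n lam + borel_transform \<mu> lam * first_kind b n lam" for n
    using sol[of n] u1 by simp
  then have "u = (\<lambda>n. second_kind b n lam + borel_transform \<mu> lam * first_kind b n lam)"
    by (rule ext)
  with u(1) show "(\<lambda>n. second_kind b n lam + borel_transform \<mu> lam * first_kind b n lam) \<in> l2"
    by simp
qed

end

section \<open>Densities\<close>

lemma borel_measurable_Im_borel_transform:
  assumes "finite_borel_measure \<mu>" "e > 0"
  shows "(\<lambda>x. Im (borel_transform \<mu> (Complex x e))) \<in> borel_measurable borel"
proof -
  interpret finite_borel_measure \<mu> by fact
  have [measurable_cong]: "sets \<mu> = sets borel" by (rule M_is_borel)
  show ?thesis unfolding Im_borel_transform[OF assms] by measurable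
qed

lemma borel_measurable_indicator_mult:
  fixes w :: "real \<Rightarrow> real"
  assumes "continuous_on S w" "A \<subseteq> S" "A \<in> sets borel"
  shows "(\<lambda>x. indicator A x * w x) \<in> borel_measurable borel"
  using borel_measurable_continuous_on_indicator[OF assms(3) continuous_on_subset[OF assms(1,2)]] by simp

text \<open>Only intervals whose closure lies in \<open>S\<close> are tested, so nothing is claimed
  about the mass of the excluded points or about integrability of \<open>w\<close> near
  them.\<close>

definition has_density_on :: "real measure \<Rightarrow> real set \<Rightarrow> (real \<Rightarrow> real) \<Rightarrow> bool" where
  "has_density_on \<mu> S w \<longleftrightarrow> (\<forall>s t. s < t \<longrightarrow> {s..t} \<subseteq> S \<longrightarrow>
     measure \<mu> {s<..t} = (LINT x|lborel. indicator {s..t} x * w x))"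

lemma integrable_const_indicator_Icc: "integrable lborel (\<lambda>x::real. C * indicator {s..t} x :: real)"
  by (intro integrable_mult_right integrable_real_indicator) (auto simp: emeasure_lborel_Icc_eq)

lemma set_integral_Icc_le:
  fixes w :: "real \<Rightarrow> real"
  assumes "continuous_on {s..t} w" "\<And>x. x \<in> {s..t} \<Longrightarrow> \<bar>w x\<bar> \<le> C" "s \<le> t"
  shows "integrable lborel (\<lambda>x. indicator {s..t} x * w x)"
    "\<bar>LINT x|lborel. indicator {s..t} x * w x\<bar> \<le> C * (t - s)"
proof -
  have "integrable lborel (\<lambda>x. indicator {s..t} x *\<^sub>R w x)"
    by (intro borel_integrable_compact compact_Icc assms)
  then show *: "integrable lborel (\<lambda>x. indicator {s..t} x * w x)"
    by simp
  have "\<bar>LINT x|lborel. indicator {s..t} x * w x\<bar> \<le> (LINT x|lborel. \<bar>indicator {s..t} x * w x\<bar>)"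
    by (rule integral_abs_bound)
  also have "\<dots> \<le> (LINT x|lborel. C * indicator {s..t} x)"
  proof (rule integral_mono)
    show "integrable lborel (\<lambda>x. \<bar>indicator {s..t} x * w x\<bar>)" using * by simp
    show "\<bar>indicator {s..t} x * w x\<bar> \<le> C * indicator {s..t} x" for x
      using assms(2) by (auto simp: indicator_def)
  qed (rule integrable_const_indicator_Icc)
  also have "\<dots> = C * (t - s)" using assms(3) by simp
  finally show "\<bar>LINT x|lborel. indicator {s..t} x * w x\<bar> \<le> C * (t - s)" .
qed

text \<open>Used to exclude atoms: the mass of a point is bounded by that of every small interval
  around it, which has length \<open>2 * h\<close>.\<close>

lemma nonpos_if_le_small_multiples:
  fixes m C d :: real
  assumes "d > 0" and "\<And>h. 0 < h \<Longrightarrow> h < d \<Longrightarrow> m \<le> C * (2 * h)"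
  shows "m \<le> 0"
proof -
  have "\<forall>\<^sub>F h in at_right 0. h < d" using assms(1) by (auto intro!: order_tendstoD tendsto_intros)
  with eventually_at_right_less[of 0] have ev: "\<forall>\<^sub>F h in at_right 0. m \<le> C * (2 * h)"
    by eventually_elim (rule assms(2))
  have "((\<lambda>h. C * (2 * h)) \<longlongrightarrow> C * (2 * 0)) (at_right 0)" by (intro tendsto_intros)
  then have "m \<le> C * (2 * 0)" using ev by (rule tendsto_lowerbound) simp
  then show ?thesis by simp
qed

text \<open>Dominated convergence identifies the limit in the inversion formula, which counts
  end-point atoms by half. The same formula on shrinking intervals around a point shows that there
  are no atoms; the strict inequalities \<open>a < s\<close> and \<open>t < b\<close> leave room for
  these intervals.\<close>

lemma stieltjes_density:
  assumes "finite_borel_measure \<mu>" "\<And>n. e n > 0" "e \<longlonglongrightarrow> 0"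
    and "continuous_on {a..b} w"
    and lim: "\<And>x. x \<in> {a..b} \<Longrightarrow> (\<lambda>n. Im (borel_transform \<mu> (Complex x (e n)))) \<longlonglongrightarrow> pi * w x"
    and bound: "\<And>n x. x \<in> {a..b} \<Longrightarrow> \<bar>Im (borel_transform \<mu> (Complex x (e n)))\<bar> \<le> C"
    and st: "a < s" "s < t" "t < b"
  shows "measure \<mu> {s<..t} = (LINT x|lborel. indicator {s..t} x * w x)"
proof -
  interpret finite_borel_measure \<mu> by fact
  have meas [measurable]: "(\<lambda>x. Im (borel_transform \<mu> (Complex x (e n)))) \<in> borel_measurable borel" for n
    by (rule borel_measurable_Im_borel_transform) fact+
  have half: "(measure \<mu> {s<..<t} + measure \<mu> {s..t}) / 2 = (LINT x|lborel. indicator {s..t} x * w x)"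
    if "a \<le> s" "s < t" "t \<le> b" for s t
  proof -
    have [measurable]: "(\<lambda>x. indicator {s..t} x * w x) \<in> borel_measurable borel"
      using that by (intro borel_measurable_indicator_mult[OF assms(4)]) auto
    have "(\<lambda>n. LINT x|lborel. indicator {s..t} x *\<^sub>R Im (borel_transform \<mu> (Complex x (e n))))
        \<longlonglongrightarrow> (LINT x|lborel. pi * (indicator {s..t} x * w x))"
    proof (rule integral_dominated_convergence[where w = "\<lambda>x. C * indicator {s..t} x"])
      show "AE x in lborel. (\<lambda>n. indicator {s..t} x *\<^sub>R Im (borel_transform \<mu> (Complex x (e n))))
          \<longlonglongrightarrow> pi * (indicator {s..t} x * w x)"
        using lim that by (intro AE_I2) (auto simp: indicator_def)
      show "AE x in lborel. norm (indicator {s..t} x *\<^sub>R Im (borel_transform \<mu> (Complex x (e n))))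
          \<le> C * indicator {s..t} x" for n
        using bound that by (intro AE_I2) (auto simp: indicator_def)
      show "integrable lborel (\<lambda>x. C * indicator {s..t} x)"
        by (rule integrable_const_indicator_Icc)
    qed auto
    from LIMSEQ_unique[OF this stieltjes_inversion[OF assms(1-3) that(2)]] show ?thesis
      by simp
  qed
  have "\<bar>pi * w x\<bar> \<le> C" if "x \<in> {a..b}" for x
    using bound[OF that] by (intro LIMSEQ_le_const2[OF tendsto_rabs[OF lim[OF that]]]) auto
  then have w: "\<bar>w x\<bar> \<le> C / pi" if "x \<in> {a..b}" for x
    using that by (simp add: abs_mult field_simps)
  have atom: "measure \<mu> {p} = 0" if p: "a < p" "p < b" for p
  proof -
    have "measure \<mu> {p} \<le> 0"
    proof (rule nonpos_if_le_small_multiples[of "min (p - a) (b - p)"])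
      fix h assume h: "0 < h" "h < min (p - a) (b - p)"
      have "measure \<mu> {p} \<le> measure \<mu> {p - h<..<p + h}" "measure \<mu> {p} \<le> measure \<mu> {p - h..p + h}"
        using h by (auto intro!: finite_measure_mono)
      then have "measure \<mu> {p} \<le> (LINT x|lborel. indicator {p - h..p + h} x * w x)"
        using half[of "p - h" "p + h"] h by simp
      also have "\<dots> \<le> C / pi * ((p + h) - (p - h))"
      proof (rule order_trans[OF abs_ge_self set_integral_Icc_le(2)])
        show "continuous_on {p - h..p + h} w"
          using h by (intro continuous_on_subset[OF assms(4)]) auto
        show "\<bar>w x\<bar> \<le> C / pi" if "x \<in> {p - h..p + h}" for x
          using that h by (intro w) auto
      qed (use h in auto)
      finally show "measure \<mu> {p} \<le> C / pi * (2 * h)" by simp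
    qed (use p in simp)
    then show ?thesis using measure_nonneg[of \<mu> "{p}"] by linarith
  qed
  have "measure \<mu> {s<..t} = measure \<mu> {s<..<t} + measure \<mu> {t}"
    using st by (subst finite_measure_Union[symmetric]) (auto intro!: arg_cong[where f = "measure \<mu>"])
  moreover have "measure \<mu> {s..t} = measure \<mu> {s} + measure \<mu> {s<..t}"
    using st by (subst finite_measure_Union[symmetric]) (auto intro!: arg_cong[where f = "measure \<mu>"])
  ultimately show ?thesis
    using half[of s t] atom[of s] atom[of t] st by simp
qed

text \<open>The limit formula holds between continuity points of \<open>cdf N\<close>, which are dense. It bounds the
  mass of short intervals, so there are no atoms in \<open>S\<close> and every point of \<open>S\<close> is a continuity point.\<close>

lemma has_density_on_weak_limit:
  assumes "\<And>n. real_distribution (M n)" "real_distribution N" "weak_conv_m M N"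
    and "open S" and w: "continuous_on S w" and wn: "\<And>n. continuous_on S (v n)"
    and dens: "\<And>n. has_density_on (M n) S (v n)"
    and lim: "\<And>x. x \<in> S \<Longrightarrow> (\<lambda>n. v n x) \<longlonglongrightarrow> w x"
    and bound: "\<And>a b. {a..b} \<subseteq> S \<Longrightarrow> \<exists>C. \<forall>n. \<forall>x\<in>{a..b}. \<bar>v n x\<bar> \<le> C"
  shows "has_density_on N S w"
  unfolding has_density_on_def
proof (intro allI impI)
  fix s t assume st: "s < t" "{s..t} \<subseteq> S"
  interpret M: real_distribution "M n" for n by fact
  interpret N: real_distribution N by fact
  let ?I = "\<lambda>w y y'. LINT x|lborel. indicator {y..y'} x * w x"
  have between: "cdf N y' - cdf N y = ?I w y y'"
    if sub: "{y..y'} \<subseteq> S" and y: "y < y'" "isCont (cdf N) y" "isCont (cdf N) y'" for y y'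
  proof (rule LIMSEQ_unique)
    obtain C where C: "\<And>n x. x \<in> {y..y'} \<Longrightarrow> \<bar>v n x\<bar> \<le> C" using bound[OF sub] by blast
    have "(\<lambda>n. cdf (M n) y' - cdf (M n) y) \<longlonglongrightarrow> cdf N y' - cdf N y"
      using assms(3) y by (intro tendsto_diff) (auto simp: weak_conv_m_def weak_conv_def)
    moreover have "cdf (M n) y' - cdf (M n) y = ?I (v n) y y'" for n
      using dens[of n] y sub by (subst M.cdf_diff_eq) (auto simp: has_density_on_def)
    ultimately show "(\<lambda>n. ?I (v n) y y') \<longlonglongrightarrow> cdf N y' - cdf N y" by simp
    have m: "(\<lambda>x. indicator {y..y'} x * f x) \<in> borel_measurable borel" if "continuous_on S f"
      for f :: "real \<Rightarrow> real"
      by (rule borel_measurable_indicator_mult[OF that sub]) simp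
    show "(\<lambda>n. ?I (v n) y y') \<longlonglongrightarrow> ?I w y y'"
    proof (rule integral_dominated_convergence[where w = "\<lambda>x. C * indicator {y..y'} x"])
      have "(\<lambda>n. indicator {y..y'} x * v n x) \<longlonglongrightarrow> indicator {y..y'} x * w x" for x
        using lim[of x] sub by (cases "x \<in> {y..y'}") auto
      then show "AE x in lborel. (\<lambda>n. indicator {y..y'} x * v n x) \<longlonglongrightarrow> indicator {y..y'} x * w x"
        by simp
      show "AE x in lborel. norm (indicator {y..y'} x * v n x) \<le> C * indicator {y..y'} x" for n
        using C by (intro AE_I2) (auto simp: indicator_def)
      show "integrable lborel (\<lambda>x. C * indicator {y..y'} x)"
        by (rule integrable_const_indicator_Icc)
    qed (use m[OF w] m[OF wn] in auto)
  qed
  have pts: "\<exists>z. y < z \<and> z < y' \<and> isCont (cdf N) z" if "y < y'" for y y'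
    using open_minus_countable[OF mono_ctble_discont[of "cdf N"], of "{y<..<y'}"] that
      N.cdf_nondecreasing by (auto simp: mono_def)
  have "isCont (cdf N) p" if p: "p \<in> S" for p
  proof -
    obtain d where d: "d > 0" "cball p d \<subseteq> S" using p assms(4) open_contains_cball by blast
    then have sub: "{p - d..p + d} \<subseteq> S" by (simp add: cball_eq_atLeastAtMost)
    obtain C where C: "\<forall>x\<in>{p - d..p + d}. norm (w x) \<le> C"
      using compact_continuous_bounded[OF compact_Icc continuous_on_subset[OF w sub]] by blast
    have "measure N {p} \<le> 0"
    proof (rule nonpos_if_le_small_multiples[OF d(1)])
      fix h assume h: "0 < h" "h < d"
      obtain y y' where y: "p - h < y" "y < p" "isCont (cdf N) y" "p < y'" "y' < p + h" "isCont (cdf N) y'"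
        using pts[of "p - h" p] pts[of p "p + h"] h by auto
      have yS: "{y..y'} \<subseteq> {p - d..p + d}" using y h by auto
      have "norm (w p) \<le> C" using C h by auto
      then have "C \<ge> 0" by (rule order_trans[OF norm_ge_zero])
      have "measure N {p} \<le> cdf N y' - cdf N y"
        using y by (subst N.cdf_diff_eq) (auto intro!: N.finite_measure_mono)
      also have "\<dots> = ?I w y y'" using y yS sub by (intro between) auto
      also have "\<dots> \<le> C * (y' - y)"
      proof (rule order_trans[OF abs_ge_self set_integral_Icc_le(2)])
        show "continuous_on {y..y'} w" using yS sub by (intro continuous_on_subset[OF w]) auto
      qed (use y yS C in auto)
      also have "\<dots> \<le> C * (2 * h)" using y \<open>C \<ge> 0\<close> by (intro mult_left_mono) auto
      finally show "measure N {p} \<le> C * (2 * h)" .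
    qed
    then show ?thesis unfolding N.isCont_cdf using measure_nonneg[of N "{p}"] by linarith
  qed
  moreover have "s \<in> {s..t}" "t \<in> {s..t}" using st by auto
  then have "s \<in> S" "t \<in> S" using st(2) by blast+
  ultimately show "measure N {s<..t} = ?I w s t"
    using between[OF st(2,1)] N.cdf_diff_eq[OF st(1)] by simp
qed

text \<open>Turns the identity for interval masses into one for measures, so that it applies to null
  sets and to integrals of the Poisson kernel. Rays suffice for the comparison, as they meet
  \<open>{a<..b}\<close> in intervals of the same kind.\<close>

lemma density_eq_lborel:
  assumes "finite_borel_measure \<mu>" "has_density_on \<mu> S w" "continuous_on S w" "\<forall>x\<in>S. w x \<ge> 0"
    and "{a..b} \<subseteq> S"
  shows "density \<mu> (indicator {a<..b}) = density lborel (\<lambda>x. ennreal (indicator {a<..b} x * w x))"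
    (is "?M = ?N")
proof (rule measure_eqI_lessThan)
  interpret finite_borel_measure \<mu> by fact
  have [measurable_cong]: "sets \<mu> = sets borel" by (rule M_is_borel)
  have [measurable]: "(\<lambda>x. indicator {a<..b} x * w x) \<in> borel_measurable borel"
    using assms(5) by (intro borel_measurable_indicator_mult[OF assms(3)]) auto
  show "sets ?M = sets borel" "sets ?N = sets borel" by (simp_all add: M_is_borel)
  fix x
  define m where "m = max a x"
  have eq: "indicator {a<..b} y * indicator {x<..} y = (indicator {m<..b} y :: ennreal)" for y
    by (auto simp: m_def indicator_def)
  have "emeasure ?M {x<..} = (\<integral>\<^sup>+y. indicator {a<..b} y * indicator {x<..} y \<partial>\<mu>)"
    by (rule emeasure_density) auto
  then have M: "emeasure ?M {x<..} = ennreal (measure \<mu> {m<..b})"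
    unfolding eq by (simp add: emeasure_eq_measure)
  then show "emeasure ?M {x<..} < \<infinity>" by simp
  have eq': "ennreal (indicator {a<..b} y * w y) * indicator {x<..} y = ennreal (indicator {m<..b} y * w y)" for y
    by (auto simp: m_def indicator_def)
  have "emeasure ?N {x<..} = (\<integral>\<^sup>+y. ennreal (indicator {a<..b} y * w y) * indicator {x<..} y \<partial>lborel)"
    by (rule emeasure_density) auto
  also have "\<dots> = (\<integral>\<^sup>+y. ennreal (indicator {m<..b} y * w y) \<partial>lborel)"
    by (simp only: eq')
  also have "\<dots> = (\<integral>\<^sup>+y. ennreal (indicator {m..b} y * w y) \<partial>lborel)"
    by (intro nn_integral_cong_AE) (use AE_lborel_singleton[of m] in
      \<open>auto simp: indicator_def elim!: eventually_mono\<close>)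
  also have "\<dots> = ennreal (measure \<mu> {m<..b})"
  proof (cases "m < b")
    case True
    have sub: "{m..b} \<subseteq> S" using assms(5) by (auto simp: m_def)
    have "(\<integral>\<^sup>+y. ennreal (indicator {m..b} y * w y) \<partial>lborel) = ennreal (LINT y|lborel. indicator {m..b} y * w y)"
    proof (rule nn_integral_eq_integral)
      have "integrable lborel (\<lambda>y. indicator {m..b} y *\<^sub>R w y)"
        by (intro borel_integrable_compact compact_Icc continuous_on_subset[OF assms(3) sub])
      then show "integrable lborel (\<lambda>y. indicator {m..b} y * w y)" by simp
      show "AE y in lborel. 0 \<le> indicator {m..b} y * w y"
        using assms(4) sub by (intro AE_I2) (auto simp: indicator_def)
    qed
    then show ?thesis using assms(2) True sub by (simp add: has_density_on_def)
  next
    case False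
    have "(\<integral>\<^sup>+y. ennreal (indicator {m..b} y * w y) \<partial>lborel) = (\<integral>\<^sup>+(y::real). 0 \<partial>lborel)"
      by (intro nn_integral_cong_AE) (use AE_lborel_singleton[of m] False in
        \<open>auto simp: indicator_def elim!: eventually_mono\<close>)
    then show ?thesis using False by simp
  qed
  finally show "emeasure ?M {x<..} = emeasure ?N {x<..}" using M by simp
qed

text \<open>The open set \<open>S\<close> is a union of countably many half-open rational intervals
  with closure in \<open>S\<close>, and on each of them \<open>\<mu>\<close> has a Lebesgue
  density.\<close>

lemma has_density_on_null:
  assumes "finite_borel_measure \<mu>" "has_density_on \<mu> S w" "continuous_on S w" "\<forall>x\<in>S. w x \<ge> 0"
    and "open S" "A \<in> sets borel" "A \<subseteq> S" "emeasure lborel A = 0"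
  shows "emeasure \<mu> A = 0"
proof -
  interpret finite_borel_measure \<mu> by fact
  have [measurable_cong]: "sets \<mu> = sets borel" by (rule M_is_borel)
  have [measurable]: "A \<in> sets borel" by fact
  define Q where "Q = {(a, b). a \<in> \<rat> \<and> b \<in> \<rat> \<and> {a..b} \<subseteq> S}"
  have "countable Q"
    by (rule countable_subset[of _ "\<rat> \<times> \<rat>"]) (auto simp: Q_def countable_rat)
  have "A \<inter> {a<..b} \<in> null_sets \<mu>" if "(a, b) \<in> Q" for a b
  proof -
    have sub: "{a..b} \<subseteq> S" using that by (simp add: Q_def)
    have [measurable]: "(\<lambda>x. indicator {a<..b} x * w x) \<in> borel_measurable borel"
      using sub by (intro borel_measurable_indicator_mult[OF assms(3)]) auto
    have "emeasure \<mu> (A \<inter> {a<..b}) = emeasure (density \<mu> (indicator {a<..b})) A"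
      by (subst emeasure_density) (auto simp: indicator_inter_arith[symmetric] Int_commute)
    also have "\<dots> = emeasure (density lborel (\<lambda>x. ennreal (indicator {a<..b} x * w x))) A"
      by (subst density_eq_lborel[OF assms(1-4) sub]) auto
    also have "\<dots> = (\<integral>\<^sup>+x. ennreal (indicator {a<..b} x * w x) * indicator A x \<partial>lborel)"
      by (subst emeasure_density) auto
    also have "\<dots> = (\<integral>\<^sup>+(x::real). 0 \<partial>lborel)"
    proof (rule nn_integral_cong_AE)
      have "AE x in lborel. x \<notin> A"
        using assms(8) by (intro AE_not_in) (auto simp: null_sets_def)
      then show "AE x in lborel. ennreal (indicator {a<..b} x * w x) * indicator A x = 0"
        by eventually_elim auto
    qed
    finally show ?thesis by (auto simp: null_sets_def)
  qed
  then have "(\<Union>(a, b)\<in>Q. A \<inter> {a<..b}) \<in> null_sets \<mu>"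
    by (intro null_sets_UN') (use \<open>countable Q\<close> in auto)
  moreover have "(\<Union>(a, b)\<in>Q. A \<inter> {a<..b}) = A"
  proof -
    have "\<exists>a b. (a, b) \<in> Q \<and> x \<in> {a<..b}" if "x \<in> A" for x
    proof -
      have "x \<in> S" using that assms(7) by auto
      then obtain d where d: "d > 0" "cball x d \<subseteq> S" using assms(5) open_contains_cball by blast
      obtain a where a: "a \<in> \<rat>" "x - d < a" "a < x" using Rats_dense_in_real[of "x - d" x] d by auto
      obtain b where b: "b \<in> \<rat>" "x < b" "b < x + d" using Rats_dense_in_real[of x "x + d"] d by auto
      have "{a..b} \<subseteq> cball x d" using a b by (auto simp: cball_eq_atLeastAtMost)
      then show ?thesis using a b d by (intro exI[of _ a] exI[of _ b]) (auto simp: Q_def)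
    qed
    note ex = this
    show ?thesis
    proof (intro equalityI subsetI)
      fix x assume "x \<in> A"
      with ex obtain a b where "(a, b) \<in> Q" "x \<in> {a<..b}" by blast
      then show "x \<in> (\<Union>(a, b)\<in>Q. A \<inter> {a<..b})"
        using \<open>x \<in> A\<close> by (intro UN_I[of "(a, b)"]) auto
    qed auto
  qed
  ultimately show ?thesis by auto
qed

text \<open>The Poisson kernel at unit scale; it serves both as the limit mass and as the dominating
  function when kernels are rescaled.\<close>

lemma has_bochner_integral_inverse_1_plus_square:
  "has_bochner_integral lborel (\<lambda>s::real. 1 / (s\<^sup>2 + 1)) pi"
proof (rule has_bochner_integral_monotone_convergence)
  let ?f = "\<lambda>n s. indicator {- real n..real n} s * (1 / (s\<^sup>2 + 1))"
  have cont: "continuous_on {- real n..real n} (\<lambda>s::real. 1 / (s\<^sup>2 + 1))" for n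
    by (intro continuous_intros) (auto simp: add_nonneg_eq_0_iff)
  show "integrable lborel (?f n)" for n
    by (rule set_integral_Icc_le(1)[OF cont, of _ 1]) (auto simp: divide_le_eq_1 add_nonneg_pos)
  show "AE s in lborel. mono (\<lambda>n. ?f n s)"
    by (intro AE_I2) (auto simp: mono_def indicator_def)
  show "AE s in lborel. (\<lambda>n. ?f n s) \<longlonglongrightarrow> 1 / (s\<^sup>2 + 1)"
  proof (rule AE_I2)
    fix s :: real
    have "\<forall>\<^sub>F n in sequentially. \<bar>s\<bar> < real n"
      using filterlim_real_sequentially unfolding filterlim_at_top_dense by blast
    then have "\<forall>\<^sub>F n in sequentially. ?f n s = 1 / (s\<^sup>2 + 1)"
      by eventually_elim (auto simp: indicator_def)
    then show "(\<lambda>n. ?f n s) \<longlonglongrightarrow> 1 / (s\<^sup>2 + 1)" by (rule tendsto_eventually)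
  qed
  have "(LINT s|lborel. ?f n s) = arctan (real n) - arctan (- real n)" for n
    using integral_poisson_kernel[of 1 "- real n" "real n" 0] by simp
  moreover have "(\<lambda>n. arctan (real n) - arctan (- real n)) \<longlonglongrightarrow> pi / 2 - - (pi / 2)"
    by (intro tendsto_diff filterlim_compose[OF tendsto_arctan_at_top]
        filterlim_compose[OF tendsto_arctan_at_bot] filterlim_real_sequentially
        filterlim_compose[OF filterlim_uminus_at_bot_at_top])
  ultimately show "(\<lambda>n. LINT s|lborel. ?f n s) \<longlonglongrightarrow> pi" by simp
qed measurable

text \<open>The kernel is split at a neighbourhood of \<open>x\<close> inside \<open>S\<close>. Near
  \<open>x\<close> the substitution \<open>t = x + e n * s\<close> turns it into the fixed kernel
  \<open>1 / (s\<^sup>2 + 1)\<close>, and continuity of \<open>w\<close> at \<open>x\<close> gives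
  the limit; away from \<open>x\<close> the kernel is at most
  \<open>e n / d\<^sup>2\<close>.\<close>

lemma has_density_on_poisson:
  assumes "finite_borel_measure \<mu>" "has_density_on \<mu> S w" "continuous_on S w" "\<forall>x\<in>S. w x \<ge> 0"
    and "open S" "x \<in> S"
  shows "((\<lambda>\<epsilon>. Im (borel_transform \<mu> (Complex x \<epsilon>))) \<longlongrightarrow> pi * w x) (at_right 0)"
  unfolding tendsto_at_iff_sequentially
proof (intro allI impI)
  fix e :: "nat \<Rightarrow> real"
  assume "\<forall>n. e n \<in> {0<..} - {0}" and e0: "e \<longlonglongrightarrow> 0"
  then have e: "e n > 0" for n by simp
  interpret finite_borel_measure \<mu> by fact
  have [measurable_cong]: "sets \<mu> = sets borel" by (rule M_is_borel)
  obtain d where d: "d > 0" "cball x d \<subseteq> S" using assms(5,6) open_contains_cball by blast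
  define a b where "a = x - d" and "b = x + d"
  have ab: "a < x" "x < b" using d by (auto simp: a_def b_def)
  have sub: "{a..b} \<subseteq> S" using d by (simp add: a_def b_def cball_eq_atLeastAtMost)
  obtain C where "\<forall>y\<in>{a..b}. norm (w y) \<le> C"
    using compact_continuous_bounded[OF compact_Icc continuous_on_subset[OF assms(3) sub]] by blast
  then have C: "\<bar>w y\<bar> \<le> C" if "y \<in> {a..b}" for y using that by auto
  have [measurable]: "(\<lambda>x. indicator {a<..b} x * w x) \<in> borel_measurable borel"
    using sub by (intro borel_measurable_indicator_mult[OF assms(3)]) auto
  let ?P = "\<lambda>n t. e n / ((t - x)\<^sup>2 + (e n)\<^sup>2)"
  let ?g = "\<lambda>t. indicator {a<..b} t * w t"
  have int: "integrable \<mu> (\<lambda>t. indicator A t * ?P n t)" if [measurable]: "A \<in> sets borel" for n A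
  proof (rule integrable_const_bound[where B = "1 / e n"])
    show "AE t in \<mu>. norm (indicator A t * ?P n t) \<le> 1 / e n"
      using poisson_kernel_le[OF e] e by (intro AE_I2) (auto simp: indicator_def less_imp_le)
  qed measurable
  have near: "(LINT t|\<mu>. indicator {a<..b} t * ?P n t) = (LINT s|lborel. ?g (x + e n * s) * (1 / (s\<^sup>2 + 1)))" for n
  proof -
    have "(LINT t|\<mu>. indicator {a<..b} t * ?P n t) = (LINT t|density \<mu> (indicator {a<..b}). ?P n t)"
    proof -
      have eq: "density \<mu> (indicator {a<..b}) = density \<mu> (\<lambda>t. ennreal (indicator {a<..b} t))"
        by (rule density_cong) (auto simp: indicator_def)
      show ?thesis unfolding eq by (subst integral_real_density) auto
    qed
    also have "\<dots> = (LINT t|lborel. ?g t * ?P n t)"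
      unfolding density_eq_lborel[OF assms(1-4) sub]
    proof (rule integral_real_density)
      show "AE t in lborel. 0 \<le> ?g t"
        using assms(4) sub by (intro AE_I2) (auto simp: indicator_def subset_iff)
    qed auto
    also have "\<dots> = e n * (LINT s|lborel. ?g (x + e n * s) * ?P n (x + e n * s))"
      using e[of n] by (subst lborel_integral_real_affine[where c = "e n" and t = x]) auto
    also have "\<dots> = (LINT s|lborel. e n * (?g (x + e n * s) * ?P n (x + e n * s)))"
      by (rule integral_mult_right_zero[symmetric])
    also have "\<dots> = (LINT s|lborel. ?g (x + e n * s) * (1 / (s\<^sup>2 + 1)))"
    proof (intro Bochner_Integration.integral_cong refl)
      fix s :: real
      have "s\<^sup>2 + 1 > 0" by (intro add_nonneg_pos) auto
      moreover have "(x + e n * s - x)\<^sup>2 + (e n)\<^sup>2 = (e n)\<^sup>2 * (s\<^sup>2 + 1)"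
        by (simp add: algebra_simps power2_eq_square)
      ultimately have "?P n (x + e n * s) = 1 / (e n * (s\<^sup>2 + 1))"
        using e[of n] by (simp add: power2_eq_square)
      then show "e n * (?g (x + e n * s) * ?P n (x + e n * s)) = ?g (x + e n * s) * (1 / (s\<^sup>2 + 1))"
        using e[of n] by simp
    qed
    finally show ?thesis .
  qed
  have "(\<lambda>n. LINT s|lborel. ?g (x + e n * s) * (1 / (s\<^sup>2 + 1)))
      \<longlonglongrightarrow> (LINT s|lborel. w x * (1 / (s\<^sup>2 + 1)))"
  proof (rule integral_dominated_convergence[where w = "\<lambda>s. C * (1 / (s\<^sup>2 + 1))"])
    show "integrable lborel (\<lambda>s::real. C * (1 / (s\<^sup>2 + 1)))"
      using has_bochner_integral_inverse_1_plus_square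
      by (intro integrable_mult_right) (rule integrable.intros)
    show "AE s in lborel. (\<lambda>n. ?g (x + e n * s) * (1 / (s\<^sup>2 + 1))) \<longlonglongrightarrow> w x * (1 / (s\<^sup>2 + 1))"
    proof (intro AE_I2 tendsto_mult tendsto_const)
      fix s
      have lim: "(\<lambda>n. x + e n * s) \<longlonglongrightarrow> x" by (rule tendsto_eq_intros refl e0 | simp)+
      have "\<forall>\<^sub>F n in sequentially. x + e n * s > a" "\<forall>\<^sub>F n in sequentially. x + e n * s < b"
        using ab by (auto intro: order_tendstoD[OF lim])
      then have "\<forall>\<^sub>F n in sequentially. w (x + e n * s) = ?g (x + e n * s)"
        by eventually_elim auto
      moreover have "isCont w x"
        using assms(3,5,6) continuous_on_eq_continuous_at by blast
      then have "(\<lambda>n. w (x + e n * s)) \<longlonglongrightarrow> w x" by (rule isCont_tendsto_compose[OF _ lim])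
      ultimately show "(\<lambda>n. ?g (x + e n * s)) \<longlonglongrightarrow> w x" by (rule Lim_transform_eventually[rotated])
    qed
    show "AE s in lborel. norm (?g (x + e n * s) * (1 / (s\<^sup>2 + 1))) \<le> C * (1 / (s\<^sup>2 + 1))" for n
    proof (rule AE_I2)
      fix s :: real
      have "C \<ge> 0" using C[of b] ab by (auto intro: order_trans[OF abs_ge_zero])
      then have "\<bar>?g (x + e n * s)\<bar> \<le> C" using C by (auto simp: indicator_def)
      then show "norm (?g (x + e n * s) * (1 / (s\<^sup>2 + 1))) \<le> C * (1 / (s\<^sup>2 + 1))"
        by (simp add: abs_mult divide_right_mono)
    qed
  qed measurable
  also have "(LINT s|lborel. w x * (1 / (s\<^sup>2 + 1))) = pi * w x"
    unfolding integral_mult_right_zero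
      has_bochner_integral_integral_eq[OF has_bochner_integral_inverse_1_plus_square] by simp
  finally have near_lim: "(\<lambda>n. LINT t|\<mu>. indicator {a<..b} t * ?P n t) \<longlonglongrightarrow> pi * w x"
    unfolding near .
  have far_lim: "(\<lambda>n. LINT t|\<mu>. indicator (- {a<..b}) t * ?P n t) \<longlonglongrightarrow> 0"
  proof (rule Lim_null_comparison)
    have "norm (LINT t|\<mu>. indicator (- {a<..b}) t * ?P n t) \<le> e n / d\<^sup>2 * measure \<mu> (space \<mu>)" for n
    proof -
      have "norm (LINT t|\<mu>. indicator (- {a<..b}) t * ?P n t) \<le> (LINT t|\<mu>. e n / d\<^sup>2)"
      proof (rule order_trans[OF integral_norm_bound], rule integral_mono)
        fix t
        have "?P n t \<le> e n / d\<^sup>2" if "t \<notin> {a<..b}"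
        proof (rule divide_left_mono)
          have "d \<le> \<bar>t - x\<bar>" using that by (auto simp: a_def b_def)
          then have "d\<^sup>2 \<le> \<bar>t - x\<bar>\<^sup>2" using d by (intro power_mono) auto
          moreover have "0 \<le> (e n)\<^sup>2" by simp
          ultimately show le: "d\<^sup>2 \<le> (t - x)\<^sup>2 + (e n)\<^sup>2"
            unfolding power2_abs by linarith
          have "0 < d\<^sup>2" using d by simp
          then show "0 < ((t - x)\<^sup>2 + (e n)\<^sup>2) * d\<^sup>2"
            using le by (intro mult_pos_pos less_le_trans[OF \<open>0 < d\<^sup>2\<close> le])
        qed (use e[of n] in auto)
        then show "norm (indicator (- {a<..b}) t * ?P n t) \<le> e n / d\<^sup>2"
          using e[of n] by (auto simp: indicator_def)
        show "integrable \<mu> (\<lambda>t. norm (indicator (- {a<..b}) t * ?P n t))"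
          by (intro integrable_norm int) auto
      qed auto
      then show ?thesis by (simp add: mult.commute)
    qed
    then show "\<forall>\<^sub>F n in sequentially. norm (LINT t|\<mu>. indicator (- {a<..b}) t * ?P n t) \<le> e n / d\<^sup>2 * measure \<mu> (space \<mu>)"
      by simp
    show "(\<lambda>n. e n / d\<^sup>2 * measure \<mu> (space \<mu>)) \<longlonglongrightarrow> 0"
      using d by (auto intro!: tendsto_eq_intros e0)
  qed
  have "Im (borel_transform \<mu> (Complex x (e n)))
      = (LINT t|\<mu>. indicator {a<..b} t * ?P n t) + (LINT t|\<mu>. indicator (- {a<..b}) t * ?P n t)" for n
  proof -
    have "(LINT t|\<mu>. ?P n t) = (LINT t|\<mu>. indicator {a<..b} t * ?P n t + indicator (- {a<..b}) t * ?P n t)"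
      by (intro Bochner_Integration.integral_cong) (auto simp: indicator_def)
    also have "\<dots> = (LINT t|\<mu>. indicator {a<..b} t * ?P n t) + (LINT t|\<mu>. indicator (- {a<..b}) t * ?P n t)"
      by (intro Bochner_Integration.integral_add int) auto
    finally show ?thesis by (simp add: Im_borel_transform[OF assms(1) e])
  qed
  with tendsto_add[OF near_lim far_lim]
  show "((\<lambda>\<epsilon>. Im (borel_transform \<mu> (Complex x \<epsilon>))) \<circ> e) \<longlonglongrightarrow> pi * w x"
    by (simp add: o_def)
qed

section \<open>Completeness and the spectral measures of arbitrary vectors\<close>

context jacobi_measure
begin

definition psum :: "(nat \<Rightarrow> complex) \<Rightarrow> nat \<Rightarrow> real \<Rightarrow> complex" where
  "psum f N x = (\<Sum>n=1..N. f n * p n x)"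

lemma square_integrable_psum: "square_integrable \<mu> (psum f N)"
  unfolding psum_def[abs_def] by (rule square_integrable_sum)

lemma integral_psum_diff:
  assumes "M \<le> N"
  shows "(LINT x|\<mu>. (cmod (psum f N x - psum f M x))\<^sup>2) = (\<Sum>n\<in>{M<..N}. (cmod (f n))\<^sup>2)"
proof -
  have "psum f N x - psum f M x = (\<Sum>n\<in>{M<..N}. f n * p n x)" for x
  proof -
    have "{1..N} = {1..M} \<union> {M<..N}" using assms by auto
    then have "psum f N x = psum f M x + (\<Sum>n\<in>{M<..N}. f n * p n x)"
      unfolding psum_def by (simp only:) (intro sum.union_disjoint; auto)
    then show ?thesis by simp
  qed
  then show ?thesis by (simp add: integral_norm_square_sum subset_iff)
qed

text \<open>The rate is chosen so that consecutive distances are at most \<open>(1 / 2) ^ k\<close>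
  in mean, hence summable; this gives convergence almost everywhere, and Fatou's lemma carries the
  square integral bounds over to the limit \<open>g\<close>. Where the sequence diverges, a null
  set, the value of \<open>lim\<close> is irrelevant.\<close>

lemma square_integrable_limit:
  fixes s :: "nat \<Rightarrow> real \<Rightarrow> complex"
  assumes s: "\<And>k. square_integrable \<mu> (s k)"
    and cauchy: "\<And>j k. k \<le> j \<Longrightarrow> (LINT x|\<mu>. (cmod (s j x - s k x))\<^sup>2) \<le> (1 / 4) ^ k"
  shows "\<exists>g. square_integrable \<mu> g \<and> (\<lambda>k. LINT x|\<mu>. (cmod (g x - s k x))\<^sup>2) \<longlonglongrightarrow> 0"
proof -
  note [measurable] = s[THEN square_integrable_measurable]
  define g where "g = (\<lambda>x. lim (\<lambda>k. s k x))"
  have [measurable]: "g \<in> borel_measurable borel"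
    unfolding g_def by measurable
  have step: "(LINT x|\<mu>. cmod (s (Suc k) x - s k x)) \<le> (1 / 2) ^ k" for k
  proof -
    have "(LINT x|\<mu>. cmod (s (Suc k) x - s k x) * cmod 1)\<^sup>2
        \<le> (LINT x|\<mu>. (cmod (s (Suc k) x - s k x))\<^sup>2) * (LINT x|\<mu>. (cmod 1)\<^sup>2)"
      by (intro cauchy_schwarz square_integrable_minus s square_integrable_const)
    also have "\<dots> \<le> (1 / 4) ^ k"
      using cauchy[of k "Suc k"] prob_space by simp
    also have "\<dots> = ((1 / 2) ^ k)\<^sup>2" by (simp add: power2_eq_square flip: power_mult_distrib)
    finally have "(LINT x|\<mu>. cmod (s (Suc k) x - s k x) * cmod 1) \<le> (1 / 2) ^ k"
      by (rule power2_le_imp_le) simp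
    then show ?thesis by simp
  qed
  have int_step: "integrable \<mu> (\<lambda>x. cmod (s (Suc k) x - s k x))" for k
    by (intro integrable_norm integrable_square_integrable square_integrable_minus s)
  have "(\<integral>\<^sup>+x. (\<Sum>k. ennreal (cmod (s (Suc k) x - s k x))) \<partial>\<mu>)
      = (\<Sum>k. \<integral>\<^sup>+x. ennreal (cmod (s (Suc k) x - s k x)) \<partial>\<mu>)"
    by (rule nn_integral_suminf) measurable
  also have "\<dots> = (\<Sum>k. ennreal (LINT x|\<mu>. cmod (s (Suc k) x - s k x)))"
    by (subst nn_integral_eq_integral[OF int_step]) auto
  also have "\<dots> \<le> (\<Sum>k. ennreal ((1 / 2) ^ k))"
    by (intro suminf_le ennreal_leI step) auto
  also have "\<dots> = ennreal (\<Sum>k. (1 / 2) ^ k)"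
    by (intro suminf_ennreal2 summable_geometric) auto
  also have "\<dots> < \<infinity>" by simp
  finally have "AE x in \<mu>. (\<Sum>k. ennreal (cmod (s (Suc k) x - s k x))) \<noteq> \<infinity>"
    by (intro nn_integral_PInf_AE) auto
  then have lim: "AE x in \<mu>. (\<lambda>k. s k x) \<longlonglongrightarrow> g x"
  proof eventually_elim
    case (elim x)
    then have "summable (\<lambda>k. cmod (s (Suc k) x - s k x))"
      by (intro summable_suminf_not_top) auto
    then have "summable (\<lambda>k. s (Suc k) x - s k x)" by (rule summable_norm_cancel)
    then have "convergent (\<lambda>n. \<Sum>k<n. s (Suc k) x - s k x)" by (simp add: summable_iff_convergent)
    then have "convergent (\<lambda>n. s n x - s 0 x)" by (simp only: sum_lessThan_telescope[of "\<lambda>k. s k x"])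
    then have "convergent (\<lambda>n. (s n x - s 0 x) + s 0 x)" by (intro convergent_add convergent_const)
    then show ?case by (simp add: g_def convergent_LIMSEQ_iff)
  qed
  have fatou: "(\<integral>\<^sup>+x. ennreal ((cmod (g x - s k x))\<^sup>2) \<partial>\<mu>) \<le> ennreal ((1 / 4) ^ k)" for k
  proof -
    have "(\<integral>\<^sup>+x. ennreal ((cmod (g x - s k x))\<^sup>2) \<partial>\<mu>)
        = (\<integral>\<^sup>+x. liminf (\<lambda>j. ennreal ((cmod (s j x - s k x))\<^sup>2)) \<partial>\<mu>)"
    proof (rule nn_integral_cong_AE)
      show "AE x in \<mu>. ennreal ((cmod (g x - s k x))\<^sup>2) = liminf (\<lambda>j. ennreal ((cmod (s j x - s k x))\<^sup>2))"
        using lim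
      proof eventually_elim
        case (elim x)
        then have "(\<lambda>j. ennreal ((cmod (s j x - s k x))\<^sup>2)) \<longlonglongrightarrow> ennreal ((cmod (g x - s k x))\<^sup>2)"
          by (intro tendsto_intros)
        then show ?case by (intro lim_imp_Liminf[symmetric]) auto
      qed
    qed
    also have "\<dots> \<le> liminf (\<lambda>j. \<integral>\<^sup>+x. ennreal ((cmod (s j x - s k x))\<^sup>2) \<partial>\<mu>)"
      by (rule nn_integral_liminf) measurable
    also have "\<dots> \<le> liminf (\<lambda>j. ennreal ((1 / 4) ^ k))"
    proof (rule Liminf_mono)
      show "\<forall>\<^sub>F j in sequentially. (\<integral>\<^sup>+x. ennreal ((cmod (s j x - s k x))\<^sup>2) \<partial>\<mu>) \<le> ennreal ((1 / 4) ^ k)"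
        using eventually_ge_at_top[of k]
      proof eventually_elim
        case (elim j)
        have "integrable \<mu> (\<lambda>x. (cmod (s j x - s k x))\<^sup>2)"
          using square_integrable_minus[OF s[of j] s[of k]] by (simp add: square_integrable_def)
        then have "(\<integral>\<^sup>+x. ennreal ((cmod (s j x - s k x))\<^sup>2) \<partial>\<mu>) = ennreal (LINT x|\<mu>. (cmod (s j x - s k x))\<^sup>2)"
          by (intro nn_integral_eq_integral) auto
        then show ?case using cauchy[OF elim] by (simp add: ennreal_leI del: ennreal_le_iff2)
      qed
    qed
    finally show ?thesis by (simp add: Liminf_const)
  qed
  have int: "integrable \<mu> (\<lambda>x. (cmod (g x - s k x))\<^sup>2)" for k
    using fatou[of k] by (intro integrableI_bounded) (auto simp: order_le_less_trans)
  have "(LINT x|\<mu>. (cmod (g x - s k x))\<^sup>2) \<le> (1 / 4) ^ k" for k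
    using fatou[of k] nn_integral_eq_integral[OF int[of k]] by simp
  then have "\<forall>\<^sub>F k in sequentially. norm (LINT x|\<mu>. (cmod (g x - s k x))\<^sup>2) \<le> (1 / 4) ^ k"
    by simp
  moreover have "(\<lambda>k. (1 / 4 :: real) ^ k) \<longlonglongrightarrow> 0" by (rule LIMSEQ_power_zero) simp
  ultimately have lim_int: "(\<lambda>k. LINT x|\<mu>. (cmod (g x - s k x))\<^sup>2) \<longlonglongrightarrow> 0"
    by (rule Lim_null_comparison)
  have "square_integrable \<mu> (\<lambda>x. g x - s 0 x)"
    using int[of 0] by (simp add: square_integrable_def)
  from square_integrable_add[OF this s[of 0]] have "square_integrable \<mu> g" by simp
  with lim_int show ?thesis by blast
qed

text \<open>The indices \<open>N k\<close> are chosen with tails of the square sum at most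
  \<open>(1 / 4) ^ k\<close>, the rate that the completeness argument asks for. Convergence along
  this subsequence is enough to recover every coefficient and every inner product.\<close>

lemma riesz_fischer:
  assumes "f \<in> l2"
  shows "\<exists>g N. square_integrable \<mu> g \<and> strict_mono N \<and>
    (\<lambda>k. LINT x|\<mu>. (cmod (g x - psum f (N k) x))\<^sup>2) \<longlonglongrightarrow> 0"
proof -
  let ?a = "\<lambda>n. (cmod (f n))\<^sup>2"
  have sum: "summable ?a" using assms by (simp add: l2_def)
  have ev: "\<exists>M. \<forall>N\<ge>M. \<forall>m\<ge>N. (\<Sum>n\<in>{N<..m}. ?a n) \<le> (1 / 4) ^ k" for k
  proof -
    have "(1 / 4 :: real) ^ k > 0" by simp
    with sum obtain M where M: "\<forall>m\<ge>M. \<forall>n. norm (sum ?a {m..<n}) < (1 / 4) ^ k"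
      unfolding summable_Cauchy by blast
    have "(\<Sum>n\<in>{N<..m}. ?a n) \<le> (1 / 4) ^ k" if "N \<ge> M" for N m
    proof -
      have "{N<..m} = {Suc N..<Suc m}" by auto
      then show ?thesis using M[rule_format, of "Suc N" "Suc m"] that by (simp add: sum_nonneg)
    qed
    then show ?thesis by blast
  qed
  have "\<exists>N. \<forall>k. (\<forall>m\<ge>N k. (\<Sum>n\<in>{N k<..m}. ?a n) \<le> (1 / 4) ^ k) \<and> N k < N (Suc k)"
  proof (rule dependent_nat_choice)
    show "\<exists>N. \<forall>m\<ge>N. (\<Sum>n\<in>{N<..m}. ?a n) \<le> (1 / 4) ^ 0" using ev[of 0] by blast
    fix M k
    obtain M' where "\<forall>N\<ge>M'. \<forall>m\<ge>N. (\<Sum>n\<in>{N<..m}. ?a n) \<le> (1 / 4) ^ Suc k" using ev by blast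
    then show "\<exists>N. (\<forall>m\<ge>N. (\<Sum>n\<in>{N<..m}. ?a n) \<le> (1 / 4) ^ Suc k) \<and> M < N"
      by (intro exI[of _ "max M' (Suc M)"]) auto
  qed
  then obtain N where N: "\<And>k m. m \<ge> N k \<Longrightarrow> (\<Sum>n\<in>{N k<..m}. ?a n) \<le> (1 / 4) ^ k" "\<And>k. N k < N (Suc k)"
    by blast
  have mono: "strict_mono N" using N(2) by (simp add: strict_mono_Suc_iff)
  have "\<exists>g. square_integrable \<mu> g \<and> (\<lambda>k. LINT x|\<mu>. (cmod (g x - psum f (N k) x))\<^sup>2) \<longlonglongrightarrow> 0"
  proof (rule square_integrable_limit)
    fix j k :: nat assume "k \<le> j"
    then have "N k \<le> N j" using mono by (simp add: strict_mono_less_eq)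
    then show "(LINT x|\<mu>. (cmod (psum f (N j) x - psum f (N k) x))\<^sup>2) \<le> (1 / 4) ^ k"
      using N(1) by (simp add: integral_psum_diff)
  qed (rule square_integrable_psum)
  then show ?thesis using mono by blast
qed

text \<open>In the coordinates given by \<open>p\<close> the operator is multiplication by the variable, so the
  spectral measure of \<open>f\<close> is \<open>\<bar>g\<bar>\<^sup>2 \<mu>\<close>, where \<open>g\<close> has the coefficients \<open>f\<close>.\<close>

lemma spectral_measure_eq_density:
  assumes f: "f \<in> l2"
  shows "\<exists>g. g \<in> borel_measurable borel \<and>
    spectral_measure (jacobi_op b) f = density \<mu> (\<lambda>x. ennreal ((cmod (g x))\<^sup>2))"
proof -
  obtain g N where g: "square_integrable \<mu> g" and N: "strict_mono N"
    and lim: "(\<lambda>k. LINT x|\<mu>. (cmod (g x - psum f (N k) x))\<^sup>2) \<longlonglongrightarrow> 0"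
    using riesz_fischer[OF f] by blast
  note [measurable] = g[THEN square_integrable_measurable]
  have int_g: "integrable \<mu> (\<lambda>x. (cmod (g x))\<^sup>2)" using g by (simp add: square_integrable_def)
  have coeff: "(LINT x|\<mu>. p n x * g x) = f n" for n
  proof (cases "n = 0")
    case True
    then show ?thesis using f by (simp add: l2_def)
  next
    case False
    have "(\<lambda>k. LINT x|\<mu>. p n x * psum f (N k) x) \<longlonglongrightarrow> (LINT x|\<mu>. p n x * g x)"
      by (rule tendsto_integral_mult[OF square_integrable_psum g square_integrable_p lim])
    moreover have "\<forall>\<^sub>F k in sequentially. (LINT x|\<mu>. p n x * psum f (N k) x) = f n"
    proof (rule eventually_sequentiallyI)
      fix k assume "n \<le> k"
      then have "n \<le> N k" using seq_suble[OF N, of k] by simp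
      have "(LINT x|\<mu>. p n x * psum f (N k) x) = (LINT x|\<mu>. (\<Sum>m=1..N k. f m * (p n x * p m x)))"
        by (simp add: psum_def sum_distrib_left algebra_simps)
      also have "\<dots> = (\<Sum>m=1..N k. f m * (LINT x|\<mu>. p n x * p m x))"
        by (simp add: Bochner_Integration.integral_sum integrable_p_p)
      also have "\<dots> = (\<Sum>m=1..N k. if m = n then f n else 0)"
        using False by (intro sum.cong refl) (auto simp: p_orthonormal)
      finally show "(LINT x|\<mu>. p n x * psum f (N k) x) = f n"
        using \<open>n \<le> N k\<close> False by simp
    qed
    then have "(\<lambda>k. LINT x|\<mu>. p n x * psum f (N k) x) \<longlonglongrightarrow> f n"
      by (rule tendsto_eventually)
    ultimately show ?thesis by (rule LIMSEQ_unique)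
  qed
  define \<nu> where "\<nu> = density \<mu> (\<lambda>x. ennreal ((cmod (g x))\<^sup>2))"
  have "emeasure \<nu> (space \<nu>) = (\<integral>\<^sup>+x. ennreal ((cmod (g x))\<^sup>2) \<partial>\<mu>)"
    unfolding \<nu>_def by (subst emeasure_density) (auto intro!: nn_integral_cong simp: indicator_def)
  also have "\<dots> = ennreal (LINT x|\<mu>. (cmod (g x))\<^sup>2)"
    using int_g by (intro nn_integral_eq_integral) auto
  finally have "finite_measure \<nu>" by (intro finite_measureI) simp
  moreover have sets_\<nu>: "sets \<nu> = sets borel" by (simp add: \<nu>_def M_is_borel)
  ultimately have fin: "finite_borel_measure \<nu>"
    by (simp add: finite_borel_measure_def finite_borel_measure_axioms_def)
  have transform: "l2_inner (resolvent (jacobi_op b) lam f) f = borel_transform \<nu> lam"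
    if "Im lam \<noteq> 0" for lam
  proof -
    define h where "h = (\<lambda>x. 1 / (of_real x - lam) * g x)"
    define u where "u = (\<lambda>n. LINT x|\<mu>. p n x * h x)"
    have h: "square_integrable \<mu> h"
      unfolding h_def using norm_cauchy_kernel_le[OF that] by (intro square_integrable_mult g) measurable
    have u: "u \<in> l2" "jacobi_op b u n - lam * u n = f n" for n
      using resolvent_coefficients[OF g that] by (simp_all add: u_def h_def coeff)
    have res: "resolvent (jacobi_op b) lam f = u"
      unfolding resolvent_def
    proof (rule the_equality)
      show "u \<in> l2 \<and> (\<forall>n. jacobi_op b u n - lam * u n = f n)" using u by blast
      fix v assume "v \<in> l2 \<and> (\<forall>n. jacobi_op b v n - lam * v n = f n)"
      then show "v = u" using u by (intro jacobi_l2_solution_unique[OF that, of v u b f]) auto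
    qed
    have "summable (\<lambda>n. u n * cnj (f n))"
    proof (rule summable_comparison_test'[where N = 0])
      show "summable (\<lambda>n. (cmod (u n))\<^sup>2 + (cmod (f n))\<^sup>2)"
        using u(1) f by (intro summable_add) (auto simp: l2_def)
      show "norm (u n * cnj (f n)) \<le> (cmod (u n))\<^sup>2 + (cmod (f n))\<^sup>2" for n
        using norm_mult_le_squares[of "u n" "cnj (f n)"] by simp
    qed
    then have "(\<lambda>m. \<Sum>n\<le>m. u n * cnj (f n)) \<longlonglongrightarrow> l2_inner u f"
      unfolding l2_inner_def by (rule summable_LIMSEQ')
    then have L1: "(\<lambda>k. \<Sum>n\<le>N k. u n * cnj (f n)) \<longlonglongrightarrow> l2_inner u f"
      using LIMSEQ_subseq_LIMSEQ[OF _ N, unfolded o_def] by blast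
    \<comment> \<open>Parseval's identity in the making: a partial sum of the inner product of
      \<open>u\<close> and \<open>f\<close> is the pairing of \<open>h\<close> with a partial
      expansion of \<open>g\<close>, and these expansions converge in the square mean.\<close>
    have "(\<Sum>n\<le>N k. u n * cnj (f n)) = (LINT x|\<mu>. h x * cnj (psum f (N k) x))" for k
    proof -
      have "{..N k} = insert 0 {1..N k}" by auto
      then have "(\<Sum>n\<le>N k. u n * cnj (f n)) = (\<Sum>n=1..N k. u n * cnj (f n))"
        using f by (simp add: l2_def)
      also have "\<dots> = (\<Sum>n=1..N k. LINT x|\<mu>. p n x * h x * cnj (f n))"
        by (simp add: u_def)
      also have "\<dots> = (LINT x|\<mu>. (\<Sum>n=1..N k. p n x * h x * cnj (f n)))"
        by (intro Bochner_Integration.integral_sum[symmetric] integrable_mult_left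
            integrable_p_mult integrable_square_integrable h)
      also have "\<dots> = (LINT x|\<mu>. h x * cnj (psum f (N k) x))"
        by (simp add: psum_def sum_distrib_left algebra_simps)
      finally show ?thesis .
    qed
    moreover have "(\<lambda>k. LINT x|\<mu>. h x * cnj (psum f (N k) x)) \<longlonglongrightarrow> (LINT x|\<mu>. h x * cnj (g x))"
    proof (rule tendsto_integral_mult[OF _ _ h])
      show "(\<lambda>k. LINT x|\<mu>. (cmod (cnj (g x) - cnj (psum f (N k) x)))\<^sup>2) \<longlonglongrightarrow> 0"
        using lim by (simp flip: complex_cnj_diff)
    qed (intro square_integrable_cnj square_integrable_psum g)+
    ultimately have "l2_inner u f = (LINT x|\<mu>. h x * cnj (g x))"
      using LIMSEQ_unique[OF L1] by simp
    also have "\<dots> = (LINT x|\<mu>. (cmod (g x))\<^sup>2 *\<^sub>R (1 / (of_real x - lam)))"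
      by (intro Bochner_Integration.integral_cong refl)
        (simp add: h_def scaleR_conv_of_real complex_norm_square del: of_real_power)
    also have "\<dots> = borel_transform \<nu> lam"
      unfolding borel_transform_def \<nu>_def by (subst integral_density) auto
    finally show ?thesis by (simp add: res)
  qed
  have "spectral_measure (jacobi_op b) f = \<nu>"
    unfolding spectral_measure_def
  proof (rule the_equality)
    show "finite_measure \<nu> \<and> sets \<nu> = sets borel \<and>
        (\<forall>lam. Im lam \<noteq> 0 \<longrightarrow> l2_inner (resolvent (jacobi_op b) lam f) f = (LINT x|\<nu>. 1 / (of_real x - lam)))"
      using \<open>finite_measure \<nu>\<close> sets_\<nu> transform by (simp add: borel_transform_def)
    fix \<nu>'
    assume \<nu>': "finite_measure \<nu>' \<and> sets \<nu>' = sets borel \<and>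
        (\<forall>lam. Im lam \<noteq> 0 \<longrightarrow> l2_inner (resolvent (jacobi_op b) lam f) f = (LINT x|\<nu>'. 1 / (of_real x - lam)))"
    then have "finite_borel_measure \<nu>'"
      by (simp add: finite_borel_measure_def finite_borel_measure_axioms_def)
    then show "\<nu>' = \<nu>"
    proof (rule borel_transform_inj[OF _ fin])
      fix lam :: complex assume "Im lam > 0"
      then have "Im lam \<noteq> 0" by simp
      with \<nu>' transform show "borel_transform \<nu>' lam = borel_transform \<nu> lam"
        by (simp add: borel_transform_def)
    qed
  qed
  then show ?thesis unfolding \<nu>_def using square_integrable_measurable[OF g] by blast
qed

lemma purely_ac_onI:
  assumes "has_density_on \<mu> S w" "continuous_on S w" "\<forall>x\<in>S. w x \<ge> 0" "open S"
  shows "purely_ac_on (jacobi_op b) S"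
  unfolding purely_ac_on_def
proof
  fix f assume "f \<in> l2"
  then obtain g where [measurable]: "g \<in> borel_measurable borel"
    and eq: "spectral_measure (jacobi_op b) f = density \<mu> (\<lambda>x. ennreal ((cmod (g x))\<^sup>2))"
    using spectral_measure_eq_density by blast
  let ?\<nu> = "spectral_measure (jacobi_op b) f"
  have S [measurable]: "S \<in> sets borel" using assms(4) by simp
  have sets: "sets ?\<nu> = sets borel" by (simp add: eq M_is_borel)
  have space: "space ?\<nu> = UNIV" using sets_eq_imp_space_eq[OF sets] by simp
  have "null_sets (restrict_space lborel S) \<subseteq> null_sets (restrict_space ?\<nu> S)"
  proof
    fix A assume "A \<in> null_sets (restrict_space lborel S)"
    then have A: "A \<in> sets borel" "A \<subseteq> S" "emeasure lborel A = 0"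
      using S by (auto simp: null_sets_restrict_space)
    have "emeasure \<mu> A = 0"
      by (rule has_density_on_null[OF _ assms(1-4) A]) unfold_locales
    then have "A \<in> null_sets \<mu>" using A by (auto simp: null_sets_def)
    then have "A \<in> null_sets ?\<nu>"
      using absolutely_continuousI_density[of "\<lambda>x. ennreal ((cmod (g x))\<^sup>2)" \<mu>]
      by (auto simp: eq absolutely_continuous_def)
    then show "A \<in> null_sets (restrict_space ?\<nu> S)"
      using A(2) S by (auto simp: null_sets_restrict_space sets)
  qed
  then show "absolutely_continuous (restrict_space lborel S) (restrict_space ?\<nu> S)"
    by (simp add: absolutely_continuous_def)
qed

end

section \<open>Compactly supported potentials\<close>

text \<open>The branch of the inverse of \<open>z + 1 / z\<close> that maps the upper half-plane
  into the unit disc and the interval (-2, 2) to the lower half of the circle. On both sets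
  \<open>4 - lam\<^sup>2\<close> avoids the cut of \<open>csqrt\<close>, so the branch is continuous
  up to the interval.\<close>

definition joukowski_root :: "complex \<Rightarrow> complex" where
  "joukowski_root lam = (lam - \<i> * csqrt (4 - lam\<^sup>2)) / 2"

lemma joukowski_root_equation: "(joukowski_root lam)\<^sup>2 + 1 = lam * joukowski_root lam"
proof -
  define s where "s = csqrt (4 - lam\<^sup>2)"
  have "s\<^sup>2 = 4 - lam\<^sup>2" by (simp add: s_def)
  moreover have "2 * joukowski_root lam = lam - \<i> * s" by (simp add: joukowski_root_def s_def)
  moreover have "\<i>\<^sup>2 = -1" by simp
  ultimately have "4 * ((joukowski_root lam)\<^sup>2 + 1) = 4 * (lam * joukowski_root lam)" by algebra
  then show ?thesis by (subst (asm) mult_left_cancel) simp_all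
qed

lemma joukowski_root_nonzero [simp]: "joukowski_root lam \<noteq> 0"
  using joukowski_root_equation[of lam] by auto

lemma joukowski_root_inverse: "joukowski_root lam + 1 / joukowski_root lam = lam"
  using joukowski_root_equation[of lam] by (simp add: field_simps power2_eq_square)

lemma not_nonpos_4_minus_square:
  assumes "Im lam > 0 \<or> Im lam = 0 \<and> \<bar>Re lam\<bar> < 2"
  shows "4 - lam\<^sup>2 \<notin> \<real>\<^sub>\<le>\<^sub>0"
proof
  assume "4 - lam\<^sup>2 \<in> \<real>\<^sub>\<le>\<^sub>0"
  then have *: "Re lam * Im lam = 0" "4 \<le> (Re lam)\<^sup>2 - (Im lam)\<^sup>2"
    by (auto simp: complex_nonpos_Reals_iff Re_power2 Im_power2)
  show False
  proof (cases "Im lam = 0")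
    case True
    then have "\<bar>Re lam\<bar>\<^sup>2 < 2\<^sup>2" using assms by (intro power_strict_mono) auto
    then show False using * True by simp
  next
    case False
    then have "Re lam = 0" using *(1) by simp
    then show False using *(2) zero_le_power2[of "Im lam"] by simp
  qed
qed

lemma continuous_on_joukowski_root:
  assumes "\<And>lam. lam \<in> A \<Longrightarrow> Im lam > 0 \<or> Im lam = 0 \<and> \<bar>Re lam\<bar> < 2"
  shows "continuous_on A joukowski_root"
  unfolding joukowski_root_def
  by (intro continuous_intros continuous_on_compose2[of "- \<real>\<^sub>\<le>\<^sub>0" csqrt A "\<lambda>lam. 4 - lam\<^sup>2"])
    (use assms not_nonpos_4_minus_square in
      \<open>auto intro!: continuous_at_imp_continuous_on continuous_at_csqrt\<close>)

text \<open>Writing \<open>lam\<close> as A + iB and the square root as P + iQ, the relation (P^2 -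
  B^2)(A^2 + P^2) = 4 P^2 gives B < P, so Im z < 0. Then Im lam = Im z (1 - 1/|z|^2) > 0 forces |z|
  < 1.\<close>

lemma norm_joukowski_root_less_1:
  assumes "Im lam > 0"
  shows "cmod (joukowski_root lam) < 1"
proof -
  define s z where "s = csqrt (4 - lam\<^sup>2)" and "z = joukowski_root lam"
  have s2: "s\<^sup>2 = 4 - lam\<^sup>2" by (simp add: s_def)
  have "Re s > 0"
  proof -
    have "Re s \<noteq> 0"
    proof
      assume "Re s = 0"
      then have "s\<^sup>2 \<in> \<real>\<^sub>\<le>\<^sub>0" by (simp add: complex_nonpos_Reals_iff Re_power2 Im_power2)
      then show False using not_nonpos_4_minus_square[of lam] assms s2 by simp
    qed
    then show ?thesis using csqrt_principal[of "4 - lam\<^sup>2"] by (simp add: s_def)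
  qed
  define A B P Q where "A = Re lam" and "B = Im lam" and "P = Re s" and "Q = Im s"
  have eqs: "P\<^sup>2 - Q\<^sup>2 = 4 - (A\<^sup>2 - B\<^sup>2)" "P * Q = - (A * B)"
    using arg_cong[OF s2, of Re] arg_cong[OF s2, of Im]
    by (simp_all add: Re_power2 Im_power2 A_def B_def P_def Q_def mult.commute)
  have "(P\<^sup>2 - B\<^sup>2) * (A\<^sup>2 + P\<^sup>2) = P\<^sup>2 * (P\<^sup>2 + (A\<^sup>2 - B\<^sup>2)) - (A * B)\<^sup>2"
    by (simp add: algebra_simps power2_eq_square)
  also have "(A * B)\<^sup>2 = P\<^sup>2 * Q\<^sup>2"
    using eqs(2) by (metis power2_minus power_mult_distrib)
  also have "P\<^sup>2 * (P\<^sup>2 + (A\<^sup>2 - B\<^sup>2)) - P\<^sup>2 * Q\<^sup>2 = P\<^sup>2 * (P\<^sup>2 - Q\<^sup>2 + (A\<^sup>2 - B\<^sup>2))"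
    by (simp add: algebra_simps)
  also have "\<dots> = 4 * P\<^sup>2" using eqs(1) by simp
  also have "\<dots> > 0" using \<open>Re s > 0\<close> by (simp add: P_def)
  finally have "(P\<^sup>2 - B\<^sup>2) * (A\<^sup>2 + P\<^sup>2) > 0" .
  moreover have "\<not> A\<^sup>2 + P\<^sup>2 < 0" by (simp add: not_less)
  ultimately have "P\<^sup>2 - B\<^sup>2 > 0" by (simp add: zero_less_mult_iff)
  then have "B < P"
    using \<open>Re s > 0\<close> by (intro power2_less_imp_less[of B P]) (auto simp: P_def)
  then have Im_z: "Im z < 0" by (simp add: z_def joukowski_root_def B_def P_def s_def)
  have "Im (1 / z) = - Im z / (cmod z)\<^sup>2" by (simp add: Im_divide cmod_power2)
  moreover have "Im z + Im (1 / z) = Im lam"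
    using joukowski_root_inverse[of lam] by (simp add: z_def flip: plus_complex.sel)
  ultimately have "Im z * (1 - 1 / (cmod z)\<^sup>2) > 0" using assms by (simp add: algebra_simps)
  then have "1 - 1 / (cmod z)\<^sup>2 < 0" using Im_z by (simp add: zero_less_mult_iff)
  moreover have "(cmod z)\<^sup>2 > 0" by (simp add: z_def)
  ultimately have "(cmod z)\<^sup>2 < 1\<^sup>2" by (simp add: field_simps)
  then show ?thesis unfolding z_def by (rule power2_less_imp_less) simp
qed

lemma joukowski_root_of_real:
  assumes "\<bar>x\<bar> < 2"
  shows "joukowski_root (of_real x) = Complex (x / 2) (- sqrt (4 - x\<^sup>2) / 2)"
proof -
  have "\<bar>x\<bar>\<^sup>2 < 2\<^sup>2" using assms by (intro power_strict_mono) auto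
  then have "csqrt (4 - (of_real x)\<^sup>2) = of_real (sqrt (4 - x\<^sup>2))"
    using of_real_sqrt[of "4 - x\<^sup>2"] by simp
  then show ?thesis by (simp add: joukowski_root_def complex_eq_iff)
qed

lemma four_minus_square_pos: "\<bar>x\<bar> < 2 \<Longrightarrow> 4 - x\<^sup>2 > (0::real)"
  using power_strict_mono[of "\<bar>x\<bar>" 2 2] by simp

text \<open>Beyond a cut-off the recurrence has constant coefficients with characteristic root
  \<open>z\<close>; the condition at \<open>Suc n\<close> selects the purely decaying
  solution.\<close>

lemma geometric_tail_in_l2:
  assumes "v 0 = 0" and rec: "\<And>k. k > n \<Longrightarrow> v (Suc k) = lam * v k - v (k - 1)"
    and "v (Suc n) = z * v n" "z\<^sup>2 + 1 = lam * z" "cmod z < 1"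
  shows "v \<in> l2"
proof -
  have "v (n + j) = z ^ j * v n \<and> v (n + Suc j) = z ^ Suc j * v n" for j
  proof (induction j)
    case 0
    then show ?case using assms(3) by simp
  next
    case (Suc j)
    have "v (n + Suc (Suc j)) = lam * v (n + Suc j) - v (n + j)"
      using rec[of "n + Suc j"] by simp
    also have "\<dots> = z ^ j * (lam * z - 1) * v n"
      using Suc by (simp add: algebra_simps)
    also have "lam * z - 1 = z\<^sup>2" using assms(4) by (simp add: algebra_simps)
    finally show ?case using Suc by (simp add: power2_eq_square algebra_simps)
  qed
  then have "(cmod (v (j + n)))\<^sup>2 = (cmod (v n))\<^sup>2 * ((cmod z)\<^sup>2) ^ j" for j
    by (simp add: norm_mult norm_power power_mult_distrib add.commute mult.commute flip: power_mult)
  moreover have "(cmod z)\<^sup>2 < 1"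
    using assms(5) by (simp add: power_less_one_iff abs_square_less_1)
  then have "summable (\<lambda>j. (cmod (v n))\<^sup>2 * ((cmod z)\<^sup>2) ^ j)"
    by (intro summable_mult summable_geometric) simp
  ultimately have "summable (\<lambda>j. (cmod (v (j + n)))\<^sup>2)" by simp
  then have "summable (\<lambda>j. (cmod (v j))\<^sup>2)" by (simp add: summable_iff_shift[of "\<lambda>j. (cmod (v j))\<^sup>2" n])
  then show ?thesis using assms(1) by (simp add: l2_def)
qed

text \<open>The polynomials are real and the root is not, so a zero would force both consecutive
  polynomials to vanish, against the Wronskian.\<close>

lemma jost_nonzero_real:
  assumes "n \<ge> 1" "\<bar>x\<bar> < 2"
  shows "first_kind b (Suc n) (of_real x) - joukowski_root (of_real x) * first_kind b n (of_real x) \<noteq> 0"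
proof
  let ?z = "joukowski_root (of_real x)"
  assume *: "first_kind b (Suc n) (of_real x) - ?z * first_kind b n (of_real x) = 0"
  have "Im ?z \<noteq> 0" using four_minus_square_pos[OF assms(2)] by (simp add: joukowski_root_of_real assms)
  moreover have "Im ?z * first_kind_real b n x = 0"
    using arg_cong[OF *, of Im] by (simp add: first_kind_of_real)
  ultimately have "first_kind b n (of_real x) = 0" by (simp add: first_kind_of_real)
  with * have "first_kind b (Suc n) (of_real x) = 0" by simp
  with \<open>first_kind b n (of_real x) = 0\<close> wronskian[OF assms(1), of b "of_real x"] show False by simp
qed

definition truncate_seq :: "nat \<Rightarrow> (nat \<Rightarrow> real) \<Rightarrow> nat \<Rightarrow> real" where
  "truncate_seq n b k = (if k \<le> n then b k else 0)"

lemma first_kind_truncate_seq: "k \<le> Suc n \<Longrightarrow> first_kind (truncate_seq n b) k = first_kind b k"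
  by (rule ext, rule first_kind_cong) (simp add: truncate_seq_def)

lemma second_kind_truncate_seq: "k \<le> Suc n \<Longrightarrow> second_kind (truncate_seq n b) k = second_kind b k"
  by (rule ext, rule second_kind_cong) (simp add: truncate_seq_def)

text \<open>The number for which \<open>second_kind\<close> plus this multiple of
  \<open>first_kind\<close> gets multiplied by \<open>joukowski_root lam\<close> from
  \<open>n\<close> to \<open>Suc n\<close>, so that past the cut-off it continues as the decaying
  solution.\<close>

definition truncated_m :: "nat \<Rightarrow> (nat \<Rightarrow> real) \<Rightarrow> complex \<Rightarrow> complex" where
  "truncated_m n b lam =
     - (second_kind b (Suc n) lam - joukowski_root lam * second_kind b n lam)
     / (first_kind b (Suc n) lam - joukowski_root lam * first_kind b n lam)"

text \<open>At a zero the polynomials of the truncated sequence would decay geometrically, making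
  \<open>lam\<close> a nonreal eigenvalue.\<close>

lemma jost_nonzero_upper:
  assumes "n \<ge> 1" "Im lam > 0"
  shows "first_kind b (Suc n) lam - joukowski_root lam * first_kind b n lam \<noteq> 0"
proof
  assume *: "first_kind b (Suc n) lam - joukowski_root lam * first_kind b n lam = 0"
  have "(\<lambda>k. first_kind (truncate_seq n b) k lam) \<in> l2"
  proof (rule geometric_tail_in_l2)
    show "first_kind (truncate_seq n b) (Suc n) lam = joukowski_root lam * first_kind (truncate_seq n b) n lam"
      using * by (simp add: first_kind_truncate_seq)
    show "first_kind (truncate_seq n b) (Suc k) lam
        = lam * first_kind (truncate_seq n b) k lam - first_kind (truncate_seq n b) (k - 1) lam" if "k > n" for k
      using that by (simp add: first_kind_rec truncate_seq_def)
  qed (simp_all add: joukowski_root_equation norm_joukowski_root_less_1 assms)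
  then show False using first_kind_not_in_l2[of lam "truncate_seq n b"] assms by simp
qed

lemma weyl_m_truncate_seq:
  assumes "n \<ge> 1" "Im lam > 0"
  shows "weyl_m (truncate_seq n b) lam = truncated_m n b lam"
proof (rule weyl_m_eqI)
  let ?m = "truncated_m n b lam" and ?b = "truncate_seq n b" and ?z = "joukowski_root lam"
  show "(\<lambda>k. second_kind ?b k lam + ?m * first_kind ?b k lam) \<in> l2"
  proof (rule geometric_tail_in_l2)
    have "?m * (first_kind b (Suc n) lam - ?z * first_kind b n lam)
        = - (second_kind b (Suc n) lam - ?z * second_kind b n lam)"
      using jost_nonzero_upper[OF assms, of b] by (simp add: truncated_m_def)
    then show "second_kind ?b (Suc n) lam + ?m * first_kind ?b (Suc n) lam
        = ?z * (second_kind ?b n lam + ?m * first_kind ?b n lam)"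
      by (simp add: first_kind_truncate_seq second_kind_truncate_seq algebra_simps)
    show "second_kind ?b (Suc k) lam + ?m * first_kind ?b (Suc k) lam
        = lam * (second_kind ?b k lam + ?m * first_kind ?b k lam)
          - (second_kind ?b (k - 1) lam + ?m * first_kind ?b (k - 1) lam)" if "k > n" for k
      using that assms by (simp add: first_kind_rec second_kind_rec truncate_seq_def algebra_simps)
  qed (simp_all add: joukowski_root_equation norm_joukowski_root_less_1 assms)
qed (use assms in simp)

definition truncated_density :: "nat \<Rightarrow> (nat \<Rightarrow> real) \<Rightarrow> real \<Rightarrow> real" where
  "truncated_density n b x = sqrt (4 - x\<^sup>2) / (2 * pi *
     (cmod (first_kind b (Suc n) (of_real x) - joukowski_root (of_real x) * first_kind b n (of_real x)))\<^sup>2)"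

text \<open>With numerator N and denominator D, both having real polynomials as coefficients, Im (N
  * cnj D) is Im z times the Wronskian. This leaves -Im z / |D|^2, and -Im z is half of
  \<open>sqrt (4 - x\<^sup>2)\<close>.\<close>

lemma Im_truncated_m_real:
  assumes "n \<ge> 1" "\<bar>x\<bar> < 2"
  shows "Im (truncated_m n b (of_real x)) = pi * truncated_density n b x"
proof -
  let ?z = "joukowski_root (of_real x)"
  define N D where "N = second_kind b (Suc n) (of_real x) - ?z * second_kind b n (of_real x)"
    and "D = first_kind b (Suc n) (of_real x) - ?z * first_kind b n (of_real x)"
  have D: "D \<noteq> 0" unfolding D_def by (rule jost_nonzero_real[OF assms])
  have im: "Im (second_kind b k (of_real x)) = 0" "Im (first_kind b k (of_real x)) = 0" for k
    using arg_cong[OF cnj_second_kind[of b k "of_real x"], of Im]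
      arg_cong[OF cnj_first_kind[of b k "of_real x"], of Im] by simp_all
  have "Im (N * cnj D) = Im ?z * Re (first_kind b n (of_real x) * second_kind b (Suc n) (of_real x)
      - second_kind b n (of_real x) * first_kind b (Suc n) (of_real x))"
    by (simp add: N_def D_def im algebra_simps)
  also have "\<dots> = Im ?z" unfolding wronskian[OF assms(1)] by simp
  finally have "Im (N / D) = Im ?z / (cmod D)\<^sup>2"
    by (simp add: complex_div_cnj[of N D] Im_divide_of_real flip: of_real_power)
  moreover have "truncated_m n b (of_real x) = - (N / D)"
    unfolding truncated_m_def N_def D_def by (rule minus_divide_left[symmetric])
  ultimately show ?thesis
    using assms by (simp add: joukowski_root_of_real truncated_density_def D_def)
qed

lemma continuous_on_truncated_m:
  assumes "n \<ge> 1" "\<And>lam. lam \<in> A \<Longrightarrow> Im lam > 0 \<or> Im lam = 0 \<and> \<bar>Re lam\<bar> < 2"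
  shows "continuous_on A (truncated_m n b)"
  unfolding truncated_m_def
proof (intro continuous_intros continuous_on_joukowski_root assms(2))
  show "\<forall>lam\<in>A. first_kind b (Suc n) lam - joukowski_root lam * first_kind b n lam \<noteq> 0"
  proof
    fix lam assume "lam \<in> A"
    from assms(2)[OF this] show "first_kind b (Suc n) lam - joukowski_root lam * first_kind b n lam \<noteq> 0"
    proof
      assume "Im lam = 0 \<and> \<bar>Re lam\<bar> < 2"
      then have "lam = of_real (Re lam)" "\<bar>Re lam\<bar> < 2" by (simp_all add: complex_eq_iff)
      then show ?thesis using jost_nonzero_real[OF assms(1), of "Re lam" b] by metis
    qed (rule jost_nonzero_upper[OF assms(1)])
  qed
qed auto

lemma continuous_on_truncated_density:
  assumes "n \<ge> 1"
  shows "continuous_on {-2<..<2} (truncated_density n b)"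
  unfolding truncated_density_def
proof (intro continuous_intros ballI)
  show "continuous_on {-2<..<2} (\<lambda>x. joukowski_root (complex_of_real x))"
    by (rule continuous_on_compose2[OF continuous_on_joukowski_root[of "of_real ` {-2<..<2}"]])
      (auto intro!: continuous_intros)
  fix x :: real assume "x \<in> {-2<..<2}"
  then show "2 * pi * (cmod (first_kind b (Suc n) (of_real x) - joukowski_root (of_real x) * first_kind b n (of_real x)))\<^sup>2 \<noteq> 0"
    using jost_nonzero_real[OF assms, of x b] by (auto simp: abs_less_iff)
qed

lemma has_density_on_truncate_seq:
  assumes "n \<ge> 1" "orthonormalizing (truncate_seq n b) R \<mu>"
  shows "has_density_on \<mu> {-2<..<2} (truncated_density n b)"
  unfolding has_density_on_def
proof (intro allI impI)
  fix s t :: real assume st: "s < t" "{s..t} \<subseteq> {-2<..<2}"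
  interpret jacobi_measure \<mu> "truncate_seq n b" R
    using assms(2) by (simp add: jacobi_measure_def jacobi_measure_axioms_def orthonormalizing_def)
  \<comment> \<open>Midpoints between the given end points and -2 or 2: they enlarge the interval on
    both sides, as the inversion lemma needs, without leaving (-2, 2).\<close>
  define a b' where "a = (s - 2) / 2" and "b' = (t + 2) / 2"
  have "s \<in> {s..t}" "t \<in> {s..t}" using st(1) by auto
  with st(2) have "s \<in> {-2<..<2}" "t \<in> {-2<..<2}" by blast+
  then have "-2 < s" "t < 2" by auto
  then have ab: "-2 < a" "a < s" "t < b'" "b' < 2" by (auto simp: a_def b'_def)
  define e :: "nat \<Rightarrow> real" where "e = (\<lambda>k. 1 / real (Suc k))"
  have e: "e k > 0" "e k \<le> 1" "e \<longlonglongrightarrow> 0" for k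
    unfolding e_def using LIMSEQ_Suc[OF lim_1_over_n] by simp_all
  \<comment> \<open>A compact rectangle resting on the real axis. Continuity of
    \<open>truncated_m\<close> there yields both the boundary values and the uniform bound for
    dominated convergence.\<close>
  define A where "A = (\<lambda>(x, y). Complex x y) ` ({a..b'} \<times> {0..1})"
  have A: "Im lam > 0 \<or> Im lam = 0 \<and> \<bar>Re lam\<bar> < 2" if "lam \<in> A" for lam
    using that ab by (auto simp: A_def)
  have cont: "continuous_on A (truncated_m n b)"
    by (rule continuous_on_truncated_m[OF assms(1) A])
  have "continuous_on ({a..b'} \<times> {0..1}) (\<lambda>(x, y). Complex x y)"
    by (auto simp: case_prod_unfold Complex_eq intro!: continuous_intros)
  then have "compact A" unfolding A_def by (intro compact_continuous_image compact_Times compact_Icc)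
  from compact_continuous_bounded[OF this cont]
  obtain C where C: "\<forall>y\<in>A. cmod (truncated_m n b y) \<le> C" by blast
  have transform: "borel_transform \<mu> (Complex x (e k)) = truncated_m n b (Complex x (e k))" for x k
    using weyl_m_eq_borel_transform[of "Complex x (e k)"] weyl_m_truncate_seq[OF assms(1), of "Complex x (e k)" b] e
    by (metis complex.sel(2) less_irrefl)
  have in_A: "Complex x y \<in> A" if "x \<in> {a..b'}" "y \<in> {0..1}" for x y
    using that by (force simp: A_def)
  show "measure \<mu> {s<..t} = (LINT x|lborel. indicator {s..t} x * truncated_density n b x)"
  proof (rule stieltjes_density[where e = e and C = C])
    show "finite_borel_measure \<mu>" by unfold_locales
    show "continuous_on {a..b'} (truncated_density n b)"
      by (rule continuous_on_subset[OF continuous_on_truncated_density[OF assms(1)]]) (use ab in auto)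
    fix x assume x: "x \<in> {a..b'}"
    show "(\<lambda>k. Im (borel_transform \<mu> (Complex x (e k)))) \<longlonglongrightarrow> pi * truncated_density n b x"
    proof -
      have "(\<lambda>k. truncated_m n b (Complex x (e k))) \<longlonglongrightarrow> truncated_m n b (Complex x 0)"
      proof (rule continuous_on_tendsto_compose[OF cont])
        show "(\<lambda>k. Complex x (e k)) \<longlonglongrightarrow> Complex x 0"
          by (intro tendsto_intros e)
      qed (use in_A x e in \<open>auto simp: less_imp_le intro!: always_eventually\<close>)
      then have "(\<lambda>k. Im (truncated_m n b (Complex x (e k)))) \<longlonglongrightarrow> Im (truncated_m n b (of_real x))"
        by (simp add: tendsto_Im complex_of_real_def)
      moreover have "\<bar>x\<bar> < 2" using x ab by auto
      ultimately show ?thesis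
        using Im_truncated_m_real[OF assms(1), of x b] by (simp add: transform)
    qed
    show "\<bar>Im (borel_transform \<mu> (Complex x (e k)))\<bar> \<le> C" for k
    proof -
      have "cmod (truncated_m n b (Complex x (e k))) \<le> C"
        using C in_A[OF x, of "e k"] e by (auto simp: less_imp_le)
      then show ?thesis using abs_Im_le_cmod transform by (metis order_trans)
    qed
  qed (use e st ab in auto)
qed

section \<open>Asymptotics of solutions\<close>

text \<open>Since \<open>Y n\<close> and \<open>G n\<close> are asymptotically equal and the relative increments of \<open>Y\<close> are
  summable, a discrete Gronwall argument bounds both sequences, after which the increments of \<open>Y\<close>
  are absolutely summable.\<close>

lemma uniform_limit_perturbed_increments:
  fixes G Y :: "nat \<Rightarrow> 'a \<Rightarrow> complex" and e d \<rho> :: "nat \<Rightarrow> real"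
  assumes e: "summable e" "\<forall>n. e n \<ge> 0" and "\<rho> \<longlonglongrightarrow> 0"
    and start: "\<forall>z\<in>K. cmod (G 1 z) \<le> C0"
    and growth: "\<forall>n\<ge>1. \<forall>z\<in>K. cmod (G (Suc n) z) \<le> d n * cmod (G n z)" "\<forall>n. d n \<ge> 0"
    and incr: "\<forall>n\<ge>1. \<forall>z\<in>K. cmod (Y (Suc n) z - Y n z) \<le> e n * cmod (G n z)"
    and near: "\<forall>n\<ge>1. \<forall>z\<in>K. cmod (Y n z - G n z) \<le> \<rho> n * cmod (G n z)"
  shows "\<exists>H M. uniform_limit K G H sequentially \<and> (\<forall>n\<ge>1. \<forall>z\<in>K. cmod (G n z) \<le> M)"
proof -
  have bounded_at: "\<exists>C. \<forall>z\<in>K. cmod (G n z) \<le> C" if "n \<ge> 1" for n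
    using that
  proof (induction n rule: dec_induct)
    case (step n)
    then obtain C where C: "\<forall>z\<in>K. cmod (G n z) \<le> C" by blast
    have "cmod (G (Suc n) z) \<le> d n * C" if "z \<in> K" for z
    proof -
      have "cmod (G (Suc n) z) \<le> d n * cmod (G n z)" using growth(1) step.hyps that by simp
      also have "\<dots> \<le> d n * C" using C that growth(2) by (intro mult_left_mono) auto
      finally show ?thesis .
    qed
    then show ?case by blast
  qed (use start in blast)
  \<comment> \<open>From such an index on, \<open>G\<close> and \<open>Y\<close> agree up to a
    factor 2, so estimates can be moved between them.\<close>
  have "\<forall>\<^sub>F n in sequentially. \<rho> n < 1/2"
    using \<open>\<rho> \<longlonglongrightarrow> 0\<close> by (rule order_tendstoD) simp
  then obtain N0 where N0: "\<forall>n\<ge>N0. \<rho> n < 1/2" unfolding eventually_sequentially by blast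
  define N where "N = max 1 N0"
  have N: "N \<ge> 1" "\<rho> n < 1/2" if "n \<ge> N" for n using N0 that by (auto simp: N_def)
  have G_le: "cmod (G n z) \<le> 2 * cmod (Y n z)" and Y_le: "cmod (Y n z) \<le> 2 * cmod (G n z)"
    if "n \<ge> N" "z \<in> K" for n z
  proof -
    have "cmod (Y n z - G n z) \<le> \<rho> n * cmod (G n z)" using near N(1)[OF that(1)] that by auto
    also have "\<dots> \<le> 1/2 * cmod (G n z)" using N(2)[OF that(1)] by (intro mult_right_mono) auto
    finally have "cmod (Y n z - G n z) \<le> 1/2 * cmod (G n z)" .
    moreover have "cmod (G n z) \<le> cmod (Y n z) + cmod (Y n z - G n z)"
      using norm_triangle_ineq4[of "Y n z" "Y n z - G n z"] by simp
    moreover have "cmod (Y n z) \<le> cmod (G n z) + cmod (Y n z - G n z)"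
      using norm_triangle_ineq[of "G n z" "Y n z - G n z"] by simp
    ultimately show "cmod (G n z) \<le> 2 * cmod (Y n z)" "cmod (Y n z) \<le> 2 * cmod (G n z)"
      using norm_ge_zero[of "G n z"] by linarith+
  qed
  have N1: "N \<ge> 1" by (simp add: N_def)
  obtain C where C: "\<forall>z\<in>K. cmod (G N z) \<le> C" using bounded_at[OF N1] by blast
  have gronwall: "cmod (Y n z) \<le> 2 * \<bar>C\<bar> * exp (2 * (\<Sum>k<n. e k))" if "n \<ge> N" "z \<in> K" for n z
    using that
  proof (induction n rule: dec_induct)
    case base
    have "cmod (Y N z) \<le> 2 * cmod (G N z)" by (intro Y_le base order_refl)
    also have "\<dots> \<le> 2 * \<bar>C\<bar> * 1" using C base by fastforce
    also have "\<dots> \<le> 2 * \<bar>C\<bar> * exp (2 * (\<Sum>k<N. e k))"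
      using e(2) by (intro mult_left_mono) (auto intro!: sum_nonneg)
    finally show ?case .
  next
    case (step n)
    have "cmod (Y (Suc n) z) \<le> cmod (Y n z) + cmod (Y (Suc n) z - Y n z)"
      using norm_triangle_ineq[of "Y n z" "Y (Suc n) z - Y n z"] by simp
    also have "cmod (Y (Suc n) z - Y n z) \<le> e n * cmod (G n z)"
      using incr step N1 by auto
    also have "e n * cmod (G n z) \<le> e n * (2 * cmod (Y n z))"
      using e(2) step by (intro mult_left_mono G_le) auto
    also have "cmod (Y n z) + e n * (2 * cmod (Y n z)) = (1 + 2 * e n) * cmod (Y n z)"
      by (simp add: algebra_simps)
    also have "\<dots> \<le> exp (2 * e n) * (2 * \<bar>C\<bar> * exp (2 * (\<Sum>k<n. e k)))"
      using step by (intro mult_mono exp_ge_add_one_self) auto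
    also have "\<dots> = 2 * \<bar>C\<bar> * exp (2 * (\<Sum>k<Suc n. e k))"
      by (simp add: exp_add algebra_simps)
    finally show ?case by simp
  qed
  \<comment> \<open>One factor 2 comes from passing from \<open>G N\<close> to \<open>Y N\<close>,
    another from returning from \<open>Y\<close> to \<open>G\<close>; the 2 in the exponent comes
    from bounding the increments of \<open>Y\<close> by \<open>Y\<close> itself.\<close>
  define M where "M = 4 * \<bar>C\<bar> * exp (2 * suminf e)"
  have G_M: "cmod (G n z) \<le> M" if "n \<ge> N" "z \<in> K" for n z
  proof -
    have "cmod (G n z) \<le> 2 * (2 * \<bar>C\<bar> * exp (2 * (\<Sum>k<n. e k)))"
      using G_le[OF that] gronwall[OF that] by linarith
    also have "\<dots> \<le> 2 * (2 * \<bar>C\<bar> * exp (2 * suminf e))"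
      using e by (intro mult_left_mono) (auto intro!: sum_le_suminf)
    finally show ?thesis by (simp add: M_def)
  qed
  obtain B where B: "\<And>n z. n \<ge> 1 \<Longrightarrow> z \<in> K \<Longrightarrow> cmod (G n z) \<le> B n" using bounded_at by metis
  define M' where "M' = M + (\<Sum>n\<le>N. \<bar>B n\<bar>)"
  have "M \<ge> 0" by (simp add: M_def)
  have bound: "cmod (G n z) \<le> M'" if "n \<ge> 1" "z \<in> K" for n z
  proof (cases "n \<le> N")
    case True
    then have "\<bar>B n\<bar> \<le> (\<Sum>n\<le>N. \<bar>B n\<bar>)" by (intro member_le_sum) auto
    then show ?thesis using B[OF that] \<open>M \<ge> 0\<close> by (simp add: M'_def)
  next
    case False
    then have "cmod (G n z) \<le> M" using that by (intro G_M) auto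
    then show ?thesis by (simp add: M'_def add_increasing2 sum_nonneg)
  qed
  define D where "D = (\<lambda>i z. Y (Suc (N + i)) z - Y (N + i) z)"
  define H where "H = (\<lambda>z. Y N z + (\<Sum>i. D i z))"
  have "uniform_limit K (\<lambda>n z. \<Sum>i<n. D i z) (\<lambda>z. \<Sum>i. D i z) sequentially"
  proof (rule Weierstrass_m_test)
    fix i z assume "z \<in> K"
    then have "norm (D i z) \<le> e (N + i) * cmod (G (N + i) z)"
      unfolding D_def using incr N1 by auto
    also have "\<dots> \<le> e (N + i) * M" using e(2) \<open>z \<in> K\<close> by (intro mult_left_mono G_M) auto
    finally show "norm (D i z) \<le> e (N + i) * M" .
  next
    show "summable (\<lambda>i. e (N + i) * M)"
      using summable_ignore_initial_segment[OF e(1), of N] by (intro summable_mult2) (simp add: add.commute)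
  qed
  then have "uniform_limit K (\<lambda>n z. Y N z + (\<Sum>i<n. D i z)) H sequentially"
    unfolding H_def by (intro uniform_limit_intros)
  moreover have "Y N z + (\<Sum>i<n. D i z) = Y (N + n) z" for n z
    using sum_lessThan_telescope[of "\<lambda>i. Y (N + i) z" n] by (simp add: D_def)
  ultimately have Y_lim: "uniform_limit K (\<lambda>n z. Y (N + n) z) H sequentially" by simp
  have "uniform_limit K G H sequentially"
    unfolding uniform_limit_sequentially_iff
  proof (intro allI impI)
    fix r :: real assume "r > 0"
    then obtain n1 where n1: "\<forall>n\<ge>n1. \<forall>z\<in>K. dist (Y (N + n) z) (H z) < r / 2"
      using Y_lim unfolding uniform_limit_sequentially_iff by (meson half_gt_zero)
    have "(\<lambda>n. \<bar>\<rho> n\<bar> * M') \<longlonglongrightarrow> \<bar>0\<bar> * M'"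
      by (intro tendsto_intros assms)
    then have "\<forall>\<^sub>F n in sequentially. \<bar>\<rho> n\<bar> * M' < r / 2"
      using \<open>r > 0\<close> by (intro order_tendstoD(2)) auto
    then obtain n2 where n2: "\<forall>n\<ge>n2. \<bar>\<rho> n\<bar> * M' < r / 2"
      unfolding eventually_sequentially by blast
    show "\<exists>m. \<forall>n\<ge>m. \<forall>z\<in>K. dist (G n z) (H z) < r"
    proof (intro exI[of _ "N + n1 + n2"] allI impI ballI)
      fix n z assume n: "n \<ge> N + n1 + n2" and z: "z \<in> K"
      have "cmod (Y n z - G n z) \<le> \<rho> n * cmod (G n z)" using near n N1 z by auto
      also have "\<dots> \<le> \<bar>\<rho> n\<bar> * cmod (G n z)" by (intro mult_right_mono) auto
      also have "\<dots> \<le> \<bar>\<rho> n\<bar> * M'" using bound n N1 z by (intro mult_left_mono) auto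
      also have "\<dots> < r / 2" using n2 n by simp
      finally have "dist (G n z) (Y n z) < r / 2" by (simp add: dist_norm norm_minus_commute)
      moreover have "dist (Y n z) (H z) < r / 2" using n1[rule_format, of "n - N" z] n z by simp
      ultimately show "dist (G n z) (H z) < r"
        using dist_triangle[of "G n z" "H z" "Y n z"] by linarith
    qed
  qed
  with bound show ?thesis by blast
qed

lemma cnj_unit:
  assumes "cmod z = 1"
  shows "cnj z = 1 / z"
proof -
  have "z \<noteq> 0" "z * cnj z = 1" using assms complex_norm_square[of z] by auto
  then show ?thesis by (simp add: nonzero_eq_divide_eq mult.commute)
qed

text \<open>Variation of constants for the free recurrence. As \<open>u0\<close> and
  \<open>u1\<close> are real and \<open>cnj z = 1 / z\<close>, the conjugate of \<open>G\<close> is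
  the amplitude of the other free solution, so one complex number replaces the pair
  \<open>u0\<close>, \<open>u1\<close>, provided \<open>z\<close> and \<open>1 / z\<close>
  differ.\<close>

lemma jost_step:
  fixes z u0 u1 u2 :: complex and m :: nat
  assumes z: "cmod z = 1" "z\<^sup>2 \<noteq> 1" and "cnj u0 = u0" "cnj u1 = u1"
    and u2: "u2 = (z + 1 / z - of_real \<beta>) * u1 - u0"
  defines "G \<equiv> z ^ m * (u1 - z * u0)"
  shows "z ^ Suc m * (u2 - z * u1) = G + of_real \<beta> * (z / (z\<^sup>2 - 1)) * (G - z ^ (2 * Suc m) * cnj G)"
    and "u1 = z / (1 - z\<^sup>2) * (G / z ^ Suc m - z ^ Suc m * cnj G)"
proof -
  have z0: "z \<noteq> 0" using z by auto
  have cnjG: "cnj G = (1 / z) ^ m * (u1 - 1 / z * u0)"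
    using assms by (simp add: G_def cnj_unit)
  have zG: "z ^ Suc m * cnj G = z * u1 - u0"
    unfolding cnjG using z0 by (simp add: field_simps)
  have "z ^ (2 * Suc m) * cnj G = z ^ Suc m * (z ^ Suc m * cnj G)"
    by (simp add: mult_2 power_add)
  also have "\<dots> = z ^ Suc m * (z * u1 - u0)" by (simp only: zG)
  finally have diff: "G - z ^ (2 * Suc m) * cnj G = - (z ^ m * (z\<^sup>2 - 1) * u1)"
    by (simp add: G_def algebra_simps power2_eq_square)
  have "(z / (z\<^sup>2 - 1)) * (G - z ^ (2 * Suc m) * cnj G) = - (z ^ Suc m * u1)"
    unfolding diff using z(2) by (simp add: field_simps)
  then have "G + of_real \<beta> * (z / (z\<^sup>2 - 1)) * (G - z ^ (2 * Suc m) * cnj G)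
      = G + of_real \<beta> * (- (z ^ Suc m * u1))" by (simp only: mult.assoc)
  also have "\<dots> = z ^ Suc m * (u2 - z * u1)"
    unfolding u2 G_def using z0 by (simp add: algebra_simps)
  finally show "z ^ Suc m * (u2 - z * u1) = G + of_real \<beta> * (z / (z\<^sup>2 - 1)) * (G - z ^ (2 * Suc m) * cnj G)" ..
  have "G / z ^ Suc m = u1 / z - u0" using z0 by (simp add: G_def field_simps)
  then have "G / z ^ Suc m - z ^ Suc m * cnj G = (u1 / z - u0) - (z * u1 - u0)"
    by (simp only: zG)
  also have "\<dots> = u1 * (1 - z\<^sup>2) / z"
    using z0 by (simp add: field_simps power2_eq_square)
  finally show "u1 = z / (1 - z\<^sup>2) * (G / z ^ Suc m - z ^ Suc m * cnj G)"
    using z0 z(2) by simp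
qed

text \<open>Here \<open>T\<close> and \<open>S\<close> are approximate tails of the series of \<open>\<alpha>\<close> and \<open>\<alpha> * p\<close>: adding them cancels
  the terms linear in \<open>\<alpha>\<close>, which are not absolutely summable.\<close>

lemma harris_lutz_step:
  fixes G G' T T' S S' \<alpha> \<beta> r r' p :: complex
  assumes G: "G = G' + (\<alpha> + \<beta>) * (G' - p * cnj G')" and p: "cmod p = 1"
    and T: "T' - T = \<alpha> + r" and S: "S' - S = \<alpha> * p + r'"
  shows "cmod ((G + T * G - S * cnj G) - (G' + T' * G' - S' * cnj G'))
    \<le> (2 * cmod \<beta> + 2 * (cmod T + cmod S) * cmod (\<alpha> + \<beta>) + cmod r + cmod r') * cmod G'"
proof -
  define E D where "E = G' - p * cnj G'" and "D = (\<alpha> + \<beta>) * E"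
  have E: "cmod E \<le> 2 * cmod G'"
    unfolding E_def using norm_triangle_ineq4[of G' "p * cnj G'"] p by (simp add: norm_mult)
  have D: "cmod D \<le> cmod (\<alpha> + \<beta>) * (2 * cmod G')"
    unfolding D_def norm_mult by (intro mult_left_mono E) simp
  have T': "T' = T + \<alpha> + r" and S': "S' = S + \<alpha> * p + r'" using T S by (simp_all add: algebra_simps)
  have GD: "G = G' + D" by (simp add: G D_def E_def)
  have "(G + T * G - S * cnj G) - (G' + T' * G' - S' * cnj G')
      = D - \<alpha> * E + T * D - S * cnj D - r * G' + r' * cnj G'"
    unfolding T' S' GD by (simp add: E_def algebra_simps)
  also have "D - \<alpha> * E = \<beta> * E" by (simp add: D_def algebra_simps)
  also have "cmod (\<beta> * E + T * D - S * cnj D - r * G' + r' * cnj G')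
      \<le> cmod (\<beta> * E) + cmod (T * D) + cmod (S * cnj D) + cmod (r * G') + cmod (r' * cnj G')"
    by (intro norm_triangle_le norm_triangle_le_diff add_mono order_refl)
  also have "\<dots> = cmod \<beta> * cmod E + (cmod T + cmod S) * cmod D + (cmod r + cmod r') * cmod G'"
    by (simp add: norm_mult algebra_simps)
  also have "\<dots> \<le> cmod \<beta> * (2 * cmod G') + (cmod T + cmod S) * (cmod (\<alpha> + \<beta>) * (2 * cmod G'))
      + (cmod r + cmod r') * cmod G'"
    by (intro add_mono mult_left_mono E D order_refl) auto
  also have "\<dots> = (2 * cmod \<beta> + 2 * (cmod T + cmod S) * cmod (\<alpha> + \<beta>) + cmod r + cmod r') * cmod G'"
    by (simp add: algebra_simps)
  finally show ?thesis .
qed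

definition jost_seq :: "(nat \<Rightarrow> complex \<Rightarrow> complex) \<Rightarrow> nat \<Rightarrow> complex \<Rightarrow> complex" where
  "jost_seq u n z = z ^ n * (u (Suc n) z - z * u n z)"

text \<open>An approximate tail \<open>\<Sum>k>n. g k * \<xi> ^ k\<close>: the exact tail with \<open>g k\<close> frozen at \<open>g n\<close>. Its
  increments differ from \<open>- g n * \<xi> ^ n\<close> by a telescoping, hence summable, amount.\<close>

definition frozen_tail :: "(nat \<Rightarrow> real) \<Rightarrow> complex \<Rightarrow> nat \<Rightarrow> complex" where
  "frozen_tail g \<xi> n = of_real (g n) * \<xi> ^ Suc n / (1 - \<xi>)"

lemma frozen_tail_diff:
  assumes "\<xi> \<noteq> 1"
  shows "frozen_tail g \<xi> n - frozen_tail g \<xi> (Suc n)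
    = of_real (g (Suc n)) * \<xi> ^ Suc n + of_real (g n - g (Suc n)) * \<xi> ^ Suc n / (1 - \<xi>)"
proof -
  define X where "X = \<xi> ^ Suc n"
  have "frozen_tail g \<xi> n - frozen_tail g \<xi> (Suc n) = (of_real (g n) * X - of_real (g (Suc n)) * (\<xi> * X)) / (1 - \<xi>)"
    by (simp add: frozen_tail_def X_def diff_divide_distrib)
  also have "of_real (g n) * X - of_real (g (Suc n)) * (\<xi> * X)
      = of_real (g (Suc n)) * X * (1 - \<xi>) + of_real (g n - g (Suc n)) * X"
    by (simp add: algebra_simps)
  finally show ?thesis using assms by (simp add: X_def add_divide_distrib)
qed

lemma norm_frozen_tail_le:
  assumes "cmod \<xi> = 1" "\<eta> > 0" "\<eta> \<le> cmod (1 - \<xi>)" "g n \<ge> 0"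
  shows "cmod (frozen_tail g \<xi> n) \<le> g n / \<eta>"
  using assms by (simp add: frozen_tail_def norm_mult norm_divide norm_power frac_le)

section \<open>The oscillating potential and convergence off the resonances\<close>

locale oscillating_jacobi =
  fixes c \<omega> \<delta> \<gamma> :: real and q b :: "nat \<Rightarrow> real"
  assumes gamma: "1/2 < \<gamma>" "\<gamma> \<le> 1"
    and omega: "\<forall>k::int. \<omega> \<noteq> pi * of_int k"
    and q: "summable (\<lambda>n. \<bar>q n\<bar>)"
    and b: "\<forall>n\<ge>1. b n = c * sin (2 * \<omega> * real n + \<delta>) / real n powr \<gamma> + q n"
begin

definition g :: "nat \<Rightarrow> real" where "g n = 1 / real n powr \<gamma>"
definition \<zeta> :: complex where "\<zeta> = cis (2 * \<omega>)"
definition e1 :: complex where "e1 = of_real c * cis \<delta> / (2 * \<i>)"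
definition e2 :: complex where "e2 = - of_real c * cis (- \<delta>) / (2 * \<i>)"

lemma norm_zeta [simp]: "cmod \<zeta> = 1" by (simp add: \<zeta>_def)

lemma zeta_neq_1: "\<zeta> \<noteq> 1"
proof
  assume "\<zeta> = 1"
  then have "cos (2 * \<omega>) = 1" by (simp add: \<zeta>_def complex_eq_iff)
  then obtain k :: int where "2 * \<omega> = of_int k * 2 * pi" unfolding cos_one_2pi_int by auto
  then have "\<omega> = pi * of_int k" by simp
  then show False using omega by blast
qed

lemma g_nonneg: "g n \<ge> 0" and g_le_1: "g n \<le> 1"
  using gamma by (auto simp: g_def ge_one_powr_ge_zero divide_le_eq_1 intro: le_cases[of n 0])

text \<open>Division by zero makes \<open>g 0 = 0\<close>, so monotonicity starts at 1.\<close>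

lemma g_decreasing: "n \<ge> 1 \<Longrightarrow> g (Suc n) \<le> g n"
  using gamma by (auto simp: g_def intro!: divide_left_mono powr_mono2 mult_pos_pos)

lemma g_tendsto_0: "g \<longlonglongrightarrow> 0"
proof -
  have "(\<lambda>n. real n powr - \<gamma>) \<longlonglongrightarrow> 0"
    using gamma by (intro tendsto_neg_powr filterlim_real_sequentially) auto
  then show ?thesis by (simp add: g_def[abs_def] powr_minus_divide)
qed

text \<open>The place where \<open>\<gamma> > 1/2\<close> is decisive: products of a correction term
  with the potential are of this size.\<close>

lemma summable_g_square: "summable (\<lambda>n. (g n)\<^sup>2)"
proof -
  have "summable (\<lambda>n. real n powr (- 2 * \<gamma>))"
    using gamma by (subst summable_real_powr_iff) auto
  moreover have "real n powr (- 2 * \<gamma>) = (g n)\<^sup>2" for n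
    by (simp add: g_def power_divide powr_minus_divide power2_eq_square flip: powr_add mult_2)
  ultimately show ?thesis by simp
qed

lemma summable_g_diff: "summable (\<lambda>n. \<bar>g n - g (Suc n)\<bar>)"
proof -
  have "\<forall>\<^sub>F n in sequentially. \<bar>g n - g (Suc n)\<bar> = g n - g (Suc n)"
    by (rule eventually_sequentiallyI[of 1]) (use g_decreasing in auto)
  then show ?thesis
    using telescope_summable'[OF g_tendsto_0] by (simp add: summable_cong)
qed

lemma b_eq:
  assumes "n \<ge> 1"
  shows "complex_of_real (b n) = of_real (g n) * (e1 * \<zeta> ^ n + e2 * cnj \<zeta> ^ n) + of_real (q n)"
proof -
  let ?t = "2 * \<omega> * real n + \<delta>"
  have "cis \<delta> * \<zeta> ^ n = cis ?t" "cis (- \<delta>) * cnj \<zeta> ^ n = cis (- ?t)"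
    unfolding \<zeta>_def cis_cnj Complex.DeMoivre cis_mult by (simp_all add: algebra_simps)
  then have "e1 * \<zeta> ^ n + e2 * cnj \<zeta> ^ n = of_real c * (cis ?t - cis (- ?t)) / (2 * \<i>)"
    by (simp add: e1_def e2_def algebra_simps diff_divide_distrib)
  also have "cis t - cis (- t) = 2 * \<i> * of_real (sin t)" for t by (simp add: complex_eq_iff)
  finally have "e1 * \<zeta> ^ n + e2 * cnj \<zeta> ^ n = of_real (c * sin ?t)"
    by (simp add: algebra_simps)
  then show ?thesis using b assms by (simp add: g_def)
qed

lemma abs_q_le: "\<bar>q n\<bar> \<le> (\<Sum>n. \<bar>q n\<bar>)"
  using sum_le_suminf[OF q, of "{n}"] by simp

lemma norm_b_le: "n \<ge> 1 \<Longrightarrow> \<bar>b n\<bar> \<le> (cmod e1 + cmod e2) * g n + \<bar>q n\<bar>"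
proof -
  assume n: "n \<ge> 1"
  have "\<bar>b n\<bar> = cmod (of_real (g n) * (e1 * \<zeta> ^ n + e2 * cnj \<zeta> ^ n) + of_real (q n))"
    using b_eq[OF n] by (metis norm_of_real)
  also have "\<dots> \<le> cmod (of_real (g n) * (e1 * \<zeta> ^ n + e2 * cnj \<zeta> ^ n)) + \<bar>q n\<bar>"
    using norm_triangle_ineq by (metis norm_of_real)
  also have "cmod (of_real (g n) * (e1 * \<zeta> ^ n + e2 * cnj \<zeta> ^ n))
      \<le> g n * (cmod e1 + cmod e2)"
    unfolding norm_mult using g_nonneg[of n] norm_triangle_ineq[of "e1 * \<zeta> ^ n" "e2 * cnj \<zeta> ^ n"]
    by (intro mult_mono) (auto simp: norm_mult norm_power)
  finally show "\<bar>b n\<bar> \<le> (cmod e1 + cmod e2) * g n + \<bar>q n\<bar>" by (simp add: mult.commute)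
qed

lemma b_bounded: "\<exists>B. \<forall>n\<ge>1. \<bar>b n\<bar> \<le> B"
proof (intro exI allI impI)
  fix n :: nat assume "n \<ge> 1"
  have "(cmod e1 + cmod e2) * g n \<le> (cmod e1 + cmod e2) * 1"
    by (intro mult_left_mono g_le_1) auto
  with norm_b_le[OF \<open>n \<ge> 1\<close>] abs_q_le[of n]
  show "\<bar>b n\<bar> \<le> (cmod e1 + cmod e2) * 1 + (\<Sum>n. \<bar>q n\<bar>)" by linarith
qed

text \<open>Bounds below the denominators that depend on \<open>z\<close>: 1 - z^2 in
  \<open>amp\<close>, and those of the geometric tails that arise when the two exponentials of the
  potential are multiplied by \<open>z ^ (2 * n)\<close>. On the circle they vanish exactly at the
  excluded points.\<close>

definition nonresonant :: "real \<Rightarrow> complex set" where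
  "nonresonant \<kappa> = {z. cmod z = 1 \<and> \<kappa> \<le> cmod (1 - z\<^sup>2) \<and> \<kappa> \<le> cmod (1 - \<zeta> * z\<^sup>2)
    \<and> \<kappa> \<le> cmod (1 - cnj \<zeta> * z\<^sup>2)}"

text \<open>The recurrence is demanded from its second row on, which admits both kinds of
  polynomials.\<close>

definition solution :: "(nat \<Rightarrow> complex \<Rightarrow> complex) \<Rightarrow> bool" where
  "solution u \<longleftrightarrow> (\<forall>z. cmod z = 1 \<longrightarrow> (\<forall>n\<ge>1. cnj (u n z) = u n z \<and>
     u (Suc (Suc n)) z = (z + 1 / z - of_real (b (Suc n))) * u (Suc n) z - u n z))"

definition amp :: "complex \<Rightarrow> complex" where "amp z = z / (z\<^sup>2 - 1)"

text \<open>Approximate tail of the series of \<open>amp z * b k\<close>; \<open>corr2\<close> does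
  the same for \<open>amp z * b k * z ^ (2 * k)\<close>. The part \<open>q\<close> is left out,
  being absolutely summable already.\<close>

definition corr1 :: "nat \<Rightarrow> complex \<Rightarrow> complex" where
  "corr1 n z = amp z * (e1 * frozen_tail g \<zeta> n + e2 * frozen_tail g (cnj \<zeta>) n)"

definition corr2 :: "nat \<Rightarrow> complex \<Rightarrow> complex" where
  "corr2 n z = amp z * (e1 * frozen_tail g (\<zeta> * z\<^sup>2) n + e2 * frozen_tail g (cnj \<zeta> * z\<^sup>2) n)"

text \<open>Stated for arbitrary solutions because it is applied twice: to the first kind for the
  limit, and to the second kind for an upper bound that becomes a lower bound through the
  Wronskian.\<close>

lemma solution_jost_uniform_limit:
  assumes u: "solution u" and "\<kappa> > 0"
    and start: "\<And>z. cmod z = 1 \<Longrightarrow> cmod (jost_seq u 1 z) \<le> C0"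
  shows "\<exists>H M. uniform_limit (nonresonant \<kappa>) (jost_seq u) H sequentially
    \<and> (\<forall>n\<ge>1. \<forall>z\<in>nonresonant \<kappa>. cmod (jost_seq u n z) \<le> M)"
proof -
  let ?J = "jost_seq u" and ?K = "nonresonant \<kappa>"
  define A where "A = cmod e1 + cmod e2"
  \<comment> \<open>A common lower bound for all four tail denominators; the two without
    \<open>z\<close> are nonzero because \<open>\<omega>\<close> is not a multiple of pi.\<close>
  define \<eta> where "\<eta> = Min {\<kappa>, cmod (1 - \<zeta>), cmod (1 - cnj \<zeta>)}"
  define C where "C = A / (\<kappa> * \<eta>)"
  have "cnj \<zeta> \<noteq> 1" using zeta_neq_1 by (metis complex_cnj_cnj complex_cnj_one)
  then have eta: "\<eta> > 0" "\<eta> \<le> \<kappa>" "\<eta> \<le> cmod (1 - \<zeta>)" "\<eta> \<le> cmod (1 - cnj \<zeta>)"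
    using zeta_neq_1 assms(2) by (auto simp: \<eta>_def)
  have A: "A \<ge> 0" by (simp add: A_def)
  have C: "C \<ge> 0" using A eta assms(2) by (simp add: C_def)
  let ?a = "\<lambda>n. (A * g (Suc n) + \<bar>q (Suc n)\<bar>) / \<kappa>"
  \<comment> \<open>The terms of the Harris-Lutz estimate: the part from \<open>q\<close>, the
    product of the two corrections (each at most \<open>C * g (Suc n)\<close>) with the potential,
    and the two telescoping remainders.\<close>
  define e where "e = (\<lambda>n. 2 * (\<bar>q (Suc n)\<bar> / \<kappa>) + 4 * C * g (Suc n) * ?a n
    + 2 * C * \<bar>g n - g (Suc n)\<bar>)"
  have a_nonneg: "?a n \<ge> 0" for n using A g_nonneg assms(2) by simp
  have amp: "cmod (amp z) \<le> 1 / \<kappa>" if "z \<in> ?K" for z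
    using that assms(2) by (simp add: amp_def nonresonant_def norm_divide norm_minus_commute frac_le)
  have comb: "cmod (amp z * (e1 * x + e2 * y)) \<le> 1 / \<kappa> * (A * B)"
    if "z \<in> ?K" "cmod x \<le> B" "cmod y \<le> B" for z x y B
  proof -
    have "cmod (e1 * x + e2 * y) \<le> cmod e1 * cmod x + cmod e2 * cmod y"
      using norm_triangle_ineq[of "e1 * x" "e2 * y"] by (simp add: norm_mult)
    also have "\<dots> \<le> cmod e1 * B + cmod e2 * B"
      using that by (intro add_mono mult_left_mono) auto
    finally have "cmod (e1 * x + e2 * y) \<le> A * B" by (simp add: A_def algebra_simps)
    then show ?thesis unfolding norm_mult using amp[OF that(1)] assms(2) by (intro mult_mono) auto
  qed
  have xi: "cmod (\<zeta> * z\<^sup>2) = 1" "cmod (cnj \<zeta> * z\<^sup>2) = 1" "\<eta> \<le> cmod (1 - \<zeta> * z\<^sup>2)"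
    "\<eta> \<le> cmod (1 - cnj \<zeta> * z\<^sup>2)" "cmod z = 1" "z\<^sup>2 \<noteq> 1"
    if "z \<in> ?K" for z
    using that eta assms(2) by (auto simp: nonresonant_def norm_mult norm_power)
  have corr: "cmod (corr1 n z) \<le> C * g n" "cmod (corr2 n z) \<le> C * g n" if z: "z \<in> ?K" for n z
  proof -
    have "cmod (corr1 n z) \<le> 1 / \<kappa> * (A * (g n / \<eta>))"
      unfolding corr1_def using eta g_nonneg by (intro comb z norm_frozen_tail_le) auto
    then show "cmod (corr1 n z) \<le> C * g n" by (simp add: C_def)
    have "cmod (corr2 n z) \<le> 1 / \<kappa> * (A * (g n / \<eta>))"
      unfolding corr2_def using eta g_nonneg xi[OF z] by (intro comb z norm_frozen_tail_le) auto
    then show "cmod (corr2 n z) \<le> C * g n" by (simp add: C_def)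
  qed
  define Y where "Y = (\<lambda>n z. ?J n z + corr1 n z * ?J n z - corr2 n z * cnj (?J n z))"
  have step: "?J (Suc n) z = ?J n z + of_real (b (Suc n)) * amp z *
      (?J n z - z ^ (2 * Suc n) * cnj (?J n z))" if "n \<ge> 1" "z \<in> ?K" for n z
    using jost_step(1)[OF xi(5,6)[OF that(2)], of "u n z" "u (Suc n) z" "u (Suc (Suc n)) z" "b (Suc n)" n]
      u xi(5)[OF that(2)] that(1) by (simp add: solution_def jost_seq_def amp_def)
  have b_amp: "cmod (of_real (b (Suc n)) * amp z) \<le> ?a n" if "z \<in> ?K" for n z
  proof -
    have "cmod (of_real (b (Suc n)) * amp z) \<le> (A * g (Suc n) + \<bar>q (Suc n)\<bar>) * (1 / \<kappa>)"
      unfolding norm_mult using amp[OF that] norm_b_le[of "Suc n"] A g_nonneg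
      by (intro mult_mono) (auto simp: A_def)
    then show ?thesis by simp
  qed
  have incr: "cmod (Y (Suc n) z - Y n z) \<le> e n * cmod (?J n z)"
    if n: "n \<ge> 1" and z: "z \<in> ?K" for n z
  proof -
    \<comment> \<open>In the notation of the Harris-Lutz step, \<open>\<alpha>\<close> is the
      oscillating part of the coefficient, \<open>\<beta>\<close> the part from \<open>q\<close>,
      and \<open>r\<close>, \<open>r'\<close> are what remains because the tails use a frozen
      amplitude.\<close>
    define p where "p = z ^ (2 * Suc n)"
    define \<alpha> where "\<alpha> = amp z * (of_real (g (Suc n)) * (e1 * \<zeta> ^ Suc n + e2 * cnj \<zeta> ^ Suc n))"
    define \<beta> where "\<beta> = amp z * of_real (q (Suc n))"
    define rem :: "complex \<Rightarrow> complex" where "rem = (\<lambda>\<xi>. of_real (g n - g (Suc n)) * \<xi> ^ Suc n / (1 - \<xi>))"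
    define r where "r = amp z * (e1 * rem \<zeta> + e2 * rem (cnj \<zeta>))"
    define r' where "r' = amp z * (e1 * rem (\<zeta> * z\<^sup>2) + e2 * rem (cnj \<zeta> * z\<^sup>2))"
    have rem: "cmod (rem \<xi>) \<le> \<bar>g n - g (Suc n)\<bar> / \<eta>" if "cmod \<xi> = 1" "\<eta> \<le> cmod (1 - \<xi>)" for \<xi>
      using that eta by (simp add: rem_def norm_mult norm_divide norm_power frac_le del: of_real_diff)
    have ab: "\<alpha> + \<beta> = of_real (b (Suc n)) * amp z"
      unfolding b_eq[of "Suc n", simplified] by (simp add: \<alpha>_def \<beta>_def algebra_simps)
    have neq: "\<zeta> * z\<^sup>2 \<noteq> 1" "cnj \<zeta> * z\<^sup>2 \<noteq> 1" using xi[OF z] eta by auto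
    have pow: "(\<xi> * z\<^sup>2) ^ Suc n = \<xi> ^ Suc n * p" for \<xi>
      by (simp only: power_mult_distrib p_def power_mult)
    have "cmod (Y (Suc n) z - Y n z) \<le> (2 * cmod \<beta> + 2 * (cmod (corr1 (Suc n) z) + cmod (corr2 (Suc n) z))
        * cmod (\<alpha> + \<beta>) + cmod r + cmod r') * cmod (?J n z)"
      unfolding Y_def
    proof (rule harris_lutz_step[where p = p])
      show "?J (Suc n) z = ?J n z + (\<alpha> + \<beta>) * (?J n z - p * cnj (?J n z))"
        unfolding ab p_def by (rule step[OF n z])
      show "cmod p = 1" unfolding p_def norm_power xi(5)[OF z] by simp
      have "corr1 n z - corr1 (Suc n) z = amp z * (e1 * (frozen_tail g \<zeta> n - frozen_tail g \<zeta> (Suc n))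
          + e2 * (frozen_tail g (cnj \<zeta>) n - frozen_tail g (cnj \<zeta>) (Suc n)))"
        by (simp add: corr1_def algebra_simps)
      also have "\<dots> = \<alpha> + r"
        unfolding frozen_tail_diff[OF zeta_neq_1] frozen_tail_diff[OF \<open>cnj \<zeta> \<noteq> 1\<close>]
        by (simp add: \<alpha>_def r_def rem_def algebra_simps)
      finally show "corr1 n z - corr1 (Suc n) z = \<alpha> + r" .
      have "corr2 n z - corr2 (Suc n) z = amp z * (e1 * (frozen_tail g (\<zeta> * z\<^sup>2) n - frozen_tail g (\<zeta> * z\<^sup>2) (Suc n))
          + e2 * (frozen_tail g (cnj \<zeta> * z\<^sup>2) n - frozen_tail g (cnj \<zeta> * z\<^sup>2) (Suc n)))"
        by (simp add: corr2_def algebra_simps)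
      also have "\<dots> = amp z * (e1 * (of_real (g (Suc n)) * (\<zeta> * z\<^sup>2) ^ Suc n + rem (\<zeta> * z\<^sup>2))
          + e2 * (of_real (g (Suc n)) * (cnj \<zeta> * z\<^sup>2) ^ Suc n + rem (cnj \<zeta> * z\<^sup>2)))"
        unfolding frozen_tail_diff[OF neq(1)] frozen_tail_diff[OF neq(2)] rem_def ..
      also have "\<dots> = \<alpha> * p + r'"
        unfolding pow by (simp add: \<alpha>_def r'_def algebra_simps)
      finally show "corr2 n z - corr2 (Suc n) z = \<alpha> * p + r'" .
    qed
    also have "\<dots> \<le> e n * cmod (?J n z)"
    proof (rule mult_right_mono)
      have "cmod \<beta> \<le> 1 / \<kappa> * \<bar>q (Suc n)\<bar>"
        unfolding \<beta>_def norm_mult using amp[OF z] assms(2) by (intro mult_mono) auto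
      moreover have "cmod r \<le> 1 / \<kappa> * (A * (\<bar>g n - g (Suc n)\<bar> / \<eta>))"
        unfolding r_def using eta by (intro comb z rem) auto
      moreover have "cmod r' \<le> 1 / \<kappa> * (A * (\<bar>g n - g (Suc n)\<bar> / \<eta>))"
        unfolding r'_def using xi[OF z] by (intro comb z rem) auto
      moreover have "2 * (cmod (corr1 (Suc n) z) + cmod (corr2 (Suc n) z)) * cmod (\<alpha> + \<beta>)
          \<le> 2 * (C * g (Suc n) + C * g (Suc n)) * ?a n"
        unfolding ab using C g_nonneg by (intro mult_mono add_mono corr z b_amp order_refl) auto
      moreover have "1 / \<kappa> * (A * (\<bar>g n - g (Suc n)\<bar> / \<eta>)) = C * \<bar>g n - g (Suc n)\<bar>"
        by (simp add: C_def)
      moreover have "1 / \<kappa> * \<bar>q (Suc n)\<bar> = \<bar>q (Suc n)\<bar> / \<kappa>" by simp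
      moreover have "2 * (C * g (Suc n) + C * g (Suc n)) * ?a n = 4 * C * g (Suc n) * ?a n"
        by (simp add: algebra_simps)
      ultimately show "2 * cmod \<beta> + 2 * (cmod (corr1 (Suc n) z) + cmod (corr2 (Suc n) z)) * cmod (\<alpha> + \<beta>)
          + cmod r + cmod r' \<le> e n"
        unfolding e_def by linarith
    qed simp
    finally show ?thesis .
  qed
  show ?thesis
  proof (rule uniform_limit_perturbed_increments[where Y = Y and e = e and d = "\<lambda>n. 1 + 2 * ?a n"
        and \<rho> = "\<lambda>n. 2 * C * g n" and ?C0.0 = C0])
    have "summable (\<lambda>n. \<bar>q (Suc n)\<bar>)" using q by (subst summable_Suc_iff)
    moreover have "summable (\<lambda>n. g (Suc n) * ?a n)"
    proof (rule summable_comparison_test'[where N = 0])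
      show "summable (\<lambda>n. (A * (g (Suc n))\<^sup>2 + \<bar>q (Suc n)\<bar>) / \<kappa>)"
        using q summable_g_square
        by (intro summable_divide summable_add summable_mult) (subst summable_Suc_iff; simp)+
      fix n
      have "g (Suc n) * \<bar>q (Suc n)\<bar> \<le> 1 * \<bar>q (Suc n)\<bar>"
        by (intro mult_right_mono g_le_1) auto
      then have "g (Suc n) * (A * g (Suc n) + \<bar>q (Suc n)\<bar>) \<le> A * (g (Suc n))\<^sup>2 + \<bar>q (Suc n)\<bar>"
        by (simp add: algebra_simps power2_eq_square)
      then have "g (Suc n) * (A * g (Suc n) + \<bar>q (Suc n)\<bar>) / \<kappa> \<le> (A * (g (Suc n))\<^sup>2 + \<bar>q (Suc n)\<bar>) / \<kappa>"
        using assms(2) by (intro divide_right_mono) auto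
      moreover have "g (Suc n) * ?a n \<ge> 0" using a_nonneg g_nonneg by (intro mult_nonneg_nonneg)
      ultimately show "norm (g (Suc n) * ?a n) \<le> (A * (g (Suc n))\<^sup>2 + \<bar>q (Suc n)\<bar>) / \<kappa>" by simp
    qed
    ultimately show "summable e"
      unfolding e_def mult.assoc[of "4 * C"]
      by (intro summable_add summable_mult summable_divide summable_g_diff)
    show "\<forall>n. e n \<ge> 0"
      unfolding e_def using C g_nonneg a_nonneg assms(2) by (intro allI add_nonneg_nonneg mult_nonneg_nonneg) auto
    have "(\<lambda>n. 2 * C * g n) \<longlonglongrightarrow> 2 * C * 0" by (intro tendsto_intros g_tendsto_0)
    then show "(\<lambda>n. 2 * C * g n) \<longlonglongrightarrow> 0" by simp
    show "\<forall>z\<in>?K. cmod (?J 1 z) \<le> C0" using start xi(5) by blast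
    show "\<forall>n\<ge>1. \<forall>z\<in>?K. cmod (?J (Suc n) z) \<le> (1 + 2 * ?a n) * cmod (?J n z)"
    proof (intro allI impI ballI)
      fix n :: nat and z assume nz: "1 \<le> n" "z \<in> ?K"
      let ?E = "?J n z - z ^ (2 * Suc n) * cnj (?J n z)"
      have "cmod (z ^ (2 * Suc n)) = 1" using xi(5)[OF nz(2)] by (simp add: norm_power del: power_Suc)
      then have E: "cmod ?E \<le> 2 * cmod (?J n z)"
        using norm_triangle_ineq4[of "?J n z" "z ^ (2 * Suc n) * cnj (?J n z)"]
        by (simp add: norm_mult del: power_Suc)
      have "cmod (?J (Suc n) z) \<le> cmod (?J n z) + cmod (of_real (b (Suc n)) * amp z) * cmod ?E"
        unfolding step[OF nz] using norm_triangle_ineq norm_mult by metis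
      also have "\<dots> \<le> cmod (?J n z) + ?a n * (2 * cmod (?J n z))"
        using a_nonneg by (intro add_left_mono mult_mono b_amp nz E) auto
      finally show "cmod (?J (Suc n) z) \<le> (1 + 2 * ?a n) * cmod (?J n z)"
        by (simp add: algebra_simps)
    qed
    show "\<forall>n. 1 + 2 * ?a n \<ge> 0"
      by (intro allI add_nonneg_nonneg mult_nonneg_nonneg a_nonneg) auto
    show "\<forall>n\<ge>1. \<forall>z\<in>?K. cmod (Y (Suc n) z - Y n z) \<le> e n * cmod (?J n z)"
      using incr by blast
    show "\<forall>n\<ge>1. \<forall>z\<in>?K. cmod (Y n z - ?J n z) \<le> 2 * C * g n * cmod (?J n z)"
    proof (intro allI impI ballI)
      fix n :: nat and z assume nz: "1 \<le> n" "z \<in> ?K"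
      have "Y n z - ?J n z = corr1 n z * ?J n z - corr2 n z * cnj (?J n z)"
        by (simp add: Y_def)
      also have "cmod \<dots> \<le> cmod (corr1 n z) * cmod (?J n z) + cmod (corr2 n z) * cmod (?J n z)"
        using norm_triangle_ineq4[of "corr1 n z * ?J n z" "corr2 n z * cnj (?J n z)"]
        by (simp add: norm_mult)
      also have "\<dots> \<le> C * g n * cmod (?J n z) + C * g n * cmod (?J n z)"
        by (intro add_mono mult_right_mono corr nz) auto
      finally show "cmod (Y n z - ?J n z) \<le> 2 * C * g n * cmod (?J n z)" by simp
    qed
  qed
qed

end

section \<open>The Jost function on the circle\<close>

context oscillating_jacobi
begin

abbreviation P_circle :: "nat \<Rightarrow> complex \<Rightarrow> complex" where
  "P_circle n z \<equiv> first_kind b n (z + 1 / z)"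

abbreviation Q_circle :: "nat \<Rightarrow> complex \<Rightarrow> complex" where
  "Q_circle n z \<equiv> second_kind b n (z + 1 / z)"

abbreviation J :: "nat \<Rightarrow> complex \<Rightarrow> complex" where
  "J \<equiv> jost_seq P_circle"

lemma cnj_circle_sum: "cmod z = 1 \<Longrightarrow> cnj (z + 1 / z) = z + 1 / z"
  using cnj_unit[of z] by (metis add.commute complex_cnj_add complex_cnj_cnj)

lemma solution_P_circle: "solution P_circle"
  unfolding solution_def cnj_first_kind
  by (intro allI impI conjI) (simp only: cnj_circle_sum, simp add: first_kind_rec)

lemma solution_Q_circle: "solution Q_circle"
  unfolding solution_def cnj_second_kind
  by (intro allI impI conjI) (simp only: cnj_circle_sum, simp add: second_kind_rec)

text \<open>A pointwise limit that does not mention \<open>\<kappa>\<close>, so that the uniform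
  limits on the various nonresonant sets fit together.\<close>

definition jost :: "complex \<Rightarrow> complex" where
  "jost z = lim (\<lambda>n. J n z)"

lemma jost_uniform_limit:
  assumes "\<kappa> > 0"
  shows "uniform_limit (nonresonant \<kappa>) (J) jost sequentially"
proof -
  have "cmod (J 1 z) \<le> 1 + \<bar>b 1\<bar>" if "cmod z = 1" for z
  proof -
    have "J 1 z = 1 - z * of_real (b 1)"
      using that by (auto simp: jost_seq_def algebra_simps)
    then show ?thesis using norm_triangle_ineq4[of 1 "z * of_real (b 1)"] that by (simp add: norm_mult)
  qed
  then obtain H where H: "uniform_limit (nonresonant \<kappa>) (J) H sequentially"
    using solution_jost_uniform_limit[OF solution_P_circle assms] by blast
  have "H z = jost z" if "z \<in> nonresonant \<kappa>" for z
    unfolding jost_def using tendsto_uniform_limitI[OF H that] by (rule limI[symmetric])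
  then show ?thesis using H by (metis (no_types, lifting) uniform_limit_cong')
qed

lemma norm_one_minus_square:
  assumes "cmod z = 1"
  shows "cmod (1 - z\<^sup>2) = 2 * \<bar>Im z\<bar>"
proof -
  have "1 = z * cnj z" using assms complex_norm_square[of z] by simp
  then have "1 - z\<^sup>2 = z * (cnj z - z)" by (simp add: power2_eq_square right_diff_distrib)
  then have "cmod (1 - z\<^sup>2) = cmod (cnj z - z)" using assms by (simp add: norm_mult)
  also have "cnj z - z = of_real (- 2 * Im z) * \<i>" by (simp add: complex_eq_iff)
  finally show ?thesis by (simp add: norm_mult)
qed

text \<open>For Jost combinations D and N of the first and second kind, the Wronskian gives Im (N *
  cnj D) = Im z. Hence D cannot be small where N is bounded.\<close>

lemma Im_le_norm_jost_mult:
  assumes "cmod z = 1" "n \<ge> 1"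
  shows "\<bar>Im z\<bar> \<le> cmod (J n z) * cmod (jost_seq Q_circle n z)"
proof -
  define D N where "D = P_circle (Suc n) z - z * P_circle n z"
    and "N = Q_circle (Suc n) z - z * Q_circle n z"
  have im: "Im (P_circle k z) = 0" "Im (Q_circle k z) = 0" for k
    using arg_cong[OF cnj_first_kind[of b k "z + 1 / z"], of Im]
      arg_cong[OF cnj_second_kind[of b k "z + 1 / z"], of Im]
    unfolding cnj_circle_sum[OF assms(1)] by simp_all
  have "Im (N * cnj D) = Im z * Re (P_circle n z * Q_circle (Suc n) z - Q_circle n z * P_circle (Suc n) z)"
    by (simp add: N_def D_def im algebra_simps)
  also have "\<dots> = Im z" unfolding wronskian[OF assms(2)] by simp
  finally have "\<bar>Im z\<bar> \<le> cmod (N * cnj D)" using abs_Im_le_cmod[of "N * cnj D"] by simp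
  also have "\<dots> = cmod D * cmod N" by (simp add: norm_mult)
  finally show ?thesis
    using assms(1) by (simp add: jost_seq_def norm_mult norm_power N_def D_def)
qed

text \<open>The second-kind sequence is bounded on the set, and |Im z| is at least half of
  \<open>\<kappa>\<close> there because |1 - z^2| = 2 |Im z| on the circle.\<close>

lemma jost_seq_lower_bound:
  assumes "\<kappa> > 0"
  shows "\<exists>m>0. \<forall>n\<ge>1. \<forall>z\<in>nonresonant \<kappa>. m \<le> cmod (J n z)"
proof -
  have "cmod (jost_seq Q_circle 1 z) \<le> 1" if "cmod z = 1" for z
    using that by (simp add: jost_seq_def numeral_2_eq_2)
  then obtain M where M: "\<forall>n\<ge>1. \<forall>z\<in>nonresonant \<kappa>. cmod (jost_seq Q_circle n z) \<le> M"
    using solution_jost_uniform_limit[OF solution_Q_circle assms] by blast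
  define M' where "M' = max M 1"
  have "\<kappa> / (2 * M') \<le> cmod (J n z)" if "n \<ge> 1" "z \<in> nonresonant \<kappa>" for n z
  proof -
    have z: "cmod z = 1" "\<kappa> \<le> 2 * \<bar>Im z\<bar>"
      using that(2) norm_one_minus_square[of z] by (auto simp: nonresonant_def)
    have "\<bar>Im z\<bar> \<le> cmod (J n z) * cmod (jost_seq Q_circle n z)"
      by (rule Im_le_norm_jost_mult[OF z(1) that(1)])
    also have "\<dots> \<le> cmod (J n z) * M'"
      using M that by (intro mult_left_mono) (auto simp: M'_def le_max_iff_disj)
    finally show ?thesis using z(2) by (simp add: M'_def field_simps)
  qed
  moreover have "\<kappa> / (2 * M') > 0" using assms by (simp add: M'_def)
  ultimately show ?thesis by blast
qed

lemma cis_mult_square_eq_1: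
  assumes "cis a * z\<^sup>2 = 1" "a = 2 * t"
  shows "z = cis (- t) \<or> z = - cis (- t)"
proof -
  have "z\<^sup>2 = (cis (- t))\<^sup>2"
  proof -
    have "z\<^sup>2 = cis (- a) * (cis a * z\<^sup>2)" by (simp add: cis_mult flip: mult.assoc)
    also have "\<dots> = (cis (- t))\<^sup>2" using assms by (simp add: power2_eq_square cis_mult)
    finally show ?thesis .
  qed
  then show ?thesis by (simp add: power2_eq_iff)
qed

text \<open>The minimum \<open>h\<close> of the three denominators is continuous and positive off
  the excluded points: 1 - z^2 vanishes at 1 and -1, the factor with \<open>\<zeta>\<close> at plus
  or minus \<open>cis (- \<omega>)\<close>, the factor with \<open>cnj \<zeta>\<close> at plus or
  minus \<open>cis \<omega>\<close>.\<close>

lemma punctured_circle_nonresonant: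
  assumes "compact K" "K \<subseteq> punctured_circle \<omega>"
  shows "\<exists>\<kappa>>0. K \<subseteq> nonresonant \<kappa>"
proof (cases "K = {}")
  case False
  define h where "h = (\<lambda>z. min (cmod (1 - z\<^sup>2)) (min (cmod (1 - \<zeta> * z\<^sup>2)) (cmod (1 - cnj \<zeta> * z\<^sup>2))))"
  have "continuous_on K h" unfolding h_def by (intro continuous_intros)
  then obtain x where x: "x \<in> K" "\<forall>y\<in>K. h x \<le> h y"
    using continuous_attains_inf[OF assms(1) False] by blast
  have px: "x \<in> punctured_circle \<omega>" using x assms by auto
  then have neq: "x \<noteq> 1" "x \<noteq> -1" "x \<noteq> cis \<omega>" "x \<noteq> cis (- \<omega>)" "x \<noteq> - cis \<omega>" "x \<noteq> - cis (- \<omega>)"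
    unfolding punctured_circle_def by blast+
  have "x\<^sup>2 \<noteq> 1" using neq(1,2) by (simp only: power2_eq_1_iff) blast
  moreover have "\<zeta> * x\<^sup>2 \<noteq> 1"
  proof
    assume "\<zeta> * x\<^sup>2 = 1"
    then have "x = cis (- \<omega>) \<or> x = - cis (- \<omega>)"
      by (intro cis_mult_square_eq_1[of "2 * \<omega>"]) (simp_all add: \<zeta>_def)
    then show False using neq by blast
  qed
  moreover have "cnj \<zeta> * x\<^sup>2 \<noteq> 1"
  proof
    assume "cnj \<zeta> * x\<^sup>2 = 1"
    then have "x = cis (- (- \<omega>)) \<or> x = - cis (- (- \<omega>))"
      by (intro cis_mult_square_eq_1[of "- (2 * \<omega>)"]) (simp_all add: \<zeta>_def cis_cnj)
    then show False using neq by simp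
  qed
  ultimately have "h x > 0" by (simp add: h_def)
  moreover have "K \<subseteq> nonresonant (h x)"
  proof
    fix y assume y: "y \<in> K"
    then have "h x \<le> h y" using x by blast
    moreover have "cmod y = 1" using y assms(2) by (auto simp: punctured_circle_def)
    ultimately show "y \<in> nonresonant (h x)" by (auto simp: nonresonant_def h_def)
  qed
  ultimately show ?thesis by blast
qed (auto intro: exI[of _ 1])

lemma nonresonant_subset:
  assumes "\<kappa> > 0"
  shows "nonresonant \<kappa> \<subseteq> punctured_circle \<omega>"
proof
  fix z assume z: "z \<in> nonresonant \<kappa>"
  then have neq: "1 - z\<^sup>2 \<noteq> 0" "1 - \<zeta> * z\<^sup>2 \<noteq> 0" "1 - cnj \<zeta> * z\<^sup>2 \<noteq> 0" and "cmod z = 1"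
    using assms by (auto simp: nonresonant_def)
  have "cnj \<zeta> * (cis \<omega>)\<^sup>2 = 1" "\<zeta> * (cis (- \<omega>))\<^sup>2 = 1"
    by (simp_all add: \<zeta>_def cis_cnj cis_mult power2_eq_square)
  then show "z \<in> punctured_circle \<omega>"
    using neq \<open>cmod z = 1\<close> by (auto simp: punctured_circle_def)
qed

lemma continuous_on_jost_nonresonant:
  assumes "\<kappa> > 0"
  shows "continuous_on (nonresonant \<kappa>) jost"
proof (rule uniform_limit_theorem[OF _ jost_uniform_limit[OF assms]])
  show "\<forall>\<^sub>F n in sequentially. continuous_on (nonresonant \<kappa>) (J n)"
    unfolding jost_seq_def
    by (intro always_eventually allI continuous_intros) (auto simp: nonresonant_def)
qed simp

lemma continuous_on_jost: "continuous_on (punctured_circle \<omega>) jost"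
  unfolding continuous_on_def
proof
  fix z assume z: "z \<in> punctured_circle \<omega>"
  obtain \<kappa> where k: "\<kappa> > 0" "{z} \<subseteq> nonresonant \<kappa>"
    using punctured_circle_nonresonant[of "{z}"] z by auto
  \<comment> \<open>Halving makes the inequalities at \<open>z\<close> strict, so they persist
    nearby and the set is a neighbourhood of \<open>z\<close> within the circle.\<close>
  have k2: "\<kappa> / 2 > 0" using k by simp
  have "z \<in> nonresonant (\<kappa> / 2)" using k by (auto simp: nonresonant_def)
  then have "(jost \<longlongrightarrow> jost z) (at z within nonresonant (\<kappa> / 2))"
    using continuous_on_jost_nonresonant[OF k2] by (simp add: continuous_on_def)
  moreover have "\<forall>\<^sub>F x in at z. x \<in> nonresonant (\<kappa> / 2) \<longleftrightarrow> x \<in> punctured_circle \<omega>"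
  proof -
    have lim: "((\<lambda>x. cmod (1 - a * x\<^sup>2)) \<longlongrightarrow> cmod (1 - a * z\<^sup>2)) (at z)" for a
      by (intro tendsto_intros)
    have "\<kappa> / 2 < cmod (1 - 1 * z\<^sup>2)" "\<kappa> / 2 < cmod (1 - \<zeta> * z\<^sup>2)" "\<kappa> / 2 < cmod (1 - cnj \<zeta> * z\<^sup>2)"
      using k by (auto simp: nonresonant_def)
    from this[THEN order_tendstoD(1)[OF lim]] show ?thesis
    proof eventually_elim
      case (elim x)
      then show ?case
        using nonresonant_subset[OF k2] by (auto simp: nonresonant_def punctured_circle_def)
    qed
  qed
  ultimately show "(jost \<longlongrightarrow> jost z) (at z within punctured_circle \<omega>)"
    by (rule Lim_transform_within_set)
qed

lemma jost_seq_tendsto: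
  assumes "z \<in> punctured_circle \<omega>"
  shows "(\<lambda>n. J n z) \<longlonglongrightarrow> jost z"
proof -
  obtain \<kappa> where k: "\<kappa> > 0" "{z} \<subseteq> nonresonant \<kappa>"
    using punctured_circle_nonresonant[of "{z}"] assms by auto
  show ?thesis by (rule tendsto_uniform_limitI[OF jost_uniform_limit[OF k(1)]]) (use k(2) in simp)
qed

lemma jost_nonzero:
  assumes "z \<in> punctured_circle \<omega>"
  shows "jost z \<noteq> 0"
proof -
  obtain \<kappa> where k: "\<kappa> > 0" "{z} \<subseteq> nonresonant \<kappa>"
    using punctured_circle_nonresonant[of "{z}"] assms by auto
  obtain m where m: "m > 0" "\<forall>n\<ge>1. \<forall>z\<in>nonresonant \<kappa>. m \<le> cmod (J n z)"
    using jost_seq_lower_bound[OF k(1)] by blast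
  have "m \<le> cmod (jost z)"
    by (rule LIMSEQ_le_const[OF tendsto_norm[OF jost_seq_tendsto[OF assms]]]) (use m k in auto)
  then show ?thesis using m by auto
qed

text \<open>The reconstruction formula is exact with \<open>J n\<close> in place of its limit and
  yields the polynomial of index \<open>Suc n\<close>. All powers of \<open>z\<close> are
  unimodular, so the error is at most a constant times |J n z - jost z|.\<close>

lemma first_kind_asymptotics:
  assumes z: "z \<in> punctured_circle \<omega>"
  shows "(\<lambda>n. P_circle n z - (z * jost z / (1 - z\<^sup>2) * (1 / z ^ n)
    + z * cnj (jost z) / (z\<^sup>2 - 1) * z ^ n)) \<longlonglongrightarrow> 0"
proof -
  have z1: "cmod z = 1" "z\<^sup>2 \<noteq> 1" using z by (auto simp: punctured_circle_def power2_eq_1_iff)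
  let ?d = "\<lambda>n. J n z - jost z"
  let ?e = "\<lambda>n. P_circle n z - (z * jost z / (1 - z\<^sup>2) * (1 / z ^ n) + z * cnj (jost z) / (z\<^sup>2 - 1) * z ^ n)"
  have "norm (?e (Suc n)) \<le> cmod (z / (1 - z\<^sup>2)) * (2 * cmod (?d n))" if "n \<ge> 1" for n
  proof -
    have "P_circle (Suc n) z = z / (1 - z\<^sup>2) * (J n z / z ^ Suc n - z ^ Suc n * cnj (J n z))"
      using jost_step(2)[OF z1, of "P_circle n z" "P_circle (Suc n) z" "P_circle (Suc (Suc n)) z" "b (Suc n)" n]
        solution_P_circle that z1(1) by (simp add: solution_def jost_seq_def)
    moreover have "z * cnj (jost z) / (z\<^sup>2 - 1) = - (z / (1 - z\<^sup>2) * cnj (jost z))"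
      by (metis minus_diff_eq minus_divide_right times_divide_eq_left)
    ultimately have "?e (Suc n) = z / (1 - z\<^sup>2) * (?d n / z ^ Suc n - z ^ Suc n * cnj (?d n))"
      by (simp add: algebra_simps diff_divide_distrib del: power_Suc)
    also have "cmod \<dots> \<le> cmod (z / (1 - z\<^sup>2)) * (2 * cmod (?d n))"
    proof -
      have "cmod (?d n / z ^ Suc n - z ^ Suc n * cnj (?d n)) \<le> cmod (?d n / z ^ Suc n) + cmod (z ^ Suc n * cnj (?d n))"
        by (rule norm_triangle_ineq4)
      also have "\<dots> = 2 * cmod (?d n)"
        using z1(1) by (simp add: norm_mult norm_divide norm_power del: power_Suc complex_cnj_diff)
      finally show ?thesis unfolding norm_mult by (intro mult_left_mono) auto
    qed
    finally show ?thesis .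
  qed
  then have "\<forall>\<^sub>F n in sequentially. norm (?e (Suc n)) \<le> cmod (z / (1 - z\<^sup>2)) * (2 * cmod (?d n))"
    by (intro eventually_sequentiallyI[of 1])
  moreover have "(\<lambda>n. cmod (z / (1 - z\<^sup>2)) * (2 * cmod (?d n))) \<longlonglongrightarrow> cmod (z / (1 - z\<^sup>2)) * (2 * cmod (jost z - jost z))"
    by (intro tendsto_intros jost_seq_tendsto z)
  then have "(\<lambda>n. cmod (z / (1 - z\<^sup>2)) * (2 * cmod (?d n))) \<longlonglongrightarrow> 0" by simp
  ultimately have "(\<lambda>n. ?e (Suc n)) \<longlonglongrightarrow> 0" by (rule Lim_null_comparison)
  then show ?thesis by (rule LIMSEQ_imp_Suc)
qed

section \<open>The spectral density off the resonances\<close>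

definition regular_set :: "real set" where
  "regular_set = {-2<..<2} - {2 * cos \<omega>, - 2 * cos \<omega>}"

abbreviation lower_point :: "real \<Rightarrow> complex" where
  "lower_point x \<equiv> Complex (x / 2) (- sqrt (4 - x\<^sup>2) / 2)"

definition jost_density :: "real \<Rightarrow> real" where
  "jost_density x = sqrt (4 - x\<^sup>2) / (2 * pi * (cmod (jost (lower_point x)))\<^sup>2)"

lemma open_regular_set: "open regular_set"
  unfolding regular_set_def by (intro open_Diff) auto

lemma lower_point:
  assumes "\<bar>x\<bar> < 2"
  shows "cmod (lower_point x) = 1" "lower_point x + 1 / lower_point x = of_real x"
    "joukowski_root (of_real x) = lower_point x"
proof -
  show J: "joukowski_root (of_real x) = lower_point x" by (rule joukowski_root_of_real) fact
  have "(cmod (lower_point x))\<^sup>2 = 1"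
    using four_minus_square_pos[OF assms]
    by (simp add: cmod_power2 power_divide flip: add_divide_distrib)
  then show "cmod (lower_point x) = 1"
    using norm_ge_zero[of "lower_point x"] unfolding power2_eq_1_iff by linarith
  show "lower_point x + 1 / lower_point x = of_real x"
    using joukowski_root_inverse[of "of_real x"] by (simp only: J)
qed

lemma lower_point_punctured:
  assumes "x \<in> regular_set"
  shows "lower_point x \<in> punctured_circle \<omega>"
proof -
  have x: "\<bar>x\<bar> < 2" using assms by (auto simp: regular_set_def)
  then have "sqrt (4 - x\<^sup>2) \<noteq> 0" using four_minus_square_pos[of x] by simp
  then show ?thesis
    using lower_point(1)[OF x] assms by (auto simp: punctured_circle_def regular_set_def complex_eq_iff)
qed

lemma continuous_on_lower_point: "continuous_on A lower_point"
  unfolding Complex_eq by (intro continuous_intros) auto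

lemma continuous_on_jost_density: "continuous_on regular_set jost_density"
  unfolding jost_density_def
proof (intro continuous_intros ballI)
  show "continuous_on regular_set (\<lambda>x. jost (lower_point x))"
    by (rule continuous_on_compose2[OF continuous_on_jost continuous_on_lower_point])
      (use lower_point_punctured in auto)
  fix x assume "x \<in> regular_set"
  then show "2 * pi * (cmod (jost (lower_point x)))\<^sup>2 \<noteq> 0"
    using jost_nonzero[OF lower_point_punctured] by simp
qed

lemma jost_density_nonneg:
  assumes "x \<in> regular_set"
  shows "jost_density x \<ge> 0"
proof -
  have "\<bar>x\<bar> < 2" using assms by (auto simp: regular_set_def)
  then show ?thesis using four_minus_square_pos[of x] by (simp add: jost_density_def)
qed

lemma truncated_density_eq:
  assumes "\<bar>x\<bar> < 2"
  shows "truncated_density n b x = sqrt (4 - x\<^sup>2) / (2 * pi * (cmod (J n (lower_point x)))\<^sup>2)"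
  using lower_point[OF assms] by (simp add: truncated_density_def jost_seq_def norm_mult norm_power)

lemma truncated_density_tendsto:
  assumes "x \<in> regular_set"
  shows "(\<lambda>n. truncated_density n b x) \<longlonglongrightarrow> jost_density x"
proof -
  have x: "\<bar>x\<bar> < 2" using assms by (auto simp: regular_set_def)
  show ?thesis
    unfolding truncated_density_eq[OF x] jost_density_def
    using lower_point_punctured[OF assms] jost_nonzero
    by (intro tendsto_intros jost_seq_tendsto) auto
qed

text \<open>The interval corresponds to a compact arc off the resonances, where the lower bound on
  the Jost sequence is uniform in \<open>n\<close>. This supplies the domination needed for the weak
  limit.\<close>

lemma truncated_density_bounded:
  assumes "{s..t} \<subseteq> regular_set"
  shows "\<exists>C. \<forall>n\<ge>1. \<forall>x\<in>{s..t}. \<bar>truncated_density n b x\<bar> \<le> C"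
proof -
  have "compact (lower_point ` {s..t})"
    by (intro compact_continuous_image continuous_on_lower_point compact_Icc)
  moreover have "lower_point ` {s..t} \<subseteq> punctured_circle \<omega>" using lower_point_punctured assms by auto
  ultimately obtain \<kappa> where k: "\<kappa> > 0" "lower_point ` {s..t} \<subseteq> nonresonant \<kappa>"
    using punctured_circle_nonresonant by blast
  obtain m where m: "m > 0" "\<forall>n\<ge>1. \<forall>z\<in>nonresonant \<kappa>. m \<le> cmod (J n z)"
    using jost_seq_lower_bound[OF k(1)] by blast
  have "\<bar>truncated_density n b x\<bar> \<le> 2 / (2 * pi * m\<^sup>2)" if "n \<ge> 1" "x \<in> {s..t}" for n x
  proof -
    have "x \<in> regular_set" using that(2) assms by blast
    then have x: "\<bar>x\<bar> < 2" by (auto simp: regular_set_def)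
    have "lower_point x \<in> nonresonant \<kappa>" using k(2) that(2) by blast
    then have "m \<le> cmod (J n (lower_point x))" using m(2) that(1) by blast
    then have "m\<^sup>2 \<le> (cmod (J n (lower_point x)))\<^sup>2" using m by (intro power_mono) auto
    moreover have "sqrt (4 - x\<^sup>2) \<le> sqrt 4" by (intro real_sqrt_le_mono) simp
    then have "sqrt (4 - x\<^sup>2) \<le> 2" by simp
    ultimately have "truncated_density n b x \<le> 2 / (2 * pi * m\<^sup>2)"
      unfolding truncated_density_eq[OF x] using m by (intro frac_le mult_left_mono) auto
    moreover have "truncated_density n b x \<ge> 0"
      unfolding truncated_density_eq[OF x] using four_minus_square_pos[OF x] by simp
    ultimately show ?thesis by simp
  qed
  then show ?thesis by blast
qed

lemma first_kind_real_truncate_seq: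
  "k \<le> Suc n \<Longrightarrow> first_kind_real (truncate_seq n b) k = first_kind_real b k"
  by (rule ext) (simp add: first_kind_real_def first_kind_truncate_seq)

text \<open>A single weak limit point suffices: the Weyl function and every spectral measure can be
  computed from any orthonormalizing measure. The cut-off index is \<open>Suc n\<close> because the
  explicit densities require it to be at least 1.\<close>

lemma orthonormalizing_with_jost_density:
  "\<exists>\<mu> R. orthonormalizing b R \<mu> \<and> has_density_on \<mu> regular_set jost_density"
proof -
  obtain B where B: "\<forall>n\<ge>1. \<bar>b n\<bar> \<le> B" using b_bounded by blast
  then have "B \<ge> 0" using abs_ge_zero[of "b 1"] by (meson order_trans order_refl)
  have "\<forall>n. \<exists>\<mu>. orthonormalizing (truncate_seq (Suc n) b) (B + 2) \<mu>"
    using B \<open>B \<ge> 0\<close> by (intro allI orthonormalizing_exists) (simp add: truncate_seq_def)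
  then obtain M where M: "\<And>n. orthonormalizing (truncate_seq (Suc n) b) (B + 2) (M n)" by metis
  have real: "real_distribution (M n)" and supp: "AE x in M n. \<bar>x\<bar> \<le> B + 2" for n
    using M[of n] by (simp_all add: orthonormalizing_def)
  have ev: "\<forall>\<^sub>F n in sequentially. gram (M n) b j k = of_bool (j = k)"
    if "j \<ge> 1" "k \<ge> 1" for j k
  proof (rule eventually_sequentiallyI)
    fix n assume "max j k \<le> n"
    then have "first_kind_real b j = first_kind_real (truncate_seq (Suc n) b) j"
      "first_kind_real b k = first_kind_real (truncate_seq (Suc n) b) k"
      by (simp_all add: first_kind_real_truncate_seq)
    then show "gram (M n) b j k = of_bool (j = k)"
      using M[of n] that by (simp add: orthonormalizing_def gram_def)
  qed
  have "0 \<le> B + 2" using \<open>B \<ge> 0\<close> by simp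
  from orthonormalizing_weak_limit[of M "B + 2" b, OF real supp this ev]
  obtain r \<mu> where r: "strict_mono r" "weak_conv_m (M \<circ> r) \<mu>" and \<mu>: "orthonormalizing b (B + 2) \<mu>"
    by blast
  have "has_density_on \<mu> regular_set jost_density"
  proof (rule has_density_on_weak_limit[where M = "M \<circ> r" and v = "\<lambda>n. truncated_density (Suc (r n)) b"])
    show "real_distribution ((M \<circ> r) n)" for n unfolding o_def by (rule real)
    show "real_distribution \<mu>" using \<mu> by (simp add: orthonormalizing_def)
    show "weak_conv_m (M \<circ> r) \<mu>" by (rule r)
    show "open regular_set" by (rule open_regular_set)
    show "continuous_on regular_set jost_density" by (rule continuous_on_jost_density)
    show "continuous_on regular_set (truncated_density (Suc (r n)) b)" for n
      by (rule continuous_on_subset[OF continuous_on_truncated_density]) (auto simp: regular_set_def)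
    show "has_density_on ((M \<circ> r) n) regular_set (truncated_density (Suc (r n)) b)" for n
    proof -
      have "has_density_on (M (r n)) {-2<..<2} (truncated_density (Suc (r n)) b)"
        by (rule has_density_on_truncate_seq[OF _ M]) simp
      then show ?thesis unfolding has_density_on_def regular_set_def o_def by blast
    qed
    fix x assume "x \<in> regular_set"
    from LIMSEQ_Suc[OF truncated_density_tendsto[OF this]]
    show "(\<lambda>n. truncated_density (Suc (r n)) b x) \<longlonglongrightarrow> jost_density x"
      by (rule LIMSEQ_subseq_LIMSEQ[OF _ r(1), unfolded o_def])
  next
    fix s t assume "{s..t} \<subseteq> regular_set"
    from truncated_density_bounded[OF this]
    show "\<exists>C. \<forall>n. \<forall>x\<in>{s..t}. \<bar>truncated_density (Suc (r n)) b x\<bar> \<le> C" by force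
  qed
  with \<mu> show ?thesis by blast
qed

lemma spectral_conclusions:
  "purely_ac_on (jacobi_op b) regular_set"
  "x \<in> regular_set \<Longrightarrow> has_spectral_density b x (jost_density x)"
proof -
  obtain \<mu> R where \<mu>: "orthonormalizing b R \<mu>" and dens: "has_density_on \<mu> regular_set jost_density"
    using orthonormalizing_with_jost_density by blast
  interpret jacobi_measure \<mu> b R
    using \<mu> by (simp add: jacobi_measure_def jacobi_measure_axioms_def orthonormalizing_def)
  show "purely_ac_on (jacobi_op b) regular_set"
    using jost_density_nonneg
    by (intro purely_ac_onI[OF dens continuous_on_jost_density _ open_regular_set]) auto
  assume x: "x \<in> regular_set"
  have "finite_borel_measure \<mu>" by unfold_locales
  then have "((\<lambda>\<epsilon>. Im (borel_transform \<mu> (Complex x \<epsilon>))) \<longlongrightarrow> pi * jost_density x) (at_right 0)"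
    using jost_density_nonneg
    by (intro has_density_on_poisson[OF _ dens continuous_on_jost_density _ open_regular_set x]) auto
  then have "((\<lambda>\<epsilon>. Im (borel_transform \<mu> (Complex x \<epsilon>)) / pi) \<longlongrightarrow> pi * jost_density x / pi) (at_right 0)"
    by (intro tendsto_divide tendsto_const) auto
  moreover have "\<forall>\<^sub>F \<epsilon> in at_right 0. Im (borel_transform \<mu> (Complex x \<epsilon>)) / pi = Im (weyl_m b (Complex x \<epsilon>)) / pi"
    using eventually_at_right_less[of "0::real"]
    by eventually_elim (simp add: weyl_m_eq_borel_transform)
  ultimately show "has_spectral_density b x (jost_density x)"
    unfolding has_spectral_density_def by (simp add: tendsto_cong)
qed

end

theorem theorem3:
  fixes c \<omega> \<delta> \<gamma> :: real and q b :: "nat \<Rightarrow> real"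
  assumes "1/2 < \<gamma>" and "\<gamma> \<le> 1"
    and "\<forall>k::int. \<omega> \<noteq> pi * of_int k"
    and "summable (\<lambda>n. \<bar>q n\<bar>)"
    and "\<forall>n\<ge>1. b n = c * sin (2 * \<omega> * real n + \<delta>) / real n powr \<gamma> + q n"
  shows "\<exists>F :: complex \<Rightarrow> complex.
      (\<forall>z\<in>punctured_circle \<omega>.
         (\<lambda>n. first_kind b n (z + 1 / z)
            - (z * F z / (1 - z\<^sup>2) * (1 / z ^ n) + z * cnj (F z) / (z\<^sup>2 - 1) * z ^ n))
         \<longlonglongrightarrow> 0)
    \<and> continuous_on (punctured_circle \<omega>) F
    \<and> (\<forall>z\<in>punctured_circle \<omega>. F z \<noteq> 0)
    \<and> purely_ac_on (jacobi_op b) ({-2<..<2} - {2 * cos \<omega>, - 2 * cos \<omega>})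
    \<and> (AE x in lborel. x \<in> {-2<..<2} \<longrightarrow>
         has_spectral_density b x
           (sqrt (4 - x\<^sup>2) /
             (2 * pi * (cmod (F (Complex (x / 2) (- sqrt (4 - x\<^sup>2) / 2))))\<^sup>2)))"
proof -
  interpret oscillating_jacobi c \<omega> \<delta> \<gamma> q b by unfold_locales fact+
  \<comment> \<open>The density formula is known at every point of \<open>regular_set\<close>; the
    two resonant energies missing from (-2, 2) form a null set.\<close>
  have "AE x in lborel. x \<noteq> 2 * cos \<omega>" "AE x in lborel. x \<noteq> - 2 * cos \<omega>"
    by (rule AE_lborel_singleton)+
  then have "AE x in lborel. x \<in> {-2<..<2} \<longrightarrow> has_spectral_density b x (jost_density x)"
    by eventually_elim (simp add: spectral_conclusions(2) regular_set_def)
  with spectral_conclusions(1) continuous_on_jost show ?thesis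
    unfolding jost_density_def regular_set_def
    by (intro exI[of _ jost] conjI ballI first_kind_asymptotics jost_nonzero)
qed

end
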